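(* Let $v_1,\dots,v_n \in \mathbb{R}^n$ be linearly independent, let $t \in \sum_{i=1}^n [-v_i,v_i]$, and let $K \subseteq \mathbb{R}^n$ be a convex body with $\gamma_n(K) \geq 1/2$. Then there exists a fractional coloring $x \in [-1,1]^n$ such that, for $p = \sum_{i=1}^n x_i v_i - t$, $A_x = \{i \in [n] : x_i \in (-1,1)\}$ and $W = \mathrm{span}(v_i : i \in A_x)$, the following hold: (1) $p \in K$; (2) the Gaussian measure of $(K-p)\cap W$ on $W$ (i.e. $\gamma_{\dim W}$ computed inside $W$) is at least $\gamma_n(K)$; (3) the barycenter of $(K-p)\cap W$ is at the origin, i.e. $\int_{(K-p)\cap W} y\, e^{-\|y\|_2^2/2}\,dy = 0$ (integral with respect to Lebesgue measure on $W$). By convention, if $x \in \{-1,1\}^n$ (so $W = \{0\}$), conditions (2) and (3) are regarded as satisfied.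
   Context: $\sum_{i=1}^n [-v_i,v_i] = \{\sum_i \lambda_i v_i : \lambda \in [-1,1]^n\}$. $\gamma_k$ is the standard Gaussian measure in dimension $k$: $\gamma_k(A) = (2\pi)^{-k/2}\int_A e^{-\|x\|_2^2/2}dx$; for a subspace $W$ of dimension $k$, the Gaussian measure of $A \subseteq W$ on $W$ is $\gamma_k$ computed treating $W$ as the whole space. A convex body is a closed convex set with non-empty interior. *)

theory Defs
  imports "HOL-Probability.Probability"
begin

definition zonotope :: "('n::finite \<Rightarrow> real ^ 'n) \<Rightarrow> (real ^ 'n) set" where
  "zonotope v = {\<Sum>i\<in>UNIV. (l $ i) *\<^sub>R v i | l :: real ^ 'n. \<forall>i. l $ i \<in> {-1..1}}"

definition convex_body :: "'a::euclidean_space set \<Rightarrow> bool" where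
  "convex_body K \<longleftrightarrow> closed K \<and> convex K \<and> interior K \<noteq> {}"

definition orthonormal_basis_of :: "'a::euclidean_space set \<Rightarrow> 'a set \<Rightarrow> bool" where
  "orthonormal_basis_of W B \<longleftrightarrow> pairwise orthogonal B \<and> (\<forall>b\<in>B. norm b = 1) \<and> span B = W"

lemma orthonormal_basis_of_ex:
  assumes "subspace W"
  shows "\<exists>B. orthonormal_basis_of W B"
  by (rule orthonormal_basis_subspace[OF assms]) (auto simp: orthonormal_basis_of_def)

(* Lebesgue measure on the subspace W, regarded as a measure on the Borel sets of the ambient
   space. This is the library definition of lborel with Basis replaced by an orthonormal basis
   of W; as Lebesgue measure is invariant under orthogonal maps, the choice of the basis
   does not matter. For W = {0} it is the point mass at 0. *)
definition lborel_subspace :: "'a::euclidean_space set \<Rightarrow> 'a measure" where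
  "lborel_subspace W =
     (let B = (SOME B. orthonormal_basis_of W B)
      in distr (\<Pi>\<^sub>M b\<in>B. lborel) borel (\<lambda>f. \<Sum>b\<in>B. f b *\<^sub>R b))"

definition gaussian_density :: "nat \<Rightarrow> 'a::euclidean_space \<Rightarrow> real" where
  "gaussian_density k x = (2 * pi) powr (- (real k / 2)) * exp (- (norm x)\<^sup>2 / 2)"

definition std_gaussian :: "'a::euclidean_space measure" where
  "std_gaussian = density lborel (gaussian_density DIM('a))"

definition gaussian_subspace :: "'a::euclidean_space set \<Rightarrow> 'a measure" where
  "gaussian_subspace W = density (lborel_subspace W) (gaussian_density (dim W))"

end

theory Submission
  imports Defs
begin

text \<open>
  Among all pairs of a point \<open>x\<close> of the cube and an index set \<open>A\<close> with \<open>x i \<in> {-1, 1}\<close> off \<open>A\<close> for which the section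
  of \<open>K - p\<close> by \<open>span (v ` A)\<close> has Gaussian measure at least that of \<open>K\<close>, choose one with \<open>A\<close> minimal, and then
  \<open>x\<close> maximising the measure of the section over the corresponding face of the cube. If \<open>x\<close> lay on the
  boundary of the face, then \<open>A\<close> could be made smaller, because a central hyperplane section of a convex
  set of measure at least \<open>1/2\<close> has at least the measure of the whole set. So \<open>x\<close> is an interior maximum, and the
  vanishing of the gradient there says that the barycenter of the section is the origin.

  The fact on central sections follows from Ehrhard's inequality: \<open>\<Phi>\<inverse>\<close> of the measure of the parallel sections is a
  concave function, and separating its hypograph from a point above the origin by a half-plane gives
  the estimate. Ehrhard's inequality for convex sets \<open>(1 - s) A + s B \<subseteq> C\<close> is obtained by symmetrisation. On the
  line it amounts to the concavity of \<open>(l, r) \<mapsto> \<Phi>\<inverse> (\<Phi> r - \<Phi> l)\<close>, which implies that replacing every section in a direction \<open>d\<close> by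
  a half-line of the same measure preserves the inclusion. Fix a unit vector \<open>e\<close>. Along a
  sequence of such triples, of fixed measures, that minimises the sum of the moments \<open>\<integral> x \<bullet> e\<close>, symmetrisation in
  any direction \<open>d\<close> with \<open>d \<bullet> e > 0\<close> changes the sets less and less. This forces each of the three sets to
  converge to a half-space \<open>{x. x \<bullet> e \<le> a}\<close>, where the inequality can be read off.
\<close>

section \<open>The Gaussian distribution function\<close>

abbreviation \<phi> :: "real \<Rightarrow> real" where "\<phi> \<equiv> std_normal_density"

definition Phi :: "real \<Rightarrow> real" where
  "Phi a = measure (std_gaussian :: real measure) {..a}"

lemma std_gaussian_real: "(std_gaussian :: real measure) = density lborel \<phi>"
proof -
  have "gaussian_density 1 = \<phi>"
    by (simp add: fun_eq_iff gaussian_density_def std_normal_density_def powr_minus_divide powr_half_sqrt)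
  then show ?thesis
    by (simp add: std_gaussian_def)
qed

lemma prob_space_std_gaussian_real: "prob_space (std_gaussian :: real measure)"
  unfolding std_gaussian_real by (rule prob_space_normal_density) simp

interpretation N1: prob_space "std_gaussian :: real measure"
  by (rule prob_space_std_gaussian_real)

lemma sets_std_gaussian [simp, measurable_cong]: "sets std_gaussian = sets borel"
  by (simp add: std_gaussian_def)

lemma space_std_gaussian [simp]: "space std_gaussian = UNIV"
  by (simp add: std_gaussian_def)

lemma Phi_diff_measure: "a \<le> b \<Longrightarrow> Phi b - Phi a = measure std_gaussian {a<..b}"
proof -
  assume "a \<le> b"
  then have "{..b} - {..a} = {a<..b}" by auto
  moreover have "measure (std_gaussian::real measure) ({..b} - {..a}) = Phi b - Phi a"
    unfolding Phi_def by (rule N1.finite_measure_Diff) (use \<open>a \<le> b\<close> in auto)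
  ultimately show ?thesis by simp
qed

lemma Phi_diff_integral:
  assumes "a \<le> b"
  shows "Phi b - Phi a = integral {a..b} \<phi>"
proof -
  have "Phi b - Phi a = (\<integral>x. indicator {a<..b} x \<partial>std_gaussian)"
    by (simp add: Phi_diff_measure[OF assms])
  also have "\<dots> = (\<integral>x. \<phi> x * indicator {a<..b} x \<partial>lborel)"
    unfolding std_gaussian_real by (subst integral_density) auto
  also have "\<dots> = (LINT x:{a..b}|lborel. \<phi> x)"
    unfolding set_lebesgue_integral_def
    by (rule integral_cong_AE) (use AE_lborel_singleton[of a] in \<open>auto simp: indicator_def elim!: eventually_mono\<close>)
  also have "\<dots> = integral {a..b} \<phi>"
    by (intro set_borel_integral_eq_integral borel_integrable_atLeastAtMost')
      (auto simp: std_normal_density_def intro!: continuous_intros)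
  finally show ?thesis .
qed

lemma continuous_on_phi [continuous_intros]: "continuous_on A f \<Longrightarrow> continuous_on A (\<lambda>x. \<phi> (f x))"
  unfolding std_normal_density_def by (intro continuous_intros) auto

lemma DERIV_Phi [derivative_intros]:
  assumes "(f has_field_derivative f') (at x)"
  shows "((\<lambda>x. Phi (f x)) has_field_derivative \<phi> (f x) * f') (at x)"
proof (rule DERIV_chain2[OF _ assms])
  fix x :: real
  have "((\<lambda>y. integral {x-1..y} \<phi>) has_real_derivative \<phi> x) (at x within {x-1..x+1})"
    by (rule integral_has_real_derivative) (auto intro!: continuous_intros)
  then have "((\<lambda>y. integral {x-1..y} \<phi>) has_real_derivative \<phi> x) (at x)"
    by (simp add: at_within_Icc_at)
  then have "((\<lambda>y. integral {x-1..y} \<phi> + Phi (x-1)) has_real_derivative \<phi> x) (at x)"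
    by (auto intro!: derivative_eq_intros)
  moreover have "\<forall>\<^sub>F y in nhds x. integral {x-1..y} \<phi> + Phi (x-1) = Phi y"
    unfolding eventually_nhds
    by (rule exI[of _ "{x-1<..}"]) (auto simp: Phi_diff_integral[symmetric])
  ultimately show "(Phi has_real_derivative \<phi> x) (at x)"
    by (subst (asm) DERIV_cong_ev) auto
qed

lemma DERIV_phi [derivative_intros]:
  assumes "(f has_field_derivative f') (at x)"
  shows "((\<lambda>x. \<phi> (f x)) has_field_derivative - f x * \<phi> (f x) * f') (at x)"
  by (rule DERIV_chain2[OF _ assms])
    (auto simp: std_normal_density_def field_simps intro!: derivative_eq_intros)

lemma phi_pos [simp]: "\<phi> x > 0" by (rule normal_density_pos) simp

lemma phi_le_1: "\<phi> x \<le> 1"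
proof -
  have "sqrt (2 * pi) \<ge> 1" using pi_gt3 by simp
  then show ?thesis
    unfolding std_normal_density_def
    by (intro mult_le_one) (auto simp: field_simps)
qed

lemma Phi_strict_mono: "a < b \<Longrightarrow> Phi a < Phi b"
  by (rule DERIV_pos_imp_increasing) (auto intro!: exI derivative_eq_intros)

lemma Phi_less_iff [simp]: "Phi a < Phi b \<longleftrightarrow> a < b"
  using Phi_strict_mono[of a b] Phi_strict_mono[of b a] by (cases a b rule: linorder_cases) auto

lemma Phi_le_iff [simp]: "Phi a \<le> Phi b \<longleftrightarrow> a \<le> b"
  using Phi_less_iff[of b a] by linarith

lemma Phi_inj_iff [simp]: "Phi a = Phi b \<longleftrightarrow> a = b"
  by (simp add: eq_iff)

lemma Phi_lipschitz: "a \<le> b \<Longrightarrow> Phi b - Phi a \<le> b - a"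
proof -
  assume "a \<le> b"
  have "(\<lambda>x. x - Phi x) a \<le> (\<lambda>x. x - Phi x) b"
    by (rule DERIV_nonneg_imp_nondecreasing[OF \<open>a \<le> b\<close>])
      (auto intro!: exI derivative_eq_intros simp: phi_le_1)
  then show ?thesis by simp
qed

lemma isCont_Phi [continuous_intros]: "isCont Phi x"
  by (rule DERIV_isCont[OF DERIV_Phi[OF DERIV_ident, unfolded id_def]])

lemma borel_measurable_Phi [measurable]: "Phi \<in> borel_measurable borel"
  by (rule borel_measurable_continuous_onI) (auto intro!: continuous_at_imp_continuous_on isCont_Phi)

lemma Phi_at_top: "(Phi \<longlongrightarrow> 1) at_top"
  and Phi_at_bot: "(Phi \<longlongrightarrow> 0) at_bot"
proof -
  interpret real_distribution "std_gaussian :: real measure" by standard simp_all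
  show "(Phi \<longlongrightarrow> 1) at_top" "(Phi \<longlongrightarrow> 0) at_bot"
    using cdf_lim_at_top_prob cdf_lim_at_bot by (simp_all add: cdf_def Phi_def[abs_def])
qed

lemma Phi_bounds: "0 < Phi x" "Phi x < 1"
proof -
  have "0 \<le> Phi (x - 1)" "Phi (x + 1) \<le> 1" by (simp_all add: Phi_def)
  then show "0 < Phi x" "Phi x < 1"
    using Phi_strict_mono[of "x-1" x] Phi_strict_mono[of x "x+1"] by linarith+
qed

lemma Phi_surj: "0 < p \<Longrightarrow> p < 1 \<Longrightarrow> \<exists>x. Phi x = p"
proof -
  assume p: "0 < p" "p < 1"
  obtain a where a: "Phi a < p"
    using order_tendstoD(2)[OF Phi_at_bot p(1)] by (auto simp: eventually_at_bot_linorder)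
  obtain b where b: "p < Phi b"
    using order_tendstoD(1)[OF Phi_at_top p(2)] by (auto simp: eventually_at_top_linorder)
  have "a \<le> b" using a b Phi_less_iff[of a b] by linarith
  then show ?thesis using IVT[of Phi a p b] a b by (auto intro: isCont_Phi)
qed

lemma Phi_minus: "Phi (- x) = 1 - Phi x"
proof -
  have "((\<lambda>x. Phi x + Phi (-x)) has_real_derivative 0) (at x)" for x
    by (auto intro!: derivative_eq_intros simp: std_normal_density_def)
  then have const: "Phi x + Phi (-x) = Phi y + Phi (-y)" for x y
    by (intro DERIV_isconst_all) auto
  have "((\<lambda>x. Phi x + Phi (-x)) \<longlongrightarrow> 1 + 0) at_top"
    by (intro tendsto_add Phi_at_top filterlim_compose[OF Phi_at_bot filterlim_uminus_at_bot_at_top])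
  then have "((\<lambda>y::real. Phi x + Phi (-x)) \<longlongrightarrow> 1) at_top"
    by (subst (asm) const[of _ x]) simp
  then show ?thesis by (simp add: tendsto_const_iff)
qed

lemma Phi_0 [simp]: "Phi 0 = 1/2"
  using Phi_minus[of 0] by simp

section \<open>Ehrhard's inequality on the line\<close>

lemma phi_minus [simp]: "\<phi> (- x) = \<phi> x"
  by (simp add: std_normal_density_def)

lemma phi_le_phi: "0 \<le> x \<Longrightarrow> x \<le> y \<Longrightarrow> \<phi> y \<le> \<phi> x"
  unfolding std_normal_density_def by (intro mult_left_mono) (auto simp: abs_le_square_iff[symmetric])

text \<open>The function \<open>g\<close> below has derivative
  \<open>(1 / u^2 - 1 / y^2) * \<phi> u\<close>, which is nonpositive for \<open>u \<ge> y\<close>.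
  So \<open>g y \<ge> g u \<ge> - (1 / u)\<close> for every \<open>u \<ge> y\<close>, and letting
  \<open>u\<close> grow gives \<open>g y \<ge> 0\<close>. In terms of the tail, this is the tangent
  inequality for \<open>\<phi> y / y\<close> at \<open>y\<close>, evaluated at tail
  \<open>0\<close>.\<close>

lemma mills_lower:
  assumes "y > 0"
  shows "\<phi> y / y \<le> (1 + 1 / y^2) * (1 - Phi y)"
proof -
  define g where "g u = (1 + 1 / y^2) * (1 - Phi u) - \<phi> u / u" for u
  have g: "- (1 / u) \<le> g y" if "y \<le> u" for u
  proof -
    have "g u \<le> g y"
    proof (rule DERIV_nonpos_imp_nonincreasing[OF that])
      fix x assume x: "y \<le> x" "x \<le> u"
      then have "x > 0" using assms by linarith
      then have "(g has_real_derivative - ((1 + 1 / y^2) * \<phi> x) - (- (1 + 1 / x^2) * \<phi> x)) (at x)"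
        unfolding g_def using assms
        by (auto intro!: derivative_eq_intros simp: field_simps power2_eq_square)
      moreover have "(1 / x^2) * \<phi> x \<le> (1 / y^2) * \<phi> x"
        using x assms by (intro mult_right_mono) (auto intro!: divide_left_mono power_mono)
      then have "- ((1 + 1 / y^2) * \<phi> x) - (- (1 + 1 / x^2) * \<phi> x) \<le> 0"
        by (simp add: algebra_simps)
      ultimately show "\<exists>D. (g has_real_derivative D) (at x) \<and> D \<le> 0" by blast
    qed
    moreover have "\<phi> u / u \<le> 1 / u"
      using that assms by (intro divide_right_mono phi_le_1) auto
    moreover have "0 \<le> (1 + 1 / y^2) * (1 - Phi u)"
      using Phi_bounds(2)[of u] by (intro mult_nonneg_nonneg) auto
    ultimately show ?thesis by (simp add: g_def)
  qed
  have "g y \<ge> 0"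
  proof (rule ccontr)
    assume "\<not> g y \<ge> 0"
    \<comment> \<open>This choice makes \<open>1 / u\<close> at most half of \<open>- g y\<close>,
      against the lower bound \<open>- (1 / u) \<le> g y\<close>.\<close>
    define u where "u = max y (2 / - g y)"
    have "u > 0" "y \<le> u" "2 / - g y \<le> u" using assms by (auto simp: u_def)
    with \<open>\<not> g y \<ge> 0\<close> have "1 / u < - g y" by (auto simp: field_simps)
    with g[OF \<open>y \<le> u\<close>] show False by simp
  qed
  then show ?thesis by (simp add: g_def)
qed

text \<open>For \<open>u \<le> x\<close> the slope \<open>1 + 1 / u^2\<close> is at least its value
  at \<open>x\<close>; integrating against \<open>\<phi>\<close> over \<open>[z, x]\<close> gives
  the bound. In terms of the tail, this is the tangent inequality at \<open>x\<close>, evaluated at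
  the larger tail of \<open>z\<close>.\<close>

lemma phi_div_diff:
  assumes "0 < z" "z \<le> x"
  shows "(1 + 1 / x^2) * (Phi x - Phi z) \<le> \<phi> z / z - \<phi> x / x"
proof -
  define g where "g u = \<phi> u / u + (1 + 1 / x^2) * Phi u" for u
  have "g x \<le> g z"
  proof (rule DERIV_nonpos_imp_nonincreasing[OF assms(2)])
    fix u assume u: "z \<le> u" "u \<le> x"
    then have "u > 0" using assms by linarith
    then have "(g has_real_derivative (- (1 + 1 / u^2) * \<phi> u) + (1 + 1 / x^2) * \<phi> u) (at u)"
      unfolding g_def using assms
        by (auto intro!: derivative_eq_intros simp: field_simps power2_eq_square)
    moreover have "(1 / x^2) * \<phi> u \<le> (1 / u^2) * \<phi> u"
      using u \<open>u > 0\<close> by (intro mult_right_mono) (auto intro!: divide_left_mono power_mono)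
    then have "(- (1 + 1 / u^2) * \<phi> u) + (1 + 1 / x^2) * \<phi> u \<le> 0"
      by (simp add: algebra_simps)
    ultimately show "\<exists>D. (g has_real_derivative D) (at u) \<and> D \<le> 0" by blast
  qed
  then show ?thesis by (simp add: g_def algebra_simps diff_divide_distrib)
qed

text \<open>Parametrised by the tail \<open>\<tau> = 1 - \<Phi> x\<close>, the function \<open>\<phi> x / x\<close> has derivative \<open>1 + 1 / x\<^sup>2\<close>, which increases with \<open>\<tau>\<close>;
  so it is convex in \<open>\<tau>\<close> and vanishes at \<open>0\<close>.\<close>

lemma phi_div_superadditive:
  assumes "0 < x" "0 < y" "0 < z" "1 - Phi z = (1 - Phi x) + (1 - Phi y)"
  shows "\<phi> x / x + \<phi> y / y \<le> \<phi> z / z"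
  using assms
proof (induction x y rule: linorder_wlog)
  case (le x y)
  have "Phi z < Phi x" using le.prems(4) Phi_bounds[of y] by linarith
  then have "z \<le> x" by simp
  have "\<phi> y / y \<le> (1 + 1 / y^2) * (1 - Phi y)"
    by (rule mills_lower[OF le.prems(2)])
  also have "\<dots> \<le> (1 + 1 / x^2) * (1 - Phi y)"
    using le Phi_bounds(2)[of y] by (intro mult_right_mono) (auto intro!: divide_left_mono power_mono)
  also have "1 - Phi y = Phi x - Phi z" using le.prems(4) by simp
  also have "(1 + 1 / x^2) * (Phi x - Phi z) \<le> \<phi> z / z - \<phi> x / x"
    by (rule phi_div_diff[OF le.prems(3) \<open>z \<le> x\<close>])
  finally show ?case by simp
next
  case (sym x y)
  then show ?case by (simp add: add.commute)
qed

lemma clear_denominators: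
  fixes x y z A B C :: real
  assumes "0 < x" "0 < y" "0 < z" "A / x + B / y \<le> C / z"
  shows "A * y * z + B * x * z \<le> C * x * y"
proof -
  have "(A / x + B / y) * (x * y * z) \<le> C / z * (x * y * z)"
    using assms by (intro mult_right_mono) auto
  then show ?thesis using assms by (simp add: distrib_right)
qed

text \<open>With \<open>q = - l\<close> this is the discriminant condition for the quadratic form in
  \<open>ehrhard_quadratic\<close>. For positive \<open>h\<close> the hypothesis says that the tail
  at \<open>h\<close> is the sum of the tails at \<open>r\<close> and \<open>q\<close>, and the
  claim is superadditivity with denominators cleared. For \<open>h \<le> 0 \<le> q\<close> the two
  sides have opposite signs.\<close>

lemma ehrhard_discriminant:
  assumes "Phi h = Phi r + Phi q - 1"
  shows "h * (r * \<phi> q + q * \<phi> r) \<le> r * q * \<phi> h"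
  using assms
proof (induction q r rule: linorder_wlog)
  case (le q r)
  have "Phi h < Phi q" using le.prems Phi_bounds[of r] by linarith
  then have hq: "h < q" by simp
  have "0 < Phi r + Phi q - 1" using le.prems Phi_bounds[of h] by linarith
  then have "Phi (-q) < Phi r" by (simp add: Phi_minus)
  then have rq: "- q < r" by simp
  consider "0 < h" | "h \<le> 0" "0 \<le> q" | "q < 0" by linarith
  then show ?case
  proof cases
    case 1
    then have "\<phi> r / r + \<phi> q / q \<le> \<phi> h / h"
      using hq le by (intro phi_div_superadditive) auto
    with 1 hq le(1) show ?thesis by (simp add: field_simps)
  next
    case 2
    then have "h * (r * \<phi> q + q * \<phi> r) \<le> 0"
      using le(1) by (intro mult_nonpos_nonneg) auto
    also have "0 \<le> r * q * \<phi> h" using 2 le(1) by (intro mult_nonneg_nonneg) auto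
    finally show ?thesis .
  next
    case 3
    \<comment> \<open>Passing to \<open>- h\<close> and \<open>- q\<close> makes all arguments
      positive; the hypothesis then says that the tail at \<open>- q\<close> is the sum of the tails
      at \<open>- h\<close> and \<open>r\<close>.\<close>
    then have "\<phi> (-h) / (-h) + \<phi> r / r \<le> \<phi> (-q) / (-q)"
      using hq rq le.prems by (intro phi_div_superadditive) (auto simp: Phi_minus)
    then have "\<phi> h * r * (-q) + \<phi> r * (-h) * (-q) \<le> \<phi> q * (-h) * r"
      using 3 hq rq clear_denominators[of "-h" r "-q" "\<phi> h" "\<phi> r" "\<phi> q"] by simp
    then show ?thesis by (simp add: algebra_simps)
  qed
next
  case (sym q r)
  then show ?case by (simp add: algebra_simps)
qed

text \<open>The function \<open>x / \<phi> x\<close> is increasing, which is verified here by signs.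
  It makes the diagonal coefficients in \<open>ehrhard_quadratic\<close> nonnegative.\<close>

lemma ehrhard_diagonal:
  assumes "h < r"
  shows "h * \<phi> r \<le> r * \<phi> h"
proof -
  consider "h \<le> 0" "0 < r" | "0 < h" | "r \<le> 0" using assms by linarith
  then show ?thesis
  proof cases
    case 1
    then have "h * \<phi> r \<le> 0" "0 \<le> r * \<phi> h" by (auto intro: mult_nonpos_nonneg)
    then show ?thesis by linarith
  next
    case 2
    then show ?thesis using assms phi_le_phi[of h r] by (intro mult_mono) auto
  next
    case 3
    have "\<phi> h \<le> \<phi> r" using 3 assms phi_le_phi[of "-r" "-h"] by simp
    then have "r * \<phi> r \<le> r * \<phi> h" using 3 by (intro mult_left_mono_neg) auto
    moreover have "h * \<phi> r \<le> r * \<phi> r" using assms by (intro mult_right_mono) auto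
    ultimately show ?thesis by linarith
  qed
qed

lemma quadratic_form_nonneg:
  fixes a b c X Y :: real
  assumes "a \<ge> 0" "b \<ge> 0" "c^2 \<le> a * b"
  shows "0 \<le> a * X^2 + 2 * c * X * Y + b * Y^2"
proof -
  have "\<bar>c\<bar> \<le> sqrt (a * b)" using assms(3) by (intro real_le_rsqrt) simp
  then have "\<bar>c\<bar> * \<bar>X * Y\<bar> \<le> sqrt (a * b) * \<bar>X * Y\<bar>" by (intro mult_right_mono) auto
  then have "- (c * X * Y) \<le> sqrt a * \<bar>X\<bar> * (sqrt b * \<bar>Y\<bar>)"
    using abs_ge_minus_self[of "c * X * Y"] by (simp add: abs_mult real_sqrt_mult algebra_simps)
  moreover have "0 \<le> (sqrt a * \<bar>X\<bar> - sqrt b * \<bar>Y\<bar>)^2" by simp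
  ultimately show ?thesis
    using assms by (simp add: power2_diff power_mult_distrib)
qed

text \<open>Up to a positive factor, the left side minus the right side is the second derivative of \<open>\<Phi>\<inverse> (\<Phi> r - \<Phi> l)\<close> when \<open>r\<close> and \<open>l\<close> move
  with velocities \<open>X\<close> and \<open>Y\<close>.\<close>

lemma ehrhard_quadratic:
  assumes "Phi h = Phi r - Phi l"
  shows "h * (X * \<phi> r - Y * \<phi> l)^2 \<le> \<phi> h * (r * \<phi> r * X^2 - l * \<phi> l * Y^2)"
proof -
  define A B C q where "A = \<phi> r" and "B = \<phi> l" and "C = \<phi> h" and "q = - l"
  have pos: "A > 0" "B > 0" "C > 0" and B: "B = \<phi> q"
    by (simp_all only: A_def B_def C_def q_def phi_pos phi_minus)
  have h: "Phi h = Phi r + Phi q - 1"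
    using assms by (simp add: q_def Phi_minus)
  have "Phi h < Phi r" "Phi h < Phi q" using h Phi_bounds[of r] Phi_bounds[of q] by linarith+
  then have "h < r" "h < q" by auto
  then have d: "h * A \<le> r * C" "h * B \<le> q * C"
    unfolding A_def B C_def by (auto intro: ehrhard_diagonal)
  have e: "h * (r * B + q * A) \<le> r * q * C"
    unfolding A_def B C_def by (rule ehrhard_discriminant[OF h])
  have "0 \<le> (A * (r * C - h * A)) * X^2 + 2 * (h * A * B) * X * Y + (B * (q * C - h * B)) * Y^2"
  proof (rule quadratic_form_nonneg)
    \<comment> \<open>This expression is exactly the product of the diagonal coefficients minus the
      square of half the mixed coefficient.\<close>
    have "0 \<le> A * B * C * (r * q * C - h * (r * B + q * A))"
      using pos e by (intro mult_nonneg_nonneg) auto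
    then show "(h * A * B)^2 \<le> A * (r * C - h * A) * (B * (q * C - h * B))"
      by (simp add: algebra_simps power2_eq_square)
  qed (use pos d in auto)
  then show ?thesis
    unfolding A_def[symmetric] B_def[symmetric] C_def[symmetric]
    by (simp add: q_def algebra_simps power2_eq_square)
qed

section \<open>Concavity of the inverse distribution function of a moving interval\<close>

lemma Phi_inv [simp]: "0 < p \<Longrightarrow> p < 1 \<Longrightarrow> Phi (inv Phi p) = p"
  using Phi_surj[of p] by (auto intro: f_inv_into_f)

lemma inv_Phi [simp]: "inv Phi (Phi x) = x"
  by (rule inv_f_f) (simp add: inj_def)

lemma DERIV_inv_Phi:
  assumes "0 < p" "p < 1"
  shows "(inv Phi has_real_derivative inverse (\<phi> (inv Phi p))) (at p)"
proof (rule DERIV_inverse_function[where f = Phi and a = 0 and b = 1])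
  show "(Phi has_real_derivative \<phi> (inv Phi p)) (at (inv Phi p))"
    by (auto intro!: derivative_eq_intros)
  have "isCont (inv Phi) (Phi (inv Phi p))"
    by (rule isCont_inverse_function[of 1]) (auto intro: isCont_Phi)
  then show "isCont (inv Phi) p" using assms by simp
qed (use assms in \<open>auto simp: less_imp_neq[symmetric]\<close>)

text \<open>Let both endpoints move linearly from the first interval to the second. Then
  \<open>h\<close>, the image under \<open>inv Phi\<close> of the measure of the moving interval,
  has nonpositive second derivative by \<open>ehrhard_quadratic\<close>, and the claim compares
  \<open>h s\<close> with the chord from \<open>h 0 \<ge> a\<close> to
  \<open>h 1 \<ge> b\<close>.\<close>

lemma ehrhard_Icc:
  assumes "l0 < r0" "l1 < r1" "0 \<le> s" "s \<le> 1"
    and a: "Phi a \<le> Phi r0 - Phi l0" and b: "Phi b \<le> Phi r1 - Phi l1"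
  shows "Phi ((1 - s) * a + s * b) \<le> Phi ((1 - s) * r0 + s * r1) - Phi ((1 - s) * l0 + s * l1)"
proof -
  define X Y where "X = r1 - r0" and "Y = l1 - l0"
  define r l where "r \<tau> = r0 + \<tau> * X" and "l \<tau> = l0 + \<tau> * Y" for \<tau> :: real
  define h where "h \<tau> = inv Phi (Phi (r \<tau>) - Phi (l \<tau>))" for \<tau>
  have lr: "l \<tau> < r \<tau>" if "\<tau> \<in> {0..1}" for \<tau>
  proof -
    have "r \<tau> - l \<tau> = (1 - \<tau>) * (r0 - l0) + \<tau> * (r1 - l1)"
      by (simp add: r_def l_def X_def Y_def algebra_simps)
    also have "\<dots> > 0"
      using that assms(1,2) by (cases "\<tau> = 0") (auto intro!: add_nonneg_pos)
    finally show ?thesis by simp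
  qed
  have D: "0 < Phi (r \<tau>) - Phi (l \<tau>)" "Phi (r \<tau>) - Phi (l \<tau>) < 1" if "\<tau> \<in> {0..1}" for \<tau>
    using lr[OF that] Phi_bounds[of "r \<tau>"] Phi_bounds[of "l \<tau>"] by auto
  have Ph: "Phi (h \<tau>) = Phi (r \<tau>) - Phi (l \<tau>)" if "\<tau> \<in> {0..1}" for \<tau>
    using D[OF that] by (simp add: h_def)
  define h' where "h' \<tau> = (X * \<phi> (r \<tau>) - Y * \<phi> (l \<tau>)) / \<phi> (h \<tau>)" for \<tau>
  define h'' where "h'' \<tau> = ((- r \<tau> * \<phi> (r \<tau>) * X^2 + l \<tau> * \<phi> (l \<tau>) * Y^2) * \<phi> (h \<tau>)
      + (X * \<phi> (r \<tau>) - Y * \<phi> (l \<tau>)) * (h \<tau> * \<phi> (h \<tau>) * h' \<tau>)) / (\<phi> (h \<tau>))^2" for \<tau>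
  have h1: "(h has_real_derivative h' \<tau>) (at \<tau>)" if "\<tau> \<in> {0..1}" for \<tau>
    unfolding h_def[abs_def] h'_def
    by (rule DERIV_chain2[where f = "inv Phi" and g = "\<lambda>\<tau>. Phi (r \<tau>) - Phi (l \<tau>)", OF DERIV_inv_Phi[OF D[OF that]], THEN DERIV_cong])
       (auto intro!: derivative_eq_intros simp: r_def l_def field_simps)
  have h2: "(h' has_real_derivative h'' \<tau>) (at \<tau>)" if "\<tau> \<in> {0..1}" for \<tau>
  proof -
    have N: "((\<lambda>\<tau>. X * \<phi> (r \<tau>) - Y * \<phi> (l \<tau>)) has_real_derivative
        - r \<tau> * \<phi> (r \<tau>) * X^2 + l \<tau> * \<phi> (l \<tau>) * Y^2) (at \<tau>)"
      unfolding r_def l_def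
      by (auto intro!: derivative_eq_intros simp: algebra_simps power2_eq_square)
    show ?thesis
      unfolding h'_def[abs_def] h''_def
      by (rule DERIV_cong[OF DERIV_divide[OF N DERIV_phi[OF h1[OF that]]]])
         (auto simp: h'_def less_imp_neq[OF phi_pos, symmetric] power2_eq_square)
  qed
  have "concave_on {0..1} h"
  proof (rule f''_le0_imp_concave[of _ _ h' h''])
    fix \<tau> :: real assume t: "\<tau> \<in> {0..1}"
    have "h \<tau> * (X * \<phi> (r \<tau>) - Y * \<phi> (l \<tau>))^2 \<le> \<phi> (h \<tau>) * (r \<tau> * \<phi> (r \<tau>) * X^2 - l \<tau> * \<phi> (l \<tau>) * Y^2)"
      by (rule ehrhard_quadratic[OF Ph[OF t]])
    \<comment> \<open>The numerator of \<open>h''\<close> becomes the difference of the two sides of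
      \<open>ehrhard_quadratic\<close> once the factor \<open>\<phi> (h \<tau>)\<close> cancels the
      denominator of \<open>h'\<close>.\<close>
    moreover have "(- r \<tau> * \<phi> (r \<tau>) * X^2 + l \<tau> * \<phi> (l \<tau>) * Y^2) * \<phi> (h \<tau>)
      + (X * \<phi> (r \<tau>) - Y * \<phi> (l \<tau>)) * (h \<tau> * \<phi> (h \<tau>) * h' \<tau>)
      = h \<tau> * (X * \<phi> (r \<tau>) - Y * \<phi> (l \<tau>))^2 - \<phi> (h \<tau>) * (r \<tau> * \<phi> (r \<tau>) * X^2 - l \<tau> * \<phi> (l \<tau>) * Y^2)"
    proof -
      have "\<phi> (h \<tau>) * h' \<tau> = X * \<phi> (r \<tau>) - Y * \<phi> (l \<tau>)"
        by (simp add: h'_def less_imp_neq[OF phi_pos, symmetric])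
      then have *: "h \<tau> * \<phi> (h \<tau>) * h' \<tau> = h \<tau> * (X * \<phi> (r \<tau>) - Y * \<phi> (l \<tau>))"
        by (simp only: mult.assoc)
      show ?thesis unfolding * by (simp add: algebra_simps power2_eq_square)
    qed
    ultimately show "h'' \<tau> \<le> 0"
      unfolding h''_def by (intro divide_nonpos_nonneg) auto
  qed (use h1 h2 in auto)
  then have "(1 - s) * h 0 + s * h 1 \<le> h s"
    using concave_onD[of "{0..1}" h s 0 1] assms(3,4) by simp
  moreover have "a \<le> h 0" "b \<le> h 1"
  proof -
    have "Phi a \<le> Phi (h 0)" "Phi b \<le> Phi (h 1)"
      using a b Ph[of 0] Ph[of 1] by (simp_all add: r_def l_def X_def Y_def)
    then show "a \<le> h 0" "b \<le> h 1" by simp_all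
  qed
  then have "(1 - s) * a + s * b \<le> (1 - s) * h 0 + s * h 1"
    using assms by (intro add_mono mult_left_mono) auto
  ultimately have "Phi ((1 - s) * a + s * b) \<le> Phi (h s)" by simp
  also have "\<dots> = Phi (r s) - Phi (l s)" using Ph assms by simp
  also have "r s = (1 - s) * r0 + s * r1" by (simp add: r_def X_def algebra_simps)
  also have "l s = (1 - s) * l0 + s * l1" by (simp add: l_def Y_def algebra_simps)
  finally show ?thesis .
qed

text \<open>Inner regularity gives a compact subset that still has measure above
  \<open>Phi a\<close>; the interval between its least and greatest points lies in \<open>I\<close>
  by convexity. Thus arbitrary convex sets on the line reduce to the compact intervals of
  \<open>ehrhard_Icc\<close>.\<close>

lemma convex_real_inner_Icc:
  fixes I :: "real set"
  assumes "convex I" "I \<in> sets borel" "Phi a < measure std_gaussian I"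
  obtains l r where "l < r" "{l..r} \<subseteq> I" "Phi a \<le> Phi r - Phi l"
proof -
  have "emeasure std_gaussian I = (SUP K\<in>{K. K \<subseteq> I \<and> compact K}. emeasure std_gaussian K)"
    by (rule inner_regular) (use assms N1.emeasure_finite in auto)
  moreover have "ennreal (Phi a) < emeasure std_gaussian I"
    using assms Phi_bounds[of a] by (simp add: N1.emeasure_eq_measure ennreal_less_iff less_imp_le)
  ultimately obtain K where K: "K \<subseteq> I" "compact K" "ennreal (Phi a) < emeasure std_gaussian K"
    by (auto simp: less_SUP_iff)
  then have Ka: "Phi a < measure std_gaussian K"
    using Phi_bounds[of a] by (simp add: N1.emeasure_eq_measure ennreal_less_iff less_imp_le)
  then have "K \<noteq> {}" using Phi_bounds[of a] by (auto simp: not_less)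
  then obtain l r where lr: "l \<in> K" "r \<in> K" "\<And>x. x \<in> K \<Longrightarrow> l \<le> x \<and> x \<le> r"
    using compact_attains_inf[OF K(2)] compact_attains_sup[OF K(2)] by metis
  have "l \<le> r" using lr by blast
  have "closed_segment l r \<subseteq> I"
    using lr K(1) assms(1) by (intro closed_segment_subset) auto
  then have sub: "{l..r} \<subseteq> I" using \<open>l \<le> r\<close> by (simp add: closed_segment_eq_real_ivl)
  have "Phi a < measure std_gaussian K" by fact
  also have "\<dots> \<le> measure std_gaussian {l..r}"
    by (rule N1.finite_measure_mono) (use lr in auto)
  also have "\<dots> = measure std_gaussian {l<..r}"
    unfolding std_gaussian_real measure_def
    by (intro arg_cong[where f = enn2real] emeasure_eq_AE)
       (use AE_lborel_singleton[of l] in \<open>auto simp: AE_density elim!: eventually_mono\<close>)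
  also have "\<dots> = Phi r - Phi l" by (simp add: Phi_diff_measure \<open>l \<le> r\<close>)
  finally have *: "Phi a < Phi r - Phi l" .
  with Phi_bounds(1)[of a] have "Phi l < Phi r" by linarith
  then have "l < r" by simp
  with sub * that show thesis by force
qed

text \<open>By continuity of \<open>Phi\<close>, later inequalities may be proved with a loss of
  \<open>\<epsilon>\<close> in the argument.\<close>

lemma Phi_le_of_all_less:
  assumes "\<And>\<epsilon>. \<epsilon> > 0 \<Longrightarrow> Phi (c - \<epsilon>) \<le> m"
  shows "Phi c \<le> m"
proof (rule tendsto_upperbound)
  show "((\<lambda>\<epsilon>. Phi (c - \<epsilon>)) \<longlongrightarrow> Phi c) (at_right 0)"
    by (rule isCont_tendsto_compose[OF isCont_Phi]) (auto intro!: tendsto_eq_intros)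
  show "\<forall>\<^sub>F \<epsilon> in at_right 0. Phi (c - \<epsilon>) \<le> m"
    using assms by (auto simp: eventually_at_filter)
qed simp

text \<open>Lowering both levels by \<open>\<epsilon>\<close> makes the hypotheses strict, so both
  sets contain compact intervals of sufficient measure. The combination of these intervals lies in
  \<open>I\<close>, and \<open>ehrhard_Icc\<close> bounds its measure.\<close>

lemma ehrhard_real:
  fixes I0 I1 I :: "real set"
  assumes "convex I0" "convex I1" "I0 \<in> sets borel" "I1 \<in> sets borel" "I \<in> sets borel"
    and s: "0 \<le> s" "s \<le> 1"
    and comb: "\<And>x y. x \<in> I0 \<Longrightarrow> y \<in> I1 \<Longrightarrow> (1 - s) * x + s * y \<in> I"
    and a: "Phi a \<le> measure std_gaussian I0" and b: "Phi b \<le> measure std_gaussian I1"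
  shows "Phi ((1 - s) * a + s * b) \<le> measure std_gaussian I"
proof (rule Phi_le_of_all_less)
  fix \<epsilon> :: real assume "\<epsilon> > 0"
  then have "Phi (a - \<epsilon>) < Phi a" "Phi (b - \<epsilon>) < Phi b" by auto
  then have ab: "Phi (a - \<epsilon>) < measure std_gaussian I0" "Phi (b - \<epsilon>) < measure std_gaussian I1"
    using a b by linarith+
  obtain l0 r0 where 0: "l0 < r0" "{l0..r0} \<subseteq> I0" "Phi (a - \<epsilon>) \<le> Phi r0 - Phi l0"
    using convex_real_inner_Icc[OF assms(1,3) ab(1)] .
  obtain l1 r1 where 1: "l1 < r1" "{l1..r1} \<subseteq> I1" "Phi (b - \<epsilon>) \<le> Phi r1 - Phi l1"
    using convex_real_inner_Icc[OF assms(2,4) ab(2)] .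
  define l r where "l = (1 - s) * l0 + s * l1" and "r = (1 - s) * r0 + s * r1"
  have "l \<le> r" unfolding l_def r_def using 0 1 s by (intro add_mono mult_left_mono) auto
  have "{l..r} \<subseteq> I"
  proof
    fix u assume u: "u \<in> {l..r}"
    then obtain \<theta> where t: "0 \<le> \<theta>" "\<theta> \<le> 1" "u = (1 - \<theta>) * l + \<theta> * r"
      using closed_segment_eq_real_ivl[of l r] \<open>l \<le> r\<close>
      unfolding closed_segment_def by (auto simp del: atLeastAtMost_iff)
    have "(1 - \<theta>) * l0 + \<theta> * r0 \<in> {l0..r0}" "(1 - \<theta>) * l1 + \<theta> * r1 \<in> {l1..r1}"
      using t(1,2) 0(1) 1(1) convexD_alt[OF convex_real_interval(5)[of l0 r0], of l0 r0 \<theta>]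
        convexD_alt[OF convex_real_interval(5)[of l1 r1], of l1 r1 \<theta>] by simp_all
    then have "(1 - s) * ((1 - \<theta>) * l0 + \<theta> * r0) + s * ((1 - \<theta>) * l1 + \<theta> * r1) \<in> I"
      using 0(2) 1(2) by (intro comb) auto
    also have "(1 - s) * ((1 - \<theta>) * l0 + \<theta> * r0) + s * ((1 - \<theta>) * l1 + \<theta> * r1) = u"
      by (simp add: t(3) l_def r_def algebra_simps)
    finally show "u \<in> I" .
  qed
  have "(1 - s) * a + s * b - \<epsilon> = (1 - s) * (a - \<epsilon>) + s * (b - \<epsilon>)"
    by (simp add: algebra_simps)
  then have "Phi ((1 - s) * a + s * b - \<epsilon>) \<le> Phi r - Phi l"
    unfolding l_def r_def using ehrhard_Icc[OF 0(1) 1(1) s 0(3) 1(3)] by simp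
  also have "\<dots> = measure std_gaussian {l<..r}" by (simp add: Phi_diff_measure \<open>l \<le> r\<close>)
  also have "\<dots> \<le> measure std_gaussian I"
    by (rule N1.finite_measure_mono) (use \<open>{l..r} \<subseteq> I\<close> assms in auto)
  finally show "Phi ((1 - s) * a + s * b - \<epsilon>) \<le> measure std_gaussian I" .
qed

section \<open>Gaussian measure on Euclidean spaces\<close>

definition orthonormal :: "'a::euclidean_space set \<Rightarrow> bool" where
  "orthonormal B \<longleftrightarrow> pairwise orthogonal B \<and> (\<forall>b\<in>B. norm b = 1)"

definition orth_proj :: "'a::euclidean_space set \<Rightarrow> 'a \<Rightarrow> 'a" where
  "orth_proj B x = (\<Sum>b\<in>B. (x \<bullet> b) *\<^sub>R b)"

lemma orthonormal_finite: "orthonormal B \<Longrightarrow> finite B"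
  by (auto simp: orthonormal_def intro: pairwise_orthogonal_imp_finite)

lemma orthonormal_independent: "orthonormal B \<Longrightarrow> independent B"
  by (rule pairwise_orthogonal_independent) (auto simp: orthonormal_def)

lemma orthonormal_inner:
  "orthonormal B \<Longrightarrow> b \<in> B \<Longrightarrow> c \<in> B \<Longrightarrow> b \<bullet> c = (if b = c then 1 else 0)"
  by (auto simp: orthonormal_def pairwise_def orthogonal_def norm_eq_1)

lemma orthonormal_sum_inner:
  assumes "orthonormal B" "c \<in> B"
  shows "(\<Sum>b\<in>B. f b *\<^sub>R b) \<bullet> c = f c"
proof -
  have "(\<Sum>b\<in>B. f b *\<^sub>R b) \<bullet> c = (\<Sum>b\<in>B. if b = c then f b else 0)"
    unfolding inner_sum_left using assms by (intro sum.cong) (auto simp: orthonormal_inner)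
  then show ?thesis using assms by (simp add: orthonormal_finite)
qed

lemma orthonormal_norm_sum:
  assumes "orthonormal B"
  shows "(norm (\<Sum>b\<in>B. f b *\<^sub>R b))\<^sup>2 = (\<Sum>b\<in>B. (f b)\<^sup>2)"
proof -
  have "(norm (\<Sum>b\<in>B. f b *\<^sub>R b))\<^sup>2 = (\<Sum>c\<in>B. f c * ((\<Sum>b\<in>B. f b *\<^sub>R b) \<bullet> c))"
    using inner_sum_right[of "\<Sum>b\<in>B. f b *\<^sub>R b" "\<lambda>c. f c *\<^sub>R c" B] by (simp add: power2_norm_eq_inner)
  then show ?thesis using assms by (simp add: orthonormal_sum_inner power2_eq_square)
qed

lemma gaussian_density_measurable [measurable]: "gaussian_density k \<in> borel_measurable borel"
  unfolding gaussian_density_def[abs_def] by measurable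

lemma gaussian_density_pos: "0 < gaussian_density k x"
  by (simp add: gaussian_density_def)

lemma gaussian_density_orthonormal_sum:
  assumes "orthonormal B"
  shows "gaussian_density (card B) (\<Sum>b\<in>B. f b *\<^sub>R b) = (\<Prod>b\<in>B. \<phi> (f b))"
proof -
  have "1 / sqrt (2 * pi) = (2 * pi) powr (- 1 / 2)"
    by (simp add: powr_minus_divide powr_half_sqrt)
  then have *: "(1 / sqrt (2 * pi)) ^ card B = (2 * pi) powr (- (real (card B) / 2))"
    by (simp add: powr_power)
  have "(\<Prod>b\<in>B. \<phi> (f b)) = (1 / sqrt (2 * pi)) ^ card B * (\<Prod>b\<in>B. exp (- (f b)\<^sup>2 / 2))"
    unfolding std_normal_density_def by (simp only: prod.distrib prod_constant)
  also have "(\<Prod>b\<in>B. exp (- (f b)\<^sup>2 / 2)) = exp (- (\<Sum>b\<in>B. (f b)\<^sup>2) / 2)"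
    using orthonormal_finite[OF assms] by (simp add: exp_sum[symmetric] sum_negf sum_divide_distrib)
  finally show ?thesis
    by (simp only: * gaussian_density_def orthonormal_norm_sum[OF assms])
qed

interpretation lborel_PiM: product_sigma_finite "\<lambda>_. lborel :: real measure"
  by standard

interpretation gauss_PiM: product_sigma_finite "\<lambda>_. std_gaussian :: real measure"
  by standard

lemma density_PiM_std_normal:
  assumes "finite I"
  shows "density (\<Pi>\<^sub>M i\<in>I. lborel) (\<lambda>f. ennreal (\<Prod>i\<in>I. \<phi> (f i))) = (\<Pi>\<^sub>M i\<in>I. std_gaussian)"
proof (rule gauss_PiM.PiM_eqI[OF assms])
  show "sets (density (\<Pi>\<^sub>M i\<in>I. lborel) (\<lambda>f. ennreal (\<Prod>i\<in>I. \<phi> (f i)))) = (\<Pi>\<^sub>M i\<in>I. std_gaussian)"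
    by (simp cong: sets_PiM_cong)
next
  fix A :: "_ \<Rightarrow> real set" assume A: "\<And>i. i \<in> I \<Longrightarrow> A i \<in> sets std_gaussian"
  then have [measurable]: "\<And>i. i \<in> I \<Longrightarrow> A i \<in> sets borel" by simp
  have [measurable]: "(Pi\<^sub>E I A) \<in> sets (\<Pi>\<^sub>M i\<in>I. lborel)"
    using A by (intro sets_PiM_I_finite assms) auto
  have "emeasure (density (\<Pi>\<^sub>M i\<in>I. lborel) (\<lambda>f. ennreal (\<Prod>i\<in>I. \<phi> (f i)))) (Pi\<^sub>E I A)
      = (\<integral>\<^sup>+f. ennreal (\<Prod>i\<in>I. \<phi> (f i)) * indicator (Pi\<^sub>E I A) f \<partial>(\<Pi>\<^sub>M i\<in>I. lborel))"
    by (rule emeasure_density) measurable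
  also have "\<dots> = (\<integral>\<^sup>+f. (\<Prod>i\<in>I. ennreal (\<phi> (f i)) * indicator (A i) (f i)) \<partial>(\<Pi>\<^sub>M i\<in>I. lborel))"
  proof (rule nn_integral_cong)
    fix f :: "_ \<Rightarrow> real" assume "f \<in> space (\<Pi>\<^sub>M i\<in>I. lborel)"
    then have "f \<in> extensional I" by (simp add: space_PiM PiE_def)
    then have "indicator (Pi\<^sub>E I A) f = (\<Prod>i\<in>I. indicator (A i) (f i) :: ennreal)"
      using assms by (auto simp: indicator_def PiE_def Pi_def prod_zero_iff)
    then show "ennreal (\<Prod>i\<in>I. \<phi> (f i)) * indicator (Pi\<^sub>E I A) f = (\<Prod>i\<in>I. ennreal (\<phi> (f i)) * indicator (A i) (f i))"
      by (simp add: prod.distrib prod_ennreal)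
  qed
  also have "\<dots> = (\<Prod>i\<in>I. \<integral>\<^sup>+x. ennreal (\<phi> x) * indicator (A i) x \<partial>lborel)"
    by (rule lborel_PiM.product_nn_integral_prod[OF assms]) measurable
  also have "\<dots> = (\<Prod>i\<in>I. emeasure std_gaussian (A i))"
    unfolding std_gaussian_real by (intro prod.cong refl emeasure_density[symmetric]) auto
  finally show "emeasure (density (\<Pi>\<^sub>M i\<in>I. lborel) (\<lambda>f. ennreal (\<Prod>i\<in>I. \<phi> (f i)))) (Pi\<^sub>E I A)
      = (\<Prod>i\<in>I. emeasure std_gaussian (A i))" .
qed

text \<open>In orthonormal coordinates the Gaussian density splits into one-dimensional factors.
  This applies both to the whole space and to the basis hidden in
  \<open>lborel_subspace\<close>.\<close>

lemma density_distr_PiM: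
  assumes "orthonormal B"
  shows "density (distr (\<Pi>\<^sub>M b\<in>B. lborel) borel (\<lambda>f. \<Sum>b\<in>B. f b *\<^sub>R b)) (gaussian_density (card B))
    = distr (\<Pi>\<^sub>M b\<in>B. std_gaussian) borel (\<lambda>f. \<Sum>b\<in>B. f b *\<^sub>R b)"
  by (subst density_distr)
     (simp_all add: gaussian_density_orthonormal_sum[OF assms] density_PiM_std_normal orthonormal_finite[OF assms])

lemma orthonormal_Basis: "orthonormal Basis"
  by (auto simp: orthonormal_def pairwise_def orthogonal_def inner_not_same_Basis)

lemma std_gaussian_PiM:
  "(std_gaussian :: 'a::euclidean_space measure) = distr (\<Pi>\<^sub>M b\<in>Basis. std_gaussian) borel (\<lambda>f. \<Sum>b\<in>Basis. f b *\<^sub>R b)"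
  by (subst std_gaussian_def, subst lborel_eq, rule density_distr_PiM[OF orthonormal_Basis])

lemma prob_space_std_gaussian: "prob_space (std_gaussian :: 'a::euclidean_space measure)"
  by (subst std_gaussian_PiM, rule prob_space.prob_space_distr) (auto intro: prob_space_PiM prob_space_std_gaussian_real)

interpretation N: prob_space "std_gaussian :: 'a::euclidean_space measure"
  by (rule prob_space_std_gaussian)

lemma emeasure_std_gaussian_UNIV [simp]: "emeasure std_gaussian UNIV = 1"
  using N.emeasure_space_1 by simp

interpretation G1G: pair_prob_space "std_gaussian :: 'b::euclidean_space measure" "std_gaussian :: 'a::euclidean_space measure"
  by standard

section \<open>Lebesgue changes of variables and resampling of one component\<close>

lemma nn_integral_lborel_translate:
  fixes w :: "'a::euclidean_space"
  assumes [measurable]: "F \<in> borel_measurable borel"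
  shows "(\<integral>\<^sup>+x. F (x + w) \<partial>lborel) = (\<integral>\<^sup>+x. F x \<partial>lborel)"
proof -
  have "(\<integral>\<^sup>+x. F x \<partial>lborel) = (\<integral>\<^sup>+x. F x \<partial>distr lborel borel ((+) w))"
    by (simp add: lborel_distr_plus)
  also have "\<dots> = (\<integral>\<^sup>+x. F (x + w) \<partial>lborel)"
    by (simp add: nn_integral_distr add.commute)
  finally show ?thesis ..
qed

lemma nn_integral_lborel_reflect:
  fixes F :: "real \<Rightarrow> ennreal"
  assumes [measurable]: "F \<in> borel_measurable borel"
  shows "(\<integral>\<^sup>+x. F (- x) \<partial>lborel) = (\<integral>\<^sup>+x. F x \<partial>lborel)"
  using nn_integral_real_affine[of F "-1" 0] by simp

lemma nn_integral_std_gaussian: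
  fixes F :: "'a::euclidean_space \<Rightarrow> ennreal"
  assumes [measurable]: "F \<in> borel_measurable borel"
  shows "(\<integral>\<^sup>+x. F x \<partial>std_gaussian) = (\<integral>\<^sup>+x. gaussian_density DIM('a) x * F x \<partial>lborel)"
  unfolding std_gaussian_def by (rule nn_integral_density) measurable

text \<open>The map \<open>(u, x) \<mapsto> (x \<bullet> d, x - (x \<bullet> d) d + u d)\<close> exchanges \<open>u\<close> with the component of \<open>x\<close>
  along \<open>d\<close>. It is a composition of shears, so it preserves Lebesgue measure.\<close>

lemma nn_integral_exchange:
  fixes d :: "'a::euclidean_space"
  assumes d: "norm d = 1" and H: "(\<lambda>(u, x). H u x) \<in> borel_measurable (borel \<Otimes>\<^sub>M borel)"
  shows "(\<integral>\<^sup>+x. \<integral>\<^sup>+u. H (x \<bullet> d) (x - (x \<bullet> d) *\<^sub>R d + u *\<^sub>R d) \<partial>lborel \<partial>lborel) = (\<integral>\<^sup>+x. \<integral>\<^sup>+u. H u x \<partial>lborel \<partial>lborel)"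
proof -
  have shear: "(\<integral>\<^sup>+x. \<integral>\<^sup>+u. K u (x + u *\<^sub>R d) \<partial>lborel \<partial>lborel) = (\<integral>\<^sup>+x. \<integral>\<^sup>+u. K u x \<partial>lborel \<partial>lborel)"
    if [measurable]: "(\<lambda>(u, x). K u x) \<in> borel_measurable (borel \<Otimes>\<^sub>M borel)" for K :: "real \<Rightarrow> 'a \<Rightarrow> ennreal"
  proof -
    have "(\<integral>\<^sup>+x. \<integral>\<^sup>+u. K u (x + u *\<^sub>R d) \<partial>lborel \<partial>lborel) = (\<integral>\<^sup>+u. \<integral>\<^sup>+x. K u (x + u *\<^sub>R d) \<partial>lborel \<partial>lborel)"
      by (rule lborel_pair.Fubini') measurable
    also have "\<dots> = (\<integral>\<^sup>+u. \<integral>\<^sup>+x. K u x \<partial>lborel \<partial>lborel)"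
      by (intro nn_integral_cong nn_integral_lborel_translate) measurable
    also have "\<dots> = (\<integral>\<^sup>+x. \<integral>\<^sup>+u. K u x \<partial>lborel \<partial>lborel)"
      by (rule lborel_pair.Fubini'[symmetric]) measurable
    finally show ?thesis .
  qed
  note [measurable] = H
  have dd: "d \<bullet> d = 1" using d by (simp add: norm_eq_1)
  \<comment> \<open>The exchange is built by substituting, in turn, \<open>- u\<close> for
    \<open>u\<close>, \<open>x + u *\<^sub>R d\<close> for \<open>x\<close>,
    \<open>u - x \<bullet> d\<close> for \<open>u\<close>, and again
    \<open>x + u *\<^sub>R d\<close> for \<open>x\<close>.\<close>
  have "(\<integral>\<^sup>+x. \<integral>\<^sup>+u. H u x \<partial>lborel \<partial>lborel) = (\<integral>\<^sup>+x. \<integral>\<^sup>+u. H (- u) x \<partial>lborel \<partial>lborel)"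
    by (intro nn_integral_cong nn_integral_lborel_reflect[symmetric]) measurable
  also have "\<dots> = (\<integral>\<^sup>+x. \<integral>\<^sup>+u. H (- u) (x + u *\<^sub>R d) \<partial>lborel \<partial>lborel)"
    by (rule shear[of "\<lambda>u x. H (- u) x", symmetric]) measurable
  also have "\<dots> = (\<integral>\<^sup>+x. \<integral>\<^sup>+u. H (- (u - x \<bullet> d)) (x + (u - x \<bullet> d) *\<^sub>R d) \<partial>lborel \<partial>lborel)"
  proof (rule nn_integral_cong)
    fix x
    show "(\<integral>\<^sup>+u. H (- u) (x + u *\<^sub>R d) \<partial>lborel) = (\<integral>\<^sup>+u. H (- (u - x \<bullet> d)) (x + (u - x \<bullet> d) *\<^sub>R d) \<partial>lborel)"
      using nn_integral_lborel_translate[of "\<lambda>u. H (- u) (x + u *\<^sub>R d)" "- (x \<bullet> d)"] by simp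
  qed
  also have "\<dots> = (\<integral>\<^sup>+x. \<integral>\<^sup>+u. H (- (u - (x + u *\<^sub>R d) \<bullet> d)) ((x + u *\<^sub>R d) + (u - (x + u *\<^sub>R d) \<bullet> d) *\<^sub>R d) \<partial>lborel \<partial>lborel)"
    by (rule shear[of "\<lambda>u x. H (- (u - x \<bullet> d)) (x + (u - x \<bullet> d) *\<^sub>R d)", symmetric]) measurable
  also have "\<dots> = (\<integral>\<^sup>+x. \<integral>\<^sup>+u. H (x \<bullet> d) (x - (x \<bullet> d) *\<^sub>R d + u *\<^sub>R d) \<partial>lborel \<partial>lborel)"
    by (intro nn_integral_cong arg_cong2[where f = H]) (simp_all add: dd inner_add_left algebra_simps)
  finally show ?thesis ..
qed

text \<open>The exchange of \<open>u\<close> with \<open>x \<bullet> d\<close> preserves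
  \<open>u\<^sup>2 + (norm x)\<^sup>2\<close>, hence the joint Gaussian density. So replacing the
  component along \<open>d\<close> by an independent Gaussian leaves the law unchanged. This plays
  the part of Fubini's theorem along lines parallel to \<open>d\<close>, without splitting the space
  into a product.\<close>

lemma nn_integral_resample:
  fixes d :: "'a::euclidean_space"
  assumes d: "norm d = 1" and [measurable]: "F \<in> borel_measurable borel"
  shows "(\<integral>\<^sup>+x. \<integral>\<^sup>+u. F (x - (x \<bullet> d) *\<^sub>R d + u *\<^sub>R d) \<partial>std_gaussian \<partial>std_gaussian) = (\<integral>\<^sup>+x. F x \<partial>std_gaussian)"
proof -
  let ?g = "\<lambda>x::'a. ennreal (gaussian_density DIM('a) x)"
  define H where "H u x = ennreal (\<phi> u) * (?g x * F x)" for u and x :: 'a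
  have [measurable]: "(\<lambda>(u, x). H u x) \<in> borel_measurable (borel \<Otimes>\<^sub>M borel)"
    unfolding H_def by measurable
  have dd: "d \<bullet> d = 1" using d by (simp add: norm_eq_1)
  have *: "ennreal (\<phi> (x \<bullet> d)) * ?g (x - (x \<bullet> d) *\<^sub>R d + u *\<^sub>R d) = ennreal (\<phi> u) * ?g x" for x u
  proof -
    have "(x \<bullet> d)\<^sup>2 + (norm (x - (x \<bullet> d) *\<^sub>R d + u *\<^sub>R d))\<^sup>2 = u\<^sup>2 + (norm x)\<^sup>2"
      unfolding power2_norm_eq_inner
      by (simp add: inner_add_left inner_add_right inner_diff_left inner_diff_right dd inner_commute
          algebra_simps power2_eq_square)
    then have "exp (- (x \<bullet> d)\<^sup>2 / 2) * exp (- (norm (x - (x \<bullet> d) *\<^sub>R d + u *\<^sub>R d))\<^sup>2 / 2) = exp (- u\<^sup>2 / 2) * exp (- (norm x)\<^sup>2 / 2)"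
      unfolding exp_add[symmetric] by (simp add: field_simps)
    then have "\<phi> (x \<bullet> d) * gaussian_density DIM('a) (x - (x \<bullet> d) *\<^sub>R d + u *\<^sub>R d) = \<phi> u * gaussian_density DIM('a) x"
      by (simp add: std_normal_density_def gaussian_density_def)
    then show ?thesis by (simp flip: ennreal_mult' add: less_imp_le gaussian_density_pos)
  qed
  have "(\<integral>\<^sup>+x. F x \<partial>std_gaussian) = (\<integral>\<^sup>+x. \<integral>\<^sup>+u. ?g x * F x \<partial>(std_gaussian :: real measure) \<partial>lborel)"
    by (simp add: nn_integral_std_gaussian )
  also have "\<dots> = (\<integral>\<^sup>+x. \<integral>\<^sup>+u. H u x \<partial>lborel \<partial>lborel)"
    unfolding H_def std_gaussian_real by (intro nn_integral_cong nn_integral_density) auto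
  also have "\<dots> = (\<integral>\<^sup>+x. \<integral>\<^sup>+u. H (x \<bullet> d) (x - (x \<bullet> d) *\<^sub>R d + u *\<^sub>R d) \<partial>lborel \<partial>lborel)"
    by (rule nn_integral_exchange[OF d, symmetric]) measurable
  also have "\<dots> = (\<integral>\<^sup>+x. \<integral>\<^sup>+u. ?g x * (ennreal (\<phi> u) * F (x - (x \<bullet> d) *\<^sub>R d + u *\<^sub>R d)) \<partial>lborel \<partial>lborel)"
    unfolding H_def mult.assoc[symmetric] * by (simp add: mult.commute)
  also have "\<dots> = (\<integral>\<^sup>+x. ?g x * (\<integral>\<^sup>+u. ennreal (\<phi> u) * F (x - (x \<bullet> d) *\<^sub>R d + u *\<^sub>R d) \<partial>lborel) \<partial>lborel)"
    by (intro nn_integral_cong nn_integral_cmult) measurable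
  also have "\<dots> = (\<integral>\<^sup>+x. ?g x * (\<integral>\<^sup>+u. F (x - (x \<bullet> d) *\<^sub>R d + u *\<^sub>R d) \<partial>std_gaussian) \<partial>lborel)"
    unfolding std_gaussian_real by (intro nn_integral_cong arg_cong2[where f = "(*)"] refl nn_integral_density[symmetric]) auto
  also have "\<dots> = (\<integral>\<^sup>+x. \<integral>\<^sup>+u. F (x - (x \<bullet> d) *\<^sub>R d + u *\<^sub>R d) \<partial>std_gaussian \<partial>std_gaussian)"
    by (rule nn_integral_std_gaussian[symmetric]) measurable
  finally show ?thesis ..
qed

lemma nn_integral_marginal:
  fixes d :: "'a::euclidean_space"
  assumes d: "norm d = 1" and [measurable]: "F \<in> borel_measurable borel"
  shows "(\<integral>\<^sup>+x. F (x \<bullet> d) \<partial>std_gaussian) = (\<integral>\<^sup>+u. F u \<partial>std_gaussian)"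
proof -
  have "d \<bullet> d = 1" using d by (simp add: norm_eq_1)
  have "(\<integral>\<^sup>+x. F (x \<bullet> d) \<partial>std_gaussian) =
      (\<integral>\<^sup>+x. \<integral>\<^sup>+u. F ((x - (x \<bullet> d) *\<^sub>R d + u *\<^sub>R d) \<bullet> d) \<partial>std_gaussian \<partial>std_gaussian)"
    by (rule nn_integral_resample[OF d, symmetric]) measurable
  also have "\<dots> = (\<integral>\<^sup>+u. F u \<partial>std_gaussian)"
    using \<open>d \<bullet> d = 1\<close> by (simp add: inner_add_left inner_diff_left )
  finally show ?thesis .
qed

lemma distr_marginal:
  fixes d :: "'a::euclidean_space"
  assumes "norm d = 1"
  shows "distr std_gaussian borel (\<lambda>x. x \<bullet> d) = std_gaussian"
proof (rule measure_eqI)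
  fix A :: "real set" assume "A \<in> sets (distr std_gaussian borel (\<lambda>x. x \<bullet> d))"
  then have [measurable]: "A \<in> sets borel" by simp
  have "emeasure (distr std_gaussian borel (\<lambda>x. x \<bullet> d)) A = (\<integral>\<^sup>+x. indicator A x \<partial>distr std_gaussian borel (\<lambda>x. x \<bullet> d))"
    by simp
  also have "\<dots> = (\<integral>\<^sup>+x. indicator A (x \<bullet> d) \<partial>std_gaussian)"
    by (rule nn_integral_distr) measurable
  also have "\<dots> = emeasure std_gaussian A"
    by (subst nn_integral_marginal[OF assms]) auto
  finally show "emeasure (distr std_gaussian borel (\<lambda>x. x \<bullet> d)) A = emeasure std_gaussian A" .
qed simp

lemma measure_marginal:
  fixes d :: "'a::euclidean_space"
  assumes "norm d = 1" "A \<in> sets borel"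
  shows "measure std_gaussian {x. x \<bullet> d \<in> A} = measure std_gaussian A"
  using assms measure_distr[of "\<lambda>x. x \<bullet> d" std_gaussian borel A]
  by (simp add: distr_marginal vimage_def)

text \<open>The Cameron--Martin formula: translation invariance of Lebesgue measure turns the shift
  into the quotient of the two Gaussian densities.\<close>

lemma nn_integral_shift:
  fixes w :: "'a::euclidean_space"
  assumes [measurable]: "F \<in> borel_measurable borel"
  shows "(\<integral>\<^sup>+x. F (x + w) \<partial>std_gaussian) = (\<integral>\<^sup>+x. ennreal (exp (x \<bullet> w - (norm w)\<^sup>2 / 2)) * F x \<partial>std_gaussian)"
proof -
  let ?g = "gaussian_density DIM('a)"
  have g: "?g (x - w) = ?g x * exp (x \<bullet> w - (norm w)\<^sup>2 / 2)" for x
  proof -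
    have "- (norm (x - w))\<^sup>2 / 2 = - (norm x)\<^sup>2 / 2 + (x \<bullet> w - (norm w)\<^sup>2 / 2)"
      unfolding power2_norm_eq_inner by (simp add: inner_diff_left inner_diff_right inner_commute field_simps)
    then show ?thesis unfolding gaussian_density_def by (simp only: exp_add mult.assoc)
  qed
  have "(\<integral>\<^sup>+x. F (x + w) \<partial>std_gaussian) = (\<integral>\<^sup>+x. ennreal (?g ((x + w) - w)) * F (x + w) \<partial>lborel)"
    by (simp add: nn_integral_std_gaussian)
  also have "\<dots> = (\<integral>\<^sup>+x. ennreal (?g (x - w)) * F x \<partial>lborel)"
    by (rule nn_integral_lborel_translate[of "\<lambda>x. ennreal (?g (x - w)) * F x"]) measurable
  also have "\<dots> = (\<integral>\<^sup>+x. ennreal (exp (x \<bullet> w - (norm w)\<^sup>2 / 2)) * F x \<partial>std_gaussian)"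
    unfolding g by (subst nn_integral_std_gaussian) (auto simp: ennreal_mult' mult.assoc less_imp_le gaussian_density_pos)
  finally show ?thesis .
qed

section \<open>Orthogonal projections of the Gaussian measure\<close>

lemma proj_measurable [measurable]: "orth_proj B \<in> borel_measurable borel"
  unfolding orth_proj_def[abs_def] by measurable

text \<open>One direction is resampled at a time. Resampling along \<open>b\<close> does not affect
  the projection onto the remaining directions, because they are orthogonal to
  \<open>b\<close>.\<close>

lemma nn_integral_resample_proj:
  fixes B :: "'a::euclidean_space set"
  assumes "finite B" "orthonormal B" and [measurable]: "F \<in> borel_measurable borel"
  shows "(\<integral>\<^sup>+f. \<integral>\<^sup>+x. F (x - orth_proj B x + (\<Sum>b\<in>B. f b *\<^sub>R b)) \<partial>std_gaussian \<partial>(\<Pi>\<^sub>M b\<in>B. std_gaussian))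
    = (\<integral>\<^sup>+x. F x \<partial>std_gaussian)"
  using assms(1,2)
proof (induction B rule: finite_induct)
  case empty
  then show ?case by (simp add: orth_proj_def PiM_empty)
next
  case (insert b B)
  have ob: "orthonormal B" and nb: "norm b = 1" and bb: "b \<bullet> b = 1"
    and bc: "\<And>c. c \<in> B \<Longrightarrow> b \<bullet> c = 0" "\<And>c. c \<in> B \<Longrightarrow> c \<bullet> b = 0"
    using insert by (auto simp: orthonormal_def pairwise_insert orthogonal_def norm_eq_1 inner_commute)
  have [measurable]: "(\<lambda>f. \<Sum>c\<in>B. f c *\<^sub>R c) \<in> borel_measurable (\<Pi>\<^sub>M b\<in>B. std_gaussian)"
    by measurable
  have [measurable]: "(\<lambda>f. \<Sum>c\<in>insert b B. f c *\<^sub>R c) \<in> borel_measurable (\<Pi>\<^sub>M b\<in>insert b B. std_gaussian)"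
    by measurable
  have "(\<integral>\<^sup>+f. \<integral>\<^sup>+x. F (x - orth_proj (insert b B) x + (\<Sum>c\<in>insert b B. f c *\<^sub>R c)) \<partial>std_gaussian \<partial>(\<Pi>\<^sub>M b\<in>insert b B. std_gaussian))
    = (\<integral>\<^sup>+f. \<integral>\<^sup>+u. \<integral>\<^sup>+x. F (x - orth_proj (insert b B) x + (\<Sum>c\<in>insert b B. (f(b := u)) c *\<^sub>R c)) \<partial>std_gaussian \<partial>std_gaussian \<partial>(\<Pi>\<^sub>M b\<in>B. std_gaussian))"
    by (rule gauss_PiM.product_nn_integral_insert) (use insert in measurable)
  also have "\<dots> = (\<integral>\<^sup>+f. \<integral>\<^sup>+x. F (x - orth_proj B x + (\<Sum>c\<in>B. f c *\<^sub>R c)) \<partial>std_gaussian \<partial>(\<Pi>\<^sub>M b\<in>B. std_gaussian))"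
  proof (rule nn_integral_cong)
    fix f :: "'a \<Rightarrow> real"
    let ?S = "\<Sum>c\<in>B. f c *\<^sub>R c"
    have "(\<integral>\<^sup>+x. F (x - orth_proj B x + ?S) \<partial>std_gaussian)
      = (\<integral>\<^sup>+x. \<integral>\<^sup>+u. F ((x - (x \<bullet> b) *\<^sub>R b + u *\<^sub>R b) - orth_proj B (x - (x \<bullet> b) *\<^sub>R b + u *\<^sub>R b) + ?S) \<partial>std_gaussian \<partial>std_gaussian)"
      by (rule nn_integral_resample[OF nb, symmetric]) measurable
    also have "\<dots> = (\<integral>\<^sup>+x. \<integral>\<^sup>+u. F (x - orth_proj (insert b B) x + (u *\<^sub>R b + ?S)) \<partial>std_gaussian \<partial>std_gaussian)"
    proof (intro nn_integral_cong arg_cong[where f = F])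
      fix x :: 'a and u :: real
      have "orth_proj B (x - (x \<bullet> b) *\<^sub>R b + u *\<^sub>R b) = orth_proj B x"
        unfolding orth_proj_def by (intro sum.cong) (auto simp: inner_add_left inner_diff_left bc)
      moreover have "orth_proj (insert b B) x = (x \<bullet> b) *\<^sub>R b + orth_proj B x"
        using insert by (simp add: orth_proj_def)
      ultimately show "(x - (x \<bullet> b) *\<^sub>R b + u *\<^sub>R b) - orth_proj B (x - (x \<bullet> b) *\<^sub>R b + u *\<^sub>R b) + ?S
          = x - orth_proj (insert b B) x + (u *\<^sub>R b + ?S)"
        by (simp add: algebra_simps)
    qed
    also have "\<dots> = (\<integral>\<^sup>+u. \<integral>\<^sup>+x. F (x - orth_proj (insert b B) x + (u *\<^sub>R b + ?S)) \<partial>std_gaussian \<partial>std_gaussian)"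
      by (rule G1G.Fubini') measurable
    also have "\<dots> = (\<integral>\<^sup>+u. \<integral>\<^sup>+x. F (x - orth_proj (insert b B) x + (\<Sum>c\<in>insert b B. (f(b := u)) c *\<^sub>R c)) \<partial>std_gaussian \<partial>std_gaussian)"
    proof -
      have "(\<Sum>c\<in>B. (f(b := u)) c *\<^sub>R c) = ?S" for u
        using insert by (intro sum.cong) auto
      then show ?thesis using insert by simp
    qed
    finally show "(\<integral>\<^sup>+u. \<integral>\<^sup>+x. F (x - orth_proj (insert b B) x + (\<Sum>c\<in>insert b B. (f(b := u)) c *\<^sub>R c)) \<partial>std_gaussian \<partial>std_gaussian)
      = (\<integral>\<^sup>+x. F (x - orth_proj B x + ?S) \<partial>std_gaussian)" ..
  qed
  also have "\<dots> = (\<integral>\<^sup>+x. F x \<partial>std_gaussian)" by (rule insert.IH[OF ob])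
  finally show ?case .
qed

lemma proj_inner:
  assumes "orthonormal B" "c \<in> B"
  shows "orth_proj B x \<bullet> c = x \<bullet> c"
  unfolding orth_proj_def by (rule orthonormal_sum_inner[OF assms])

lemma proj_diff: "orth_proj B (x - y) = orth_proj B x - orth_proj B y"
  and proj_add: "orth_proj B (x + y) = orth_proj B x + orth_proj B y"
  and proj_scale: "orth_proj B (c *\<^sub>R x) = c *\<^sub>R orth_proj B x"
  by (simp_all add: orth_proj_def inner_diff_left inner_add_left scaleR_diff_left scaleR_add_left
      sum_subtractf sum.distrib scaleR_sum_right)

lemma proj_sum:
  assumes "orthonormal B"
  shows "orth_proj B (\<Sum>b\<in>B. f b *\<^sub>R b) = (\<Sum>b\<in>B. f b *\<^sub>R b)"
  unfolding orth_proj_def by (intro sum.cong refl) (simp add: orthonormal_sum_inner[OF assms])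

lemma proj_in_span: "orth_proj B x \<in> span B"
  unfolding orth_proj_def by (intro span_sum span_scale span_base)

lemma proj_residual:
  assumes "orthonormal B" "w \<in> span B"
  shows "(x - orth_proj B x) \<bullet> w = 0"
  using assms(2)
proof (induction rule: span_induct_alt)
  case (step c b y)
  then show ?case using proj_inner[OF assms(1) step(1), of x] by (simp add: inner_add_right inner_diff_left)
qed simp

lemma proj_unique:
  assumes "orthonormal B" "z \<in> span B" "\<And>w. w \<in> span B \<Longrightarrow> (x - z) \<bullet> w = 0"
  shows "orth_proj B x = z"
proof -
  have "orth_proj B x - z \<in> span B" using assms(2) proj_in_span by (rule span_diff[rotated])
  then have "(x - z) \<bullet> (orth_proj B x - z) = 0" "(x - orth_proj B x) \<bullet> (orth_proj B x - z) = 0"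
    using assms proj_residual by blast+
  then have "(orth_proj B x - z) \<bullet> (orth_proj B x - z) = 0"
    by (simp add: inner_diff_left)
  then show ?thesis by simp
qed

lemma proj_eq_of_span_eq:
  assumes "orthonormal B" "orthonormal C" "span B = span C"
  shows "orth_proj B = orth_proj C"
proof
  fix x show "orth_proj B x = orth_proj C x"
    by (rule proj_unique) (use assms proj_in_span[of C x] proj_residual[of C _ x] in auto)
qed

lemma proj_fixed: "orthonormal B \<Longrightarrow> x \<in> span B \<Longrightarrow> orth_proj B x = x"
  by (rule proj_unique) auto

lemma distr_proj:
  fixes B :: "'a::euclidean_space set"
  assumes "orthonormal B"
  shows "distr std_gaussian borel (orth_proj B) = distr (\<Pi>\<^sub>M b\<in>B. std_gaussian) borel (\<lambda>f. \<Sum>b\<in>B. f b *\<^sub>R b)"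
proof (rule measure_eqI)
  fix A :: "'a set" assume "A \<in> sets (distr std_gaussian borel (orth_proj B))"
  then have [measurable]: "A \<in> sets borel" by simp
  let ?S = "\<lambda>f. \<Sum>b\<in>B. f b *\<^sub>R b"
  have "emeasure (distr std_gaussian borel (orth_proj B)) A = (\<integral>\<^sup>+x. indicator A x \<partial>distr std_gaussian borel (orth_proj B))"
    by simp
  also have "\<dots> = (\<integral>\<^sup>+x. indicator A (orth_proj B x) \<partial>std_gaussian)"
    by (rule nn_integral_distr) measurable
  also have "\<dots> = (\<integral>\<^sup>+f. \<integral>\<^sup>+x. indicator A (orth_proj B (x - orth_proj B x + ?S f)) \<partial>std_gaussian \<partial>(\<Pi>\<^sub>M b\<in>B. std_gaussian))"
    by (rule nn_integral_resample_proj[OF orthonormal_finite[OF assms] assms, symmetric]) measurable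
  also have "\<dots> = (\<integral>\<^sup>+f. indicator A (?S f) \<partial>(\<Pi>\<^sub>M b\<in>B. std_gaussian))"
    by (simp add: proj_add proj_diff proj_sum[OF assms] proj_fixed[OF assms proj_in_span] )
  also have "\<dots> = (\<integral>\<^sup>+x. indicator A x \<partial>distr (\<Pi>\<^sub>M b\<in>B. std_gaussian) borel ?S)"
    by (rule nn_integral_distr[symmetric]) measurable
  also have "\<dots> = emeasure (distr (\<Pi>\<^sub>M b\<in>B. std_gaussian) borel ?S) A" by simp
  finally show "emeasure (distr std_gaussian borel (orth_proj B)) A = emeasure (distr (\<Pi>\<^sub>M b\<in>B. std_gaussian) borel ?S) A" .
qed simp

text \<open>The basis chosen inside \<open>lborel_subspace\<close> disappears because a projection
  depends only on the span. Gaussian measures on subspaces thereby become probabilities in the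
  ambient space, the form in which all sections are treated below.\<close>

lemma gaussian_subspace_eq:
  fixes B :: "'a::euclidean_space set"
  assumes "orthonormal B"
  shows "gaussian_subspace (span B) = distr std_gaussian borel (orth_proj B)"
proof -
  define C where "C = (SOME C. orthonormal_basis_of (span B) C)"
  have "orthonormal_basis_of (span B) C"
    unfolding C_def by (rule someI_ex) (auto intro: orthonormal_basis_of_ex)
  then have C: "orthonormal C" "span C = span B"
    by (auto simp: orthonormal_basis_of_def orthonormal_def)
  have dim: "dim (span B) = card C"
    using C orthonormal_independent[OF C(1)] by (metis dim_span_eq_card_independent)
  have "gaussian_subspace (span B) = density (distr (\<Pi>\<^sub>M b\<in>C. lborel) borel (\<lambda>f. \<Sum>b\<in>C. f b *\<^sub>R b)) (gaussian_density (card C))"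
    unfolding gaussian_subspace_def lborel_subspace_def Let_def dim C_def[symmetric] ..
  also have "\<dots> = distr std_gaussian borel (orth_proj C)"
    by (simp add: density_distr_PiM C distr_proj)
  also have "orth_proj C = orth_proj B" by (rule proj_eq_of_span_eq) (use C assms in auto)
  finally show ?thesis .
qed

section \<open>Ehrhard symmetrisation\<close>

lemma measure_std_gaussian_UNIV [simp]: "measure std_gaussian UNIV = 1"
  using N.prob_space by simp

definition resample :: "'a::euclidean_space \<Rightarrow> 'a \<Rightarrow> real \<Rightarrow> 'a" where
  "resample d x u = x - (x \<bullet> d) *\<^sub>R d + u *\<^sub>R d"

definition line_measure :: "'a::euclidean_space \<Rightarrow> 'a set \<Rightarrow> 'a \<Rightarrow> real" where
  "line_measure d A x = measure std_gaussian {u. resample d x u \<in> A}"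

text \<open>Every section in direction \<open>d\<close> is replaced by the half-line \<open>{u. \<Phi> u \<le> \<kappa>}\<close>, where \<open>\<kappa>\<close> is its measure; it is empty for
  \<open>\<kappa> = 0\<close> and the whole line for \<open>\<kappa> = 1\<close>.\<close>

definition ehrhard_sym :: "'a::euclidean_space \<Rightarrow> 'a set \<Rightarrow> 'a set" where
  "ehrhard_sym d A = {x. Phi (x \<bullet> d) \<le> line_measure d A x}"

lemma resample_measurable [measurable]:
  "(\<lambda>p. resample d (fst p) (snd p)) \<in> borel_measurable (borel \<Otimes>\<^sub>M borel)"
  "resample d x \<in> borel_measurable borel"
  unfolding resample_def by measurable

lemma resample_inner: "norm d = 1 \<Longrightarrow> resample d x u \<bullet> d = u"
  by (simp add: resample_def inner_add_left inner_diff_left norm_eq_1)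

lemma resample_resample: "norm d = 1 \<Longrightarrow> resample d (resample d x u) w = resample d x w"
  by (simp add: resample_def inner_add_left inner_diff_left norm_eq_1)

lemma resample_sets [measurable]: "A \<in> sets borel \<Longrightarrow> {u. resample d x u \<in> A} \<in> sets borel"
  using measurable_sets[OF resample_measurable(2), of A d x] by (simp add: vimage_def)

lemma nn_integral_resample':
  fixes d :: "'a::euclidean_space"
  assumes d: "norm d = 1" and [measurable]: "F \<in> borel_measurable borel"
  shows "(\<integral>\<^sup>+x. \<integral>\<^sup>+u. F (resample d x u) \<partial>std_gaussian \<partial>std_gaussian) = (\<integral>\<^sup>+x. F x \<partial>std_gaussian)"
  unfolding resample_def by (rule nn_integral_resample[OF assms])

lemma ennreal_line_measure:
  assumes [measurable]: "A \<in> sets borel"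
  shows "ennreal (line_measure d A x) = (\<integral>\<^sup>+u. indicator A (resample d x u) \<partial>std_gaussian)"
proof -
  have "(\<integral>\<^sup>+u. indicator A (resample d x u) \<partial>std_gaussian) = (\<integral>\<^sup>+u. indicator {u. resample d x u \<in> A} u \<partial>std_gaussian)"
    by (intro nn_integral_cong) (auto simp: indicator_def)
  also have "\<dots> = emeasure std_gaussian {u. resample d x u \<in> A}" by simp
  finally show ?thesis by (simp add: line_measure_def N1.emeasure_eq_measure)
qed

lemma line_measure_measurable [measurable]:
  assumes [measurable]: "A \<in> sets borel"
  shows "line_measure d A \<in> borel_measurable borel"
proof -
  have "(\<lambda>x. \<integral>\<^sup>+u. indicator A (resample d x u) \<partial>std_gaussian) \<in> borel_measurable borel"
    by measurable
  then have "(\<lambda>x. enn2real (ennreal (line_measure d A x))) \<in> borel_measurable borel"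
    by (subst ennreal_line_measure) auto
  moreover have "(\<lambda>x. enn2real (ennreal (line_measure d A x))) = line_measure d A"
    by (simp add: line_measure_def fun_eq_iff)
  ultimately show ?thesis by simp
qed

lemma line_measure_nonneg: "0 \<le> line_measure d A x" and line_measure_le_1: "line_measure d A x \<le> 1"
  by (simp_all add: line_measure_def)

lemma ehrhard_sym_sets [measurable]:
  assumes [measurable]: "A \<in> sets borel"
  shows "ehrhard_sym d A \<in> sets borel"
  unfolding ehrhard_sym_def by measurable

lemma line_measure_resample: "norm d = 1 \<Longrightarrow> line_measure d A (resample d x u) = line_measure d A x"
  by (simp add: line_measure_def resample_resample)

lemma resample_in_ehrhard_sym_iff: "norm d = 1 \<Longrightarrow> resample d x u \<in> ehrhard_sym d A \<longleftrightarrow> Phi u \<le> line_measure d A x"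
  by (simp add: ehrhard_sym_def line_measure_resample resample_inner)

lemma nn_integral_line_measure:
  assumes "norm d = 1" and [measurable]: "A \<in> sets borel"
  shows "(\<integral>\<^sup>+x. line_measure d A x \<partial>std_gaussian) = emeasure std_gaussian A"
  by (simp add: ennreal_line_measure nn_integral_resample'[OF assms(1)])

lemma line_measure_integral:
  assumes "norm d = 1" and [measurable]: "A \<in> sets borel"
  shows "integrable std_gaussian (line_measure d A)" "(\<integral>x. line_measure d A x \<partial>std_gaussian) = measure std_gaussian A"
proof -
  show "integrable std_gaussian (line_measure d A)"
    by (rule N.integrable_const_bound[of _ 1]) (auto simp: line_measure_nonneg line_measure_le_1)
  show "(\<integral>x. line_measure d A x \<partial>std_gaussian) = measure std_gaussian A"
    by (subst integral_eq_nn_integral) (auto simp: line_measure_nonneg nn_integral_line_measure assms(1) measure_def)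
qed

lemma measure_Phi_le:
  assumes "0 \<le> p" "p \<le> 1"
  shows "measure std_gaussian {u. Phi u \<le> p} = p"
proof -
  consider "p = 0" | "p = 1" | "0 < p" "p < 1" using assms by linarith
  then show ?thesis
  proof cases
    case 1
    then have "{u. Phi u \<le> p} = {}" using Phi_bounds by (auto simp: not_le)
    with 1 show ?thesis by simp
  next
    case 2
    then have "{u. Phi u \<le> p} = space std_gaussian" using Phi_bounds by (auto simp: less_imp_le)
    with 2 show ?thesis using N1.prob_space by simp
  next
    case 3
    then obtain b where "Phi b = p" using Phi_surj by blast
    then have "{u. Phi u \<le> p} = {..b}" by auto
    then show ?thesis using \<open>Phi b = p\<close> by (simp add: Phi_def)
  qed
qed

lemma measure_Phi_marginal_le:
  fixes e :: "'a::euclidean_space"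
  assumes "norm e = 1" "0 \<le> p" "p \<le> 1"
  shows "measure std_gaussian {x. Phi (x \<bullet> e) \<le> p} = p"
proof -
  have "{u. Phi u \<le> p} \<in> sets borel" by measurable
  from measure_marginal[OF assms(1) this] show ?thesis
    using measure_Phi_le[OF assms(2,3)] by simp
qed

lemma line_measure_ehrhard_sym:
  assumes "norm d = 1"
  shows "line_measure d (ehrhard_sym d A) x = line_measure d A x"
proof -
  have "line_measure d (ehrhard_sym d A) x = measure std_gaussian {u. Phi u \<le> line_measure d A x}"
    by (simp add: line_measure_def[of d "ehrhard_sym d A"] resample_in_ehrhard_sym_iff[OF assms])
  then show ?thesis by (simp add: measure_Phi_le line_measure_nonneg line_measure_le_1)
qed

lemma measure_ehrhard_sym:
  assumes "norm d = 1" and [measurable]: "A \<in> sets borel"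
  shows "measure std_gaussian (ehrhard_sym d A) = measure std_gaussian A"
  using line_measure_integral(2)[OF assms] line_measure_integral(2)[OF assms(1), of "ehrhard_sym d A"]
  by (simp add: line_measure_ehrhard_sym assms(1))

lemma resample_combination:
  "(1 - s) *\<^sub>R resample d x u + s *\<^sub>R resample d y w = resample d ((1 - s) *\<^sub>R x + s *\<^sub>R y) ((1 - s) * u + s * w)"
  by (simp add: resample_def inner_add_left algebra_simps)

text \<open>The sections of \<open>A\<close> and \<open>B\<close> on the lines through
  \<open>x\<close> and \<open>y\<close> combine into the section of \<open>C\<close> on the line
  through the combined point. So membership in \<open>ehrhard_sym d C\<close> is
  \<open>ehrhard_real\<close> with levels \<open>x \<bullet> d\<close> and
  \<open>y \<bullet> d\<close>.\<close>

lemma ehrhard_sym_combination: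
  fixes A B C :: "'a::euclidean_space set"
  assumes d: "norm d = 1" and "convex A" "convex B"
    and [measurable]: "A \<in> sets borel" "B \<in> sets borel" "C \<in> sets borel"
    and s: "0 \<le> s" "s \<le> 1"
    and comb: "\<And>x y. x \<in> A \<Longrightarrow> y \<in> B \<Longrightarrow> (1 - s) *\<^sub>R x + s *\<^sub>R y \<in> C"
    and x: "x \<in> ehrhard_sym d A" and y: "y \<in> ehrhard_sym d B"
  shows "(1 - s) *\<^sub>R x + s *\<^sub>R y \<in> ehrhard_sym d C"
proof -
  have conv: "convex {u. resample d x u \<in> K}" if "convex K" for K and x :: 'a
  proof -
    have "resample d x ((1 - \<theta>) * u + \<theta> * w) \<in> K"
      if "resample d x u \<in> K" "resample d x w \<in> K" "0 \<le> \<theta>" "\<theta> \<le> 1" for u w \<theta>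
      using convexD_alt[OF \<open>convex K\<close> that] by (simp add: resample_combination scaleR_left_distrib[symmetric])
    then show ?thesis by (auto simp: convex_alt)
  qed
  have "Phi ((1 - s) * (x \<bullet> d) + s * (y \<bullet> d)) \<le> measure std_gaussian {u. resample d ((1 - s) *\<^sub>R x + s *\<^sub>R y) u \<in> C}"
  proof (rule ehrhard_real[OF conv[OF assms(2), of x] conv[OF assms(3), of y] _ _ _ s])
    show "Phi (x \<bullet> d) \<le> measure std_gaussian {u. resample d x u \<in> A}"
      "Phi (y \<bullet> d) \<le> measure std_gaussian {u. resample d y u \<in> B}"
      using x y by (simp_all add: ehrhard_sym_def line_measure_def)
  qed (auto simp: resample_combination[symmetric] intro: comb)
  then show ?thesis by (simp add: ehrhard_sym_def line_measure_def inner_add_left)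
qed

lemma convex_ehrhard_sym:
  assumes "norm d = 1" "convex A" "A \<in> sets borel"
  shows "convex (ehrhard_sym d A)"
  unfolding convex_alt
  using ehrhard_sym_combination[OF assms(1,2,2,3,3,3)] convexD_alt[OF assms(2)] by blast

lemma ehrhard_sym_downward:
  assumes "norm d = 1" "x \<in> ehrhard_sym d A" "0 \<le> c"
  shows "x - c *\<^sub>R d \<in> ehrhard_sym d A"
proof -
  have "line_measure d A (x - c *\<^sub>R d) = line_measure d A x"
    using assms(1) by (simp add: line_measure_def resample_def inner_diff_left norm_eq_1 algebra_simps)
  moreover have "(x - c *\<^sub>R d) \<bullet> d \<le> x \<bullet> d"
    using assms by (simp add: inner_diff_left norm_eq_1)
  then have "Phi ((x - c *\<^sub>R d) \<bullet> d) \<le> Phi (x \<bullet> d)" by simp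
  ultimately show ?thesis using assms(2) unfolding ehrhard_sym_def mem_Collect_eq by linarith
qed

section \<open>Decrease of the first moment under symmetrisation\<close>

lemma integrable_std_gaussian_id: "integrable std_gaussian (\<lambda>u::real. u)"
  unfolding std_gaussian_real using integrable_std_normal_moment[of 1]
  by (subst integrable_density) auto

lemma integrable_std_gaussian_inner:
  fixes e :: "'a::euclidean_space"
  shows "integrable std_gaussian (\<lambda>x. x \<bullet> e)"
proof (cases "e = 0")
  case False
  define d where "d = e /\<^sub>R norm e"
  have d: "norm d = 1" using False by (simp add: d_def)
  have "integrable (distr std_gaussian borel (\<lambda>x. x \<bullet> d)) (\<lambda>u. u)"
    by (simp add: distr_marginal d integrable_std_gaussian_id)
  then have "integrable std_gaussian (\<lambda>x. x \<bullet> d)"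
    by (subst (asm) integrable_distr_eq) auto
  then have "integrable std_gaussian (\<lambda>x. norm e * (x \<bullet> d))" by simp
  then show ?thesis using False by (simp add: d_def)
qed simp

text \<open>Suppose \<open>H\<close> is the half-line up to \<open>b\<close>. Points of
  \<open>B\<close> with \<open>Phi u > \<kappa> + \<eta>\<close> lie more than \<open>\<eta>\<close>
  beyond \<open>b\<close>, because \<open>Phi\<close> is 1-Lipschitz, and each contributes at least
  \<open>\<eta>\<close> to the gain. The remaining points of \<open>B - H\<close> lie in a strip of
  measure at most \<open>\<eta>\<close>.\<close>

lemma symmetrisation_gain_real:
  fixes B :: "real set"
  assumes [measurable]: "B \<in> sets borel" and "0 \<le> \<eta>"
  defines "H \<equiv> {u. Phi u \<le> measure std_gaussian B}"
  shows "\<eta> * (measure std_gaussian (B - H) - \<eta>)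
    \<le> (\<integral>u. u * indicator B u \<partial>std_gaussian) - (\<integral>u. u * indicator H u \<partial>std_gaussian)"
proof -
  define \<kappa> where "\<kappa> = measure std_gaussian B"
  have \<kappa>: "0 \<le> \<kappa>" "\<kappa> \<le> 1" by (simp_all add: \<kappa>_def)
  have [measurable]: "H \<in> sets borel" unfolding H_def by measurable
  have H: "measure std_gaussian H = \<kappa>" using measure_Phi_le[OF \<kappa>] by (simp add: H_def \<kappa>_def)
  have int: "integrable std_gaussian (\<lambda>u. u * indicator S u)" if [measurable]: "S \<in> sets borel" for S :: "real set"
    by (rule integrable_real_mult_indicator) (auto intro: integrable_std_gaussian_id)
  have neg: "\<eta> * (0 - \<eta>) \<le> 0" using assms(2) by simp
  \<comment> \<open>At the extreme values there is no finite threshold \<open>b\<close>; there the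
    two integrals agree and the left side is nonpositive.\<close>
  consider "\<kappa> = 0" | "\<kappa> = 1" | "0 < \<kappa>" "\<kappa> < 1" using \<kappa> by linarith
  then show ?thesis
  proof cases
    case 1
    have N: "AE u in std_gaussian. u \<notin> B" "AE u in std_gaussian. u \<notin> H"
      using 1 H by (auto intro!: AE_not_in simp: null_sets_def N1.emeasure_eq_measure \<kappa>_def)
    have "AE u in std_gaussian. u * indicator B u = 0" using N(1) by (auto elim: eventually_mono)
    moreover have "AE u in std_gaussian. u * indicator H u = 0" using N(2) by (auto elim: eventually_mono)
    ultimately have "(\<integral>u. u * indicator B u \<partial>std_gaussian) = 0" "(\<integral>u. u * indicator H u \<partial>std_gaussian) = 0"
      by (blast intro: integral_eq_zero_AE)+
    moreover have "measure std_gaussian (B - H) \<le> measure std_gaussian B"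
      by (rule N1.finite_measure_mono) auto
    then have "measure std_gaussian (B - H) = 0"
      using 1 by (intro antisym measure_nonneg) (simp add: \<kappa>_def)
    ultimately show ?thesis using neg by simp
  next
    case 2
    have "AE u in std_gaussian. u \<in> B" "AE u in std_gaussian. u \<in> H"
      using 2 H N1.prob_eq_1[of B] N1.prob_eq_1[of H] by (simp_all add: \<kappa>_def)
    then have *: "(\<integral>u. u * indicator B u \<partial>std_gaussian) = (\<integral>u. u * indicator H u \<partial>std_gaussian)"
      by (intro integral_cong_AE) (auto elim!: eventually_elim2)
    have "H = UNIV" using 2 Phi_bounds(2) by (auto simp: H_def \<kappa>_def[symmetric] less_imp_le)
    then show ?thesis using * neg by simp
  next
    case 3
    then obtain b where b: "Phi b = \<kappa>" using Phi_surj by blast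
    have Hb: "H = {..b}" using b by (auto simp: H_def \<kappa>_def[symmetric])
    let ?R = "{u. \<kappa> < Phi u \<and> Phi u \<le> \<kappa> + \<eta>}"
    have [measurable]: "?R \<in> sets borel" by measurable
    have "measure std_gaussian ?R \<le> \<eta>"
    proof -
      have "?R \<subseteq> {u. Phi u \<le> min 1 (\<kappa> + \<eta>)} - H"
        using Phi_bounds(2) by (auto simp: H_def \<kappa>_def[symmetric] less_imp_le)
      then have "measure std_gaussian ?R \<le> measure std_gaussian ({u. Phi u \<le> min 1 (\<kappa> + \<eta>)} - H)"
        by (intro N1.finite_measure_mono) auto
      also have "\<dots> = measure std_gaussian {u. Phi u \<le> min 1 (\<kappa> + \<eta>)} - measure std_gaussian H"
        by (rule N1.finite_measure_Diff) (use assms(2) \<kappa> in \<open>auto simp: H_def \<kappa>_def[symmetric]\<close>)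
      also have "\<dots> \<le> \<eta>"
        using assms(2) \<kappa> by (subst measure_Phi_le) (auto simp: H)
      finally show ?thesis .
    qed
    then have "\<eta> * (measure std_gaussian (B - H) - \<eta>) \<le> \<eta> * (measure std_gaussian (B - H) - measure std_gaussian ?R)"
      using assms(2) by (intro mult_left_mono) auto
    also have "\<dots> = (\<integral>u. \<eta> * (indicator (B - H) u - indicator ?R u) \<partial>std_gaussian)"
      by (subst integral_mult_right_zero, subst Bochner_Integration.integral_diff)
         (auto simp: N1.emeasure_eq_measure)
    \<comment> \<open>Subtracting \<open>b\<close> times the difference of the indicators does not
      change the integral, since \<open>B\<close> and \<open>H\<close> have equal measure; it makes
      the integrand on the right nonnegative everywhere.\<close>
    also have "\<dots> \<le> (\<integral>u. (u * indicator B u - u * indicator H u) - b * (indicator B u - indicator H u) \<partial>std_gaussian)"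
    proof (rule integral_mono)
      show "integrable std_gaussian (\<lambda>u. \<eta> * (indicator (B - H) u - indicator ?R u))"
        by (auto intro!: integrable_mult_right Bochner_Integration.integrable_diff simp: N1.emeasure_eq_measure)
      show "integrable std_gaussian (\<lambda>u. (u * indicator B u - u * indicator H u) - b * (indicator B u - indicator H u))"
        by (auto intro!: integrable_mult_right Bochner_Integration.integrable_diff int simp: N1.emeasure_eq_measure)
      fix u :: real
      show "\<eta> * (indicator (B - H) u - indicator ?R u) \<le> (u * indicator B u - u * indicator H u) - b * (indicator B u - indicator H u)"
      proof (cases "u \<le> b")
        case True
        then have "u \<in> H" "u \<notin> ?R" using b Hb by auto
        then show ?thesis using True by (auto simp: indicator_def)
      next
        case False
        then have "\<kappa> < Phi u" using b by (auto simp flip: b)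
        moreover have "Phi u - \<kappa> \<le> u - b" using Phi_lipschitz[of b u] False b by simp
        ultimately show ?thesis using False assms(2) by (auto simp: indicator_def Hb)
      qed
    qed
    also have "\<dots> = (\<integral>u. u * indicator B u \<partial>std_gaussian) - (\<integral>u. u * indicator H u \<partial>std_gaussian)"
      by (simp add: int H \<kappa>_def N1.emeasure_eq_measure)
    finally show ?thesis .
  qed
qed

lemma distr_resample:
  fixes d :: "'a::euclidean_space"
  assumes "norm d = 1"
  shows "distr (std_gaussian \<Otimes>\<^sub>M std_gaussian) borel (\<lambda>p. resample d (fst p) (snd p)) = std_gaussian"
proof (rule measure_eqI)
  fix A :: "'a set" assume "A \<in> sets (distr (std_gaussian \<Otimes>\<^sub>M std_gaussian) borel (\<lambda>p. resample d (fst p) (snd p)))"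
  then have [measurable]: "A \<in> sets borel" by simp
  have "emeasure (distr (std_gaussian \<Otimes>\<^sub>M std_gaussian) borel (\<lambda>p. resample d (fst p) (snd p))) A
    = (\<integral>\<^sup>+x. indicator A x \<partial>(distr (std_gaussian \<Otimes>\<^sub>M std_gaussian) borel (\<lambda>p. resample d (fst p) (snd p))))"
    by simp
  also have "\<dots> = (\<integral>\<^sup>+p. indicator A (resample d (fst p) (snd p)) \<partial>(std_gaussian \<Otimes>\<^sub>M std_gaussian))"
    by (rule nn_integral_distr) measurable
  also have "\<dots> = (\<integral>\<^sup>+x. \<integral>\<^sup>+u. indicator A (resample d x u) \<partial>std_gaussian \<partial>std_gaussian)"
    by (subst N1.nn_integral_fst[symmetric]) auto
  also have "\<dots> = emeasure std_gaussian A"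
    by (subst nn_integral_resample'[OF assms]) auto
  finally show "emeasure (distr (std_gaussian \<Otimes>\<^sub>M std_gaussian) borel (\<lambda>p. resample d (fst p) (snd p))) A = emeasure std_gaussian A" .
qed simp

lemma integral_resample:
  fixes d :: "'a::euclidean_space" and F :: "'a \<Rightarrow> real"
  assumes d: "norm d = 1" and F: "integrable std_gaussian F"
  shows "integrable std_gaussian (\<lambda>x. \<integral>u. F (resample d x u) \<partial>std_gaussian)"
    and "(\<integral>x. \<integral>u. F (resample d x u) \<partial>std_gaussian \<partial>std_gaussian) = (\<integral>x. F x \<partial>std_gaussian)"
proof -
  have [measurable]: "F \<in> borel_measurable borel" using F by auto
  let ?T = "\<lambda>p. resample d (fst p) (snd p)"
  have int: "integrable (std_gaussian \<Otimes>\<^sub>M std_gaussian) (\<lambda>p. F (?T p))"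
    using F by (subst (asm) distr_resample[OF d, symmetric], subst (asm) integrable_distr_eq) auto
  show "integrable std_gaussian (\<lambda>x. \<integral>u. F (resample d x u) \<partial>std_gaussian)"
    using G1G.integrable_fst'[OF int] by simp
  have "(\<integral>x. F x \<partial>std_gaussian) = (\<integral>p. F (?T p) \<partial>(std_gaussian \<Otimes>\<^sub>M std_gaussian))"
    by (subst distr_resample[OF d, symmetric], subst integral_distr) auto
  then show "(\<integral>x. \<integral>u. F (resample d x u) \<partial>std_gaussian \<partial>std_gaussian) = (\<integral>x. F x \<partial>std_gaussian)"
    using G1G.integral_fst'[OF int] by simp
qed

definition moment :: "'a::euclidean_space \<Rightarrow> 'a set \<Rightarrow> real" where
  "moment e A = (\<integral>x. (x \<bullet> e) * indicator A x \<partial>std_gaussian)"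

lemma integrable_moment:
  "A \<in> sets borel \<Longrightarrow> integrable std_gaussian (\<lambda>x. (x \<bullet> e) * indicator A x)"
  by (rule integrable_real_mult_indicator) (auto intro: integrable_std_gaussian_inner)

lemma moment_lower: "A \<in> sets borel \<Longrightarrow> - (\<integral>x. \<bar>x \<bullet> e\<bar> \<partial>std_gaussian) \<le> moment e A"
  unfolding moment_def integral_minus[symmetric]
  by (intro integral_mono integrable_minus integrable_abs integrable_moment integrable_std_gaussian_inner)
     (auto simp: indicator_def)

text \<open>Integrate the one-dimensional gain over the lines in direction \<open>d\<close>. On each
  line \<open>x \<bullet> e\<close> is a constant plus \<open>d \<bullet> e\<close> times the
  coordinate, and the constant cancels because symmetrisation preserves the measure of the
  section.\<close>

lemma symmetrisation_gain:
  fixes A :: "'a::euclidean_space set"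
  assumes d: "norm d = 1" and [measurable]: "A \<in> sets borel" and "0 \<le> \<eta>" "0 \<le> d \<bullet> e"
  shows "(d \<bullet> e) * (\<eta> * (measure std_gaussian (A - ehrhard_sym d A) - \<eta>)) \<le> moment e A - moment e (ehrhard_sym d A)"
proof -
  define S where "S = ehrhard_sym d A"
  have [measurable]: "S \<in> sets borel" by (simp add: S_def)
  define F where "F x = (x \<bullet> e) * indicator A x - (x \<bullet> e) * indicator S x" for x
  have F: "integrable std_gaussian F"
    unfolding F_def[abs_def] by (intro Bochner_Integration.integrable_diff integrable_moment) auto
  have int: "integrable std_gaussian (\<lambda>u. u * indicator T u)" if [measurable]: "T \<in> sets borel" for T :: "real set"
    by (rule integrable_real_mult_indicator) (auto intro: integrable_std_gaussian_id)
  have "(d \<bullet> e) * (\<eta> * (line_measure d (A - S) x - \<eta>)) \<le> (\<integral>u. F (resample d x u) \<partial>std_gaussian)" for x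
  proof -
    define B where "B = {u. resample d x u \<in> A}"
    define H where "H = {u. Phi u \<le> measure std_gaussian B}"
    have [measurable]: "B \<in> sets borel" "H \<in> sets borel" unfolding B_def H_def by measurable
    have HS: "resample d x u \<in> S \<longleftrightarrow> u \<in> H" for u
      by (simp add: S_def H_def B_def resample_in_ehrhard_sym_iff[OF d] line_measure_def)
    have mH: "measure std_gaussian H = measure std_gaussian B"
      unfolding H_def by (rule measure_Phi_le) auto
    define c where "c = (x - (x \<bullet> d) *\<^sub>R d) \<bullet> e"
    have "F (resample d x u) = c * (indicator B u - indicator H u)
        + (d \<bullet> e) * (u * indicator B u - u * indicator H u)" for u
      by (simp add: F_def indicator_def HS B_def c_def) (simp add: resample_def inner_add_left)
    then have "(\<integral>u. F (resample d x u) \<partial>std_gaussian)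
      = (d \<bullet> e) * ((\<integral>u. u * indicator B u \<partial>std_gaussian) - (\<integral>u. u * indicator H u \<partial>std_gaussian))"
      by (simp add: int mH N1.emeasure_eq_measure)
    moreover have "\<eta> * (measure std_gaussian (B - H) - \<eta>)
      \<le> (\<integral>u. u * indicator B u \<partial>std_gaussian) - (\<integral>u. u * indicator H u \<partial>std_gaussian)"
      unfolding H_def by (rule symmetrisation_gain_real) (use assms in auto)
    moreover have "line_measure d (A - S) x = measure std_gaussian (B - H)"
      unfolding line_measure_def by (rule arg_cong[where f = "measure std_gaussian"]) (auto simp: HS B_def)
    ultimately show ?thesis using assms(4) by (simp add: mult_left_mono)
  qed
  then have "(\<integral>x. (d \<bullet> e) * (\<eta> * (line_measure d (A - S) x - \<eta>)) \<partial>std_gaussian) \<le> (\<integral>x. \<integral>u. F (resample d x u) \<partial>std_gaussian \<partial>std_gaussian)"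
    by (intro integral_mono integral_resample d F) (auto intro!: line_measure_integral d)
  also have "\<dots> = moment e A - moment e S"
    unfolding integral_resample(2)[OF d F] unfolding moment_def F_def
    by (intro Bochner_Integration.integral_diff integrable_moment) auto
  also have "(\<integral>x. (d \<bullet> e) * (\<eta> * (line_measure d (A - S) x - \<eta>)) \<partial>std_gaussian) = (d \<bullet> e) * (\<eta> * (measure std_gaussian (A - S) - \<eta>))"
    by (simp add: line_measure_integral d)
  finally show ?thesis by (simp add: S_def)
qed

section \<open>Ehrhard's inequality for convex sets\<close>

lemma gaussian_density_le_1: "gaussian_density k x \<le> 1"
proof -
  have "(2 * pi) powr (- (real k / 2)) \<le> (2 * pi) powr 0"
    using pi_gt3 by (intro powr_mono) auto
  then show ?thesis
    unfolding gaussian_density_def by (intro mult_le_one) auto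
qed

text \<open>Substituting \<open>y = x + z\<close> groups the pairs by their difference
  \<open>z\<close>, so that a single direction of symmetrisation can serve all pairs of one
  group.\<close>

lemma nn_integral_pair_difference:
  fixes P :: "'a::euclidean_space \<times> 'a \<Rightarrow> ennreal"
  assumes [measurable]: "P \<in> borel_measurable (borel \<Otimes>\<^sub>M borel)"
  defines "g \<equiv> \<lambda>x::'a. ennreal (gaussian_density DIM('a) x)"
  shows "(\<integral>\<^sup>+p. P p \<partial>(std_gaussian \<Otimes>\<^sub>M std_gaussian)) = (\<integral>\<^sup>+z. \<integral>\<^sup>+x. g x * g (x + z) * P (x, x + z) \<partial>lborel \<partial>lborel)"
proof -
  have [measurable]: "g \<in> borel_measurable borel" unfolding g_def by measurable
  have "(\<integral>\<^sup>+p. P p \<partial>(std_gaussian \<Otimes>\<^sub>M std_gaussian)) = (\<integral>\<^sup>+x. \<integral>\<^sup>+y. P (x, y) \<partial>std_gaussian \<partial>std_gaussian)"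
    by (rule N.nn_integral_fst[symmetric]) measurable
  also have "\<dots> = (\<integral>\<^sup>+x. g x * (\<integral>\<^sup>+y. g y * P (x, y) \<partial>lborel) \<partial>lborel)"
    by (simp add: nn_integral_std_gaussian g_def)
  also have "\<dots> = (\<integral>\<^sup>+x. \<integral>\<^sup>+z. g x * g (x + z) * P (x, x + z) \<partial>lborel \<partial>lborel)"
  proof (rule nn_integral_cong)
    fix x :: 'a
    have "(\<integral>\<^sup>+y. g y * P (x, y) \<partial>lborel) = (\<integral>\<^sup>+z. g (z + x) * P (x, z + x) \<partial>lborel)"
      by (rule nn_integral_lborel_translate[symmetric]) measurable
    then show "g x * (\<integral>\<^sup>+y. g y * P (x, y) \<partial>lborel) = (\<integral>\<^sup>+z. g x * g (x + z) * P (x, x + z) \<partial>lborel)"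
      by (simp add: nn_integral_cmult mult.assoc add.commute)
  qed
  also have "\<dots> = (\<integral>\<^sup>+z. \<integral>\<^sup>+x. g x * g (x + z) * P (x, x + z) \<partial>lborel \<partial>lborel)"
    by (rule lborel_pair.Fubini') measurable
  finally show ?thesis .
qed

text \<open>The sets \<open>half_space e p\<close> below are exactly those for which no pair is in the wrong order. For a
  fixed difference \<open>z\<close> of the two points, symmetrisation along \<open>z\<close> removes all such pairs.\<close>

definition wrong_pairs :: "'a::euclidean_space \<Rightarrow> 'a set \<Rightarrow> ('a \<times> 'a) set" where
  "wrong_pairs e A = {p. fst p \<notin> A \<and> snd p \<in> A \<and> fst p \<bullet> e < snd p \<bullet> e}"

lemma wrong_pairs_sets [measurable]:
  assumes [measurable]: "A \<in> sets borel"
  shows "wrong_pairs e A \<in> sets (borel \<Otimes>\<^sub>M borel)"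
proof -
  have "wrong_pairs e A = {p \<in> space (borel \<Otimes>\<^sub>M borel). fst p \<notin> A \<and> snd p \<in> A \<and> fst p \<bullet> e < snd p \<bullet> e}"
    by (auto simp: wrong_pairs_def space_pair_measure)
  also have "\<dots> \<in> sets (borel \<Otimes>\<^sub>M borel)" by measurable
  finally show ?thesis .
qed

text \<open>The parameter is a measure instead of a height, so that \<open>0\<close> and
  \<open>1\<close> give the empty set and the whole space.\<close>

definition half_space :: "'a::euclidean_space \<Rightarrow> real \<Rightarrow> 'a set" where
  "half_space e p = {x. Phi (x \<bullet> e) \<le> p}"

lemma half_space_sets [measurable]: "half_space e p \<in> sets borel"
  unfolding half_space_def by measurable

lemma measure_half_space:
  assumes "norm e = 1"
  shows "measure std_gaussian (half_space e (measure std_gaussian A)) = measure std_gaussian A"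
  unfolding half_space_def by (rule measure_Phi_marginal_le[OF assms]) auto

lemma measure_diff_half_space:
  assumes e: "norm e = 1" and [measurable]: "A \<in> sets borel"
  shows "measure std_gaussian (half_space e (measure std_gaussian A) - A) = measure std_gaussian (A - half_space e (measure std_gaussian A))"
  using measure_half_space[OF e, of A]
    N.finite_measure_Diff'[of A "half_space e (measure std_gaussian A)"]
    N.finite_measure_Diff'[of "half_space e (measure std_gaussian A)" A]
  by (simp add: Int_commute)

text \<open>Every point of \<open>L\<close> lies strictly below every point outside it, so the
  product of \<open>L - A\<close> and \<open>A - L\<close> consists of wrong pairs. The two factors
  have the same measure because \<open>L\<close> and \<open>A\<close> do.\<close>

lemma wrong_pairs_lower:
  fixes A :: "'a::euclidean_space set"
  assumes e: "norm e = 1" and [measurable]: "A \<in> sets borel"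
  defines "L \<equiv> half_space e (measure std_gaussian A)"
  shows "ennreal ((measure std_gaussian (A - L))\<^sup>2) \<le> emeasure (std_gaussian \<Otimes>\<^sub>M std_gaussian) (wrong_pairs e A)"
proof -
  have [measurable]: "L \<in> sets borel" by (simp add: L_def)
  have "x \<bullet> e < y \<bullet> e" if "x \<in> L" "y \<notin> L" for x y
  proof -
    have "Phi (x \<bullet> e) < Phi (y \<bullet> e)" using that unfolding L_def half_space_def mem_Collect_eq by linarith
    then show ?thesis by simp
  qed
  then have sub: "(L - A) \<times> (A - L) \<subseteq> wrong_pairs e A" by (auto simp: wrong_pairs_def)
  have "ennreal ((measure std_gaussian (A - L))\<^sup>2) = emeasure std_gaussian (L - A) * emeasure std_gaussian (A - L)"
    using measure_diff_half_space[OF assms(1,2)]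
    by (simp add: L_def N.emeasure_eq_measure power2_eq_square ennreal_mult')
  also have "\<dots> = emeasure (std_gaussian \<Otimes>\<^sub>M std_gaussian) ((L - A) \<times> (A - L))"
    by (rule N.emeasure_pair_measure_Times[symmetric]) auto
  also have "\<dots> \<le> emeasure (std_gaussian \<Otimes>\<^sub>M std_gaussian) (wrong_pairs e A)"
    by (rule emeasure_mono[OF sub]) measurable
  finally show ?thesis .
qed

text \<open>The symmetrised set \<open>S\<close> is closed under moving backwards along
  \<open>z\<close>. If \<open>x\<close> is outside \<open>A\<close> and \<open>x + z\<close> is in
  \<open>A\<close>, then either \<open>x + z\<close> lies in \<open>A - S\<close>, or
  \<open>x + z\<close> lies in \<open>S\<close> and therefore \<open>x\<close> lies in
  \<open>S - A\<close>. Both differences have equal measure, and the spare density factor is at most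
  1.\<close>

lemma wrong_pairs_shift_bound:
  fixes A :: "'a::euclidean_space set"
  assumes [measurable]: "A \<in> sets borel" and z: "z \<noteq> 0"
  defines "d \<equiv> z /\<^sub>R norm z" and "g \<equiv> \<lambda>x::'a. ennreal (gaussian_density DIM('a) x)"
  shows "(\<integral>\<^sup>+x. g x * g (x + z) * indicator (wrong_pairs e A) (x, x + z) \<partial>lborel)
    \<le> ennreal (2 * measure std_gaussian (A - ehrhard_sym d A))"
proof -
  have [measurable]: "g \<in> borel_measurable borel" unfolding g_def by measurable
  have g1: "g x \<le> 1" for x by (simp add: g_def gaussian_density_le_1)
  have d: "norm d = 1" "z = norm z *\<^sub>R d" using z by (auto simp: d_def)
  define S where "S = ehrhard_sym d A"
  have [measurable]: "S \<in> sets borel" by (simp add: S_def)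
  have "g x * g (x + z) * indicator (wrong_pairs e A) (x, x + z)
      \<le> g x * indicator (S - A) x + g (x + z) * indicator (A - S) (x + z)" for x
  proof (cases "x \<notin> A \<and> x + z \<in> A")
    case False
    then show ?thesis by (auto simp: wrong_pairs_def)
  next
    case True
    show ?thesis
    proof (cases "x + z \<in> S")
      case True
      have "x + z - norm z *\<^sub>R d \<in> S"
        using ehrhard_sym_downward[OF d(1), of "x + z" A "norm z"] True by (simp add: S_def)
      then have "x \<in> S" using d(2) by simp
      have "g x * g (x + z) * indicator (wrong_pairs e A) (x, x + z) \<le> g x * 1 * 1"
        using g1 by (intro mult_mono) (auto simp: indicator_def)
      then show ?thesis using \<open>x \<in> S\<close> \<open>x \<notin> A \<and> x + z \<in> A\<close> by (simp add: add_increasing2)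
    next
      case False
      have "g x * g (x + z) * indicator (wrong_pairs e A) (x, x + z) \<le> 1 * g (x + z) * 1"
        using g1 by (intro mult_mono) (auto simp: indicator_def)
      then show ?thesis using False \<open>x \<notin> A \<and> x + z \<in> A\<close> by (simp add: add_increasing)
    qed
  qed
  then have "(\<integral>\<^sup>+x. g x * g (x + z) * indicator (wrong_pairs e A) (x, x + z) \<partial>lborel)
      \<le> (\<integral>\<^sup>+x. g x * indicator (S - A) x + g (x + z) * indicator (A - S) (x + z) \<partial>lborel)"
    by (intro nn_integral_mono)
  also have "\<dots> = (\<integral>\<^sup>+x. g x * indicator (S - A) x \<partial>lborel) + (\<integral>\<^sup>+x. g (x + z) * indicator (A - S) (x + z) \<partial>lborel)"
    by (rule nn_integral_add) measurable
  also have "(\<integral>\<^sup>+x. g (x + z) * indicator (A - S) (x + z) \<partial>lborel) = (\<integral>\<^sup>+x. g x * indicator (A - S) x \<partial>lborel)"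
    by (rule nn_integral_lborel_translate) measurable
  also have "(\<integral>\<^sup>+x. g x * indicator (S - A) x \<partial>lborel) = emeasure std_gaussian (S - A)"
    unfolding g_def by (subst nn_integral_std_gaussian[symmetric]) auto
  also have "(\<integral>\<^sup>+x. g x * indicator (A - S) x \<partial>lborel) = emeasure std_gaussian (A - S)"
    unfolding g_def by (subst nn_integral_std_gaussian[symmetric]) auto
  also have "measure std_gaussian (S - A) = measure std_gaussian (A - S)"
    using measure_ehrhard_sym[OF d(1), of A] N.finite_measure_Diff'[of A S] N.finite_measure_Diff'[of S A]
    by (simp add: Int_commute S_def)
  then have "emeasure std_gaussian (S - A) + emeasure std_gaussian (A - S) = ennreal (2 * measure std_gaussian (A - S))"
    by (simp add: N.emeasure_eq_measure flip: ennreal_plus)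
  finally show ?thesis by (simp add: S_def)
qed

text \<open>For each difference \<open>z\<close> with \<open>z \<bullet> e > 0\<close> the
  contribution tends to 0 by \<open>wrong_pairs_shift_bound\<close>; for other \<open>z\<close>
  there are no wrong pairs. Dominated convergence applies because \<open>G\<close> is the density of
  the difference of two independent Gaussian points and has integral 1.\<close>

lemma wrong_pairs_tendsto_0:
  fixes A :: "nat \<Rightarrow> 'a::euclidean_space set"
  assumes A [measurable]: "\<And>j. A j \<in> sets borel"
    and lim: "\<And>d. norm d = 1 \<Longrightarrow> 0 < d \<bullet> e \<Longrightarrow> (\<lambda>j. measure std_gaussian (A j - ehrhard_sym d (A j))) \<longlonglongrightarrow> 0"
  shows "(\<lambda>j. emeasure (std_gaussian \<Otimes>\<^sub>M std_gaussian) (wrong_pairs e (A j))) \<longlonglongrightarrow> 0"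
proof -
  define g where "g = (\<lambda>x::'a. ennreal (gaussian_density DIM('a) x))"
  have [measurable]: "g \<in> borel_measurable borel" unfolding g_def by measurable
  define I where "I j z = (\<integral>\<^sup>+x. g x * g (x + z) * indicator (wrong_pairs e (A j)) (x, x + z) \<partial>lborel)" for j z
  define G where "G z = (\<integral>\<^sup>+x. g x * g (x + z) \<partial>lborel)" for z
  have I: "emeasure (std_gaussian \<Otimes>\<^sub>M std_gaussian) (wrong_pairs e (A j)) = (\<integral>\<^sup>+z. I j z \<partial>lborel)" for j
    unfolding I_def g_def by (subst nn_integral_pair_difference[symmetric]) auto
  have "(\<integral>\<^sup>+p. 1 \<partial>((std_gaussian :: 'a measure) \<Otimes>\<^sub>M (std_gaussian :: 'a measure))) = (\<integral>\<^sup>+z. G z \<partial>lborel)"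
    unfolding G_def g_def using nn_integral_pair_difference[of "\<lambda>_ :: 'a \<times> 'a. 1"] by simp
  moreover have "(\<integral>\<^sup>+p. 1 \<partial>((std_gaussian :: 'a measure) \<Otimes>\<^sub>M (std_gaussian :: 'a measure))) = 1"
    using N.emeasure_pair_measure_Times[of UNIV "std_gaussian :: 'a measure" UNIV] by (simp add: space_pair_measure)
  ultimately have G: "(\<integral>\<^sup>+z. G z \<partial>lborel) = 1" by simp
  have "(\<lambda>j. \<integral>\<^sup>+z. I j z \<partial>lborel) \<longlonglongrightarrow> (\<integral>\<^sup>+z. 0 \<partial>(lborel :: 'a measure))"
  proof (rule nn_integral_dominated_convergence[where w = G])
    show "AE z in lborel. I j z \<le> G z" for j
      unfolding I_def G_def by (intro AE_I2 nn_integral_mono) (auto simp: indicator_def)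
    have "(\<lambda>j. I j z) \<longlonglongrightarrow> 0" for z
    proof (cases "0 < z \<bullet> e")
      case True
      then have z: "z \<noteq> 0" by auto
      define d where "d = z /\<^sub>R norm z"
      have "norm d = 1" "0 < d \<bullet> e" using z True by (auto simp: d_def)
      from lim[OF this] have "(\<lambda>j. ennreal (2 * measure std_gaussian (A j - ehrhard_sym d (A j)))) \<longlonglongrightarrow> ennreal (2 * 0)"
        by (intro tendsto_intros)
      then have lim0: "(\<lambda>j. ennreal (2 * measure std_gaussian (A j - ehrhard_sym d (A j)))) \<longlonglongrightarrow> 0" by simp
      have "I j z \<le> ennreal (2 * measure std_gaussian (A j - ehrhard_sym d (A j)))" for j
        using wrong_pairs_shift_bound[OF A[of j] z, of e] by (simp add: I_def g_def d_def)
      then show ?thesis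
        by (intro tendsto_sandwich[OF _ _ tendsto_const lim0]) auto
    next
      case False
      then have "I j z = 0" for j
        by (simp add: I_def wrong_pairs_def inner_add_left)
      then show ?thesis by simp
    qed
    then show "AE z in lborel. (\<lambda>j. I j z) \<longlonglongrightarrow> 0" by simp
  qed (auto simp: I_def[abs_def] G_def[abs_def] G[unfolded G_def[abs_def]])
  then show ?thesis by (simp add: I)
qed

lemma tendsto_half_space:
  fixes A :: "nat \<Rightarrow> 'a::euclidean_space set"
  assumes e: "norm e = 1" and A [measurable]: "\<And>j. A j \<in> sets borel" and m: "\<And>j. measure std_gaussian (A j) = m"
    and lim: "\<And>d. norm d = 1 \<Longrightarrow> 0 < d \<bullet> e \<Longrightarrow> (\<lambda>j. measure std_gaussian (A j - ehrhard_sym d (A j))) \<longlonglongrightarrow> 0"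
  shows "(\<lambda>j. measure std_gaussian (A j - half_space e m)) \<longlonglongrightarrow> 0"
    and "(\<lambda>j. measure std_gaussian (half_space e m - A j)) \<longlonglongrightarrow> 0"
proof -
  have "(\<lambda>j. ennreal ((measure std_gaussian (A j - half_space e m))\<^sup>2)) \<longlonglongrightarrow> 0"
    by (rule tendsto_sandwich[OF _ _ tendsto_const wrong_pairs_tendsto_0[OF A lim]])
       (use wrong_pairs_lower[OF e A] in \<open>auto simp: m\<close>)
  then have "(\<lambda>j. (measure std_gaussian (A j - half_space e m))\<^sup>2) \<longlonglongrightarrow> 0"
    by (simp add: ennreal_tendsto_0_iff)
  then have "(\<lambda>j. sqrt ((measure std_gaussian (A j - half_space e m))\<^sup>2)) \<longlonglongrightarrow> sqrt 0"
    by (rule tendsto_real_sqrt)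
  then show "(\<lambda>j. measure std_gaussian (A j - half_space e m)) \<longlonglongrightarrow> 0" by simp
  then show "(\<lambda>j. measure std_gaussian (half_space e m - A j)) \<longlonglongrightarrow> 0"
    using measure_diff_half_space[OF e A] by (simp add: m)
qed

section \<open>Triples of fixed measures with nearly minimal total moment\<close>

definition ehrhard_triple :: "real \<Rightarrow> real \<Rightarrow> real \<Rightarrow> real \<Rightarrow> ('a::euclidean_space set \<times> 'a set \<times> 'a set) \<Rightarrow> bool" where
  "ehrhard_triple s \<alpha> \<beta> \<kappa> = (\<lambda>(A, B, C). convex A \<and> convex B \<and> A \<in> sets borel \<and> B \<in> sets borel \<and> C \<in> sets borel
     \<and> (\<forall>x\<in>A. \<forall>y\<in>B. (1 - s) *\<^sub>R x + s *\<^sub>R y \<in> C)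
     \<and> measure std_gaussian A = \<alpha> \<and> measure std_gaussian B = \<beta> \<and> measure std_gaussian C = \<kappa>)"

lemma ehrhard_triple_sym:
  assumes "norm d = 1" "0 \<le> s" "s \<le> 1" "ehrhard_triple s \<alpha> \<beta> \<kappa> (A, B, C)"
  shows "ehrhard_triple s \<alpha> \<beta> \<kappa> (ehrhard_sym d A, ehrhard_sym d B, ehrhard_sym d C)"
  using assms ehrhard_sym_combination[of d A B C s]
  by (auto simp: ehrhard_triple_def convex_ehrhard_sym measure_ehrhard_sym)

text \<open>The total moment is bounded below. Symmetrising a triple within \<open>1 / Suc j\<close>
  of the infimum gives another admissible triple, so it gains at most \<open>1 / Suc j\<close>; by
  \<open>symmetrisation_gain\<close> the sets can then change only little. The sequence is fixed
  before \<open>d\<close>, so one sequence serves all directions.\<close>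

lemma ehrhard_minimising_sequence:
  fixes e :: "'a::euclidean_space"
  assumes s: "0 \<le> s" "s \<le> 1" and T0: "ehrhard_triple s \<alpha> \<beta> \<kappa> (T0 :: 'a set \<times> 'a set \<times> 'a set)"
  shows "\<exists>A B C :: nat \<Rightarrow> 'a set. (\<forall>j. ehrhard_triple s \<alpha> \<beta> \<kappa> (A j, B j, C j)) \<and>
    (\<forall>d. norm d = 1 \<longrightarrow> 0 < d \<bullet> e \<longrightarrow> (\<lambda>j. measure std_gaussian (A j - ehrhard_sym d (A j))) \<longlonglongrightarrow> 0
      \<and> (\<lambda>j. measure std_gaussian (B j - ehrhard_sym d (B j))) \<longlonglongrightarrow> 0
      \<and> (\<lambda>j. measure std_gaussian (C j - ehrhard_sym d (C j))) \<longlonglongrightarrow> 0)"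
proof -
  define J where "J = (\<lambda>(A, B, C). moment e A + moment e B + moment e C)"
  define X where "X = J ` {T. ehrhard_triple s \<alpha> \<beta> \<kappa> T}"
  have bdd: "bdd_below X"
    unfolding X_def
  proof (rule bdd_belowI2)
    fix T :: "'a set \<times> 'a set \<times> 'a set"
    assume T: "T \<in> {T. ehrhard_triple s \<alpha> \<beta> \<kappa> T}"
    obtain A B C where [simp]: "T = (A, B, C)" by (cases T) auto
    have "A \<in> sets borel" "B \<in> sets borel" "C \<in> sets borel" using T by (auto simp: ehrhard_triple_def)
    then show "3 * - (\<integral>x. \<bar>x \<bullet> e\<bar> \<partial>std_gaussian) \<le> J T"
      using moment_lower[of A e] moment_lower[of B e] moment_lower[of C e] by (simp add: J_def)
  qed
  have "X \<noteq> {}" using T0 unfolding X_def by blast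
  have "\<exists>T. ehrhard_triple s \<alpha> \<beta> \<kappa> T \<and> J T < Inf X + 1 / real (Suc j)" for j
    using cInf_lessD[OF \<open>X \<noteq> {}\<close>, of "Inf X + 1 / real (Suc j)"] by (auto simp: X_def)
  then obtain T where T: "\<And>j. ehrhard_triple s \<alpha> \<beta> \<kappa> (T j)" "\<And>j. J (T j) < Inf X + 1 / real (Suc j)"
    by metis
  define A B C where "A j = fst (T j)" and "B j = fst (snd (T j))" and "C j = snd (snd (T j))" for j
  have ABC: "T j = (A j, B j, C j)" for j by (simp add: A_def B_def C_def)
  define D where "D d K = measure std_gaussian (K - ehrhard_sym d K)" for d :: 'a and K
  have Dsum: "(\<lambda>j. D d (A j) + D d (B j) + D d (C j)) \<longlonglongrightarrow> 0" if d: "norm d = 1" "0 < d \<bullet> e" for d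
  proof (rule order_tendstoI)
    fix a :: real assume "a < 0"
    then have "a < D d (A j) + D d (B j) + D d (C j)" for j
      using measure_nonneg[of std_gaussian] by (simp add: D_def add_nonneg_nonneg less_le_trans)
    then show "\<forall>\<^sub>F j in sequentially. a < D d (A j) + D d (B j) + D d (C j)" by simp
  next
    fix a :: real assume "0 < a"
    \<comment> \<open>The three gain estimates lose \<open>3 * \<eta>\<close> in total, and
      eventually the remainder is below \<open>\<eta>\<close>; hence the sum of the changes is below
      \<open>4 * \<eta>\<close>, which is less than \<open>a\<close>.\<close>
    define \<eta> where "\<eta> = a / 6"
    have \<eta>: "0 < \<eta>" using \<open>0 < a\<close> by (simp add: \<eta>_def)
    have bound: "(d \<bullet> e) * (\<eta> * (D d (A j) + D d (B j) + D d (C j) - 3 * \<eta>)) \<le> 1 / real (Suc j)" for j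
    proof -
      note tr = T(1)[of j, unfolded ABC]
      have sets: "A j \<in> sets borel" "B j \<in> sets borel" "C j \<in> sets borel"
        using tr by (auto simp: ehrhard_triple_def)
      have "(d \<bullet> e) * (\<eta> * (D d K - \<eta>)) \<le> moment e K - moment e (ehrhard_sym d K)" if "K \<in> sets borel" for K
        unfolding D_def using d \<eta> that by (intro symmetrisation_gain) auto
      from this[OF sets(1)] this[OF sets(2)] this[OF sets(3)]
      have "(d \<bullet> e) * (\<eta> * (D d (A j) + D d (B j) + D d (C j) - 3 * \<eta>)) \<le> J (T j) - J (ehrhard_sym d (A j), ehrhard_sym d (B j), ehrhard_sym d (C j))"
        by (simp add: J_def ABC algebra_simps)
      also have "Inf X \<le> J (ehrhard_sym d (A j), ehrhard_sym d (B j), ehrhard_sym d (C j))"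
        using ehrhard_triple_sym[OF d(1) s tr] by (intro cInf_lower[OF _ bdd]) (auto simp: X_def)
      then have "J (T j) - J (ehrhard_sym d (A j), ehrhard_sym d (B j), ehrhard_sym d (C j)) \<le> 1 / real (Suc j)"
        using T(2)[of j] by linarith
      finally show ?thesis .
    qed
    have "(\<lambda>j. 1 / real (Suc j)) \<longlonglongrightarrow> 0" by (rule LIMSEQ_Suc[OF lim_1_over_n])
    moreover have "0 < (d \<bullet> e) * (\<eta> * \<eta>)" using d \<eta> by simp
    ultimately have "\<forall>\<^sub>F j in sequentially. 1 / real (Suc j) < (d \<bullet> e) * (\<eta> * \<eta>)"
      by (rule order_tendstoD)
    then show "\<forall>\<^sub>F j in sequentially. D d (A j) + D d (B j) + D d (C j) < a"
    proof eventually_elim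
      case (elim j)
      then have "(d \<bullet> e) * (\<eta> * (D d (A j) + D d (B j) + D d (C j) - 3 * \<eta>)) < (d \<bullet> e) * (\<eta> * \<eta>)"
        using bound[of j] by linarith
      then have "D d (A j) + D d (B j) + D d (C j) - 3 * \<eta> < \<eta>"
        using d \<eta> by simp
      then show ?case using \<open>0 < a\<close> by (simp add: \<eta>_def)
    qed
  qed
  have nn: "0 \<le> D d K" for d K by (simp add: D_def)
  have "(\<lambda>j. D d (A j)) \<longlonglongrightarrow> 0 \<and> (\<lambda>j. D d (B j)) \<longlonglongrightarrow> 0 \<and> (\<lambda>j. D d (C j)) \<longlonglongrightarrow> 0"
    if "norm d = 1" "0 < d \<bullet> e" for d
    by (intro conjI; rule tendsto_sandwich[OF _ _ tendsto_const Dsum[OF that]];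
        use nn[of d] in \<open>auto intro!: always_eventually add_increasing2\<close>)
  then show ?thesis
    using T(1) unfolding ABC D_def by (intro exI[of _ A] exI[of _ B] exI[of _ C]) blast
qed

text \<open>On the ball of radius \<open>R\<close> the Gaussian density is at least
  \<open>m\<close>. This lets three differently translated exceptional sets be compared on one piece
  of space.\<close>

lemma lborel_translate_le_gaussian:
  fixes U V :: "'a::euclidean_space set"
  assumes [measurable]: "V \<in> sets borel" "U \<in> sets borel" and R: "\<And>x. x \<in> U \<Longrightarrow> norm (x + w) \<le> R"
  defines "m \<equiv> (2 * pi) powr (- (real DIM('a) / 2)) * exp (- R\<^sup>2 / 2)"
  shows "ennreal m * emeasure lborel {x\<in>U. x + w \<in> V} \<le> emeasure std_gaussian V"
proof -
  let ?g = "\<lambda>x::'a. gaussian_density DIM('a) x"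
  have m: "m \<le> ?g (x + w)" if "x \<in> U" for x
    unfolding m_def gaussian_density_def
    using R[OF that] norm_ge_zero[of "x + w"] by (intro mult_left_mono) (auto intro!: power_mono)
  have "ennreal m * emeasure lborel {x\<in>U. x + w \<in> V} = (\<integral>\<^sup>+x. ennreal m * indicator {x\<in>U. x + w \<in> V} x \<partial>lborel)"
    by (rule nn_integral_cmult_indicator[symmetric]) measurable
  also have "\<dots> \<le> (\<integral>\<^sup>+x. ennreal (?g (x + w)) * indicator V (x + w) \<partial>lborel)"
    by (intro nn_integral_mono) (auto simp: indicator_def m intro!: ennreal_leI)
  also have "\<dots> = (\<integral>\<^sup>+x. ennreal (?g x) * indicator V x \<partial>lborel)"
    by (rule nn_integral_lborel_translate[of "\<lambda>x. ennreal (?g x) * indicator V x"]) measurable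
  also have "\<dots> = emeasure std_gaussian V"
    by (subst nn_integral_std_gaussian[symmetric]) auto
  finally show ?thesis .
qed

text \<open>If the inequality failed, a fixed ball could be translated into the limiting half-spaces
  for \<open>A\<close> and \<open>B\<close> and also outside the one for \<open>C\<close>; the
  combination property then covers the ball by three sets of vanishing measure. Because the levels
  \<open>a\<close> and \<open>b\<close> are real numbers, the inverse of \<open>Phi\<close> is never
  evaluated at 0 or 1.\<close>

theorem ehrhard:
  fixes A B C :: "'a::euclidean_space set"
  assumes "convex A" "convex B" "A \<in> sets borel" "B \<in> sets borel" "C \<in> sets borel"
    and s: "0 \<le> s" "s \<le> 1"
    and "\<And>x y. x \<in> A \<Longrightarrow> y \<in> B \<Longrightarrow> (1 - s) *\<^sub>R x + s *\<^sub>R y \<in> C"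
    and a: "Phi a \<le> measure std_gaussian A" and b: "Phi b \<le> measure std_gaussian B"
  shows "Phi ((1 - s) * a + s * b) \<le> measure std_gaussian C"
proof (rule ccontr)
  define \<alpha> \<beta> \<kappa> c where "\<alpha> = measure std_gaussian A" and "\<beta> = measure std_gaussian B"
    and "\<kappa> = measure std_gaussian C" and "c = (1 - s) * a + s * b"
  assume "\<not> Phi ((1 - s) * a + s * b) \<le> measure std_gaussian C"
  then obtain \<epsilon> where \<epsilon>: "\<epsilon> > 0" "\<kappa> < Phi (c - \<epsilon>)"
    using Phi_le_of_all_less[of c \<kappa>] unfolding c_def \<kappa>_def by (meson not_le)
  obtain e :: 'a where "e \<in> Basis" using nonempty_Basis by blast
  then have e: "norm e = 1" "e \<bullet> e = 1" by auto
  have T: "ehrhard_triple s \<alpha> \<beta> \<kappa> (A, B, C)"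
    using assms by (auto simp: ehrhard_triple_def \<alpha>_def \<beta>_def \<kappa>_def)
  obtain A B C :: "nat \<Rightarrow> 'a set" where
    tr: "\<forall>j. ehrhard_triple s \<alpha> \<beta> \<kappa> (A j, B j, C j)"
    and lim: "\<forall>d. norm d = 1 \<longrightarrow> 0 < d \<bullet> e \<longrightarrow> (\<lambda>j. measure std_gaussian (A j - ehrhard_sym d (A j))) \<longlonglongrightarrow> 0
      \<and> (\<lambda>j. measure std_gaussian (B j - ehrhard_sym d (B j))) \<longlonglongrightarrow> 0
      \<and> (\<lambda>j. measure std_gaussian (C j - ehrhard_sym d (C j))) \<longlonglongrightarrow> 0"
    using ehrhard_minimising_sequence[OF s T, of e] by blast
  have [measurable]: "A j \<in> sets borel" "B j \<in> sets borel" "C j \<in> sets borel" for j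
    using tr by (auto simp: ehrhard_triple_def)
  have L: "(\<lambda>j. measure std_gaussian (half_space e \<alpha> - A j)) \<longlonglongrightarrow> 0"
      "(\<lambda>j. measure std_gaussian (half_space e \<beta> - B j)) \<longlonglongrightarrow> 0"
      "(\<lambda>j. measure std_gaussian (C j - half_space e \<kappa>)) \<longlonglongrightarrow> 0"
    by (rule tendsto_half_space; use tr lim e in \<open>auto simp: ehrhard_triple_def\<close>)+
  \<comment> \<open>With these heights, balls of radius \<open>\<epsilon> / 2\<close> around
    \<open>p\<close> and \<open>q\<close> stay below the levels \<open>a\<close> and
    \<open>b\<close>, and the one around \<open>r\<close> stays above \<open>c - \<epsilon>\<close>,
    where \<open>Phi\<close> already exceeds \<open>\<kappa>\<close>.\<close>
  define p q r where "p = (a - \<epsilon> / 2) *\<^sub>R e" and "q = (b - \<epsilon> / 2) *\<^sub>R e" and "r = (c - \<epsilon> / 2) *\<^sub>R e"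
  have "(1 - s) *\<^sub>R p + s *\<^sub>R q = ((1 - s) * (a - \<epsilon> / 2) + s * (b - \<epsilon> / 2)) *\<^sub>R e"
    by (simp add: p_def q_def scaleR_left_distrib)
  also have "(1 - s) * (a - \<epsilon> / 2) + s * (b - \<epsilon> / 2) = c - \<epsilon> / 2"
    by (simp add: c_def field_simps)
  finally have "(1 - s) *\<^sub>R p + s *\<^sub>R q = r" by (simp add: r_def)
  then have pqr: "(1 - s) *\<^sub>R (x + p) + s *\<^sub>R (x + q) = x + r" for x
    by (simp add: algebra_simps)
  define U where "U = ball (0::'a) (\<epsilon> / 2)"
  have [measurable]: "U \<in> sets borel" by (simp add: U_def)
  define R where "R = \<epsilon> / 2 + norm p + norm q + norm r"
  have R: "norm (x + p) \<le> R" "norm (x + q) \<le> R" "norm (x + r) \<le> R" if "x \<in> U" for x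
  proof -
    have "norm x < \<epsilon> / 2" using that by (simp add: U_def)
    then show "norm (x + p) \<le> R" "norm (x + q) \<le> R" "norm (x + r) \<le> R"
      using norm_triangle_ineq[of x p] norm_triangle_ineq[of x q] norm_triangle_ineq[of x r]
        norm_ge_zero[of p] norm_ge_zero[of q] norm_ge_zero[of r]
      unfolding R_def by linarith+
  qed
  have xe: "\<bar>x \<bullet> e\<bar> < \<epsilon> / 2" if "x \<in> U" for x
    using that Cauchy_Schwarz_ineq2[of x e] by (simp add: U_def e(1))
  have inA: "x + p \<in> half_space e \<alpha>" and inB: "x + q \<in> half_space e \<beta>" and notinC: "x + r \<notin> half_space e \<kappa>" if "x \<in> U" for x
  proof -
    have "Phi ((x + p) \<bullet> e) \<le> Phi a" "Phi ((x + q) \<bullet> e) \<le> Phi b" "Phi (c - \<epsilon>) \<le> Phi ((x + r) \<bullet> e)"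
      unfolding Phi_le_iff using xe[OF that] by (simp_all add: p_def q_def r_def inner_add_left e(2) abs_less_iff)
    then show "x + p \<in> half_space e \<alpha>" "x + q \<in> half_space e \<beta>" "x + r \<notin> half_space e \<kappa>"
      using a b \<epsilon>(2) unfolding half_space_def mem_Collect_eq \<alpha>_def \<beta>_def by linarith+
  qed
  define m where "m = (2 * pi) powr (- (real DIM('a) / 2)) * exp (- R\<^sup>2 / 2)"
  have "ennreal m * emeasure lborel U \<le> ennreal (measure std_gaussian (half_space e \<alpha> - A j)
      + measure std_gaussian (half_space e \<beta> - B j) + measure std_gaussian (C j - half_space e \<kappa>))" for j
  proof -
    \<comment> \<open>If \<open>x + p\<close> lies in \<open>A j\<close> and \<open>x + q\<close>
      lies in \<open>B j\<close>, their combination \<open>x + r\<close> lies in \<open>C j\<close>,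
      although it is outside the half-space of \<open>C\<close>.\<close>
    have "U \<subseteq> {x\<in>U. x + p \<in> half_space e \<alpha> - A j} \<union> {x\<in>U. x + q \<in> half_space e \<beta> - B j} \<union> {x\<in>U. x + r \<in> C j - half_space e \<kappa>}"
      using inA inB notinC tr pqr unfolding ehrhard_triple_def by fastforce
    then have "emeasure lborel U \<le> emeasure lborel ({x\<in>U. x + p \<in> half_space e \<alpha> - A j}
        \<union> {x\<in>U. x + q \<in> half_space e \<beta> - B j} \<union> {x\<in>U. x + r \<in> C j - half_space e \<kappa>})"
      by (rule emeasure_mono) measurable
    also have "\<dots> \<le> emeasure lborel {x\<in>U. x + p \<in> half_space e \<alpha> - A j}
        + emeasure lborel {x\<in>U. x + q \<in> half_space e \<beta> - B j} + emeasure lborel {x\<in>U. x + r \<in> C j - half_space e \<kappa>}"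
      by (intro order_trans[OF emeasure_subadditive] add_mono order_refl) measurable
    finally have "ennreal m * emeasure lborel U \<le> ennreal m * (emeasure lborel {x\<in>U. x + p \<in> half_space e \<alpha> - A j}
        + emeasure lborel {x\<in>U. x + q \<in> half_space e \<beta> - B j} + emeasure lborel {x\<in>U. x + r \<in> C j - half_space e \<kappa>})"
      by (rule mult_left_mono) simp
    also have "\<dots> \<le> emeasure std_gaussian (half_space e \<alpha> - A j) + emeasure std_gaussian (half_space e \<beta> - B j)
        + emeasure std_gaussian (C j - half_space e \<kappa>)"
      unfolding distrib_left m_def
      by (intro add_mono lborel_translate_le_gaussian R) auto
    also have "\<dots> = ennreal (measure std_gaussian (half_space e \<alpha> - A j)
      + measure std_gaussian (half_space e \<beta> - B j) + measure std_gaussian (C j - half_space e \<kappa>))"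
      by (simp add: N.emeasure_eq_measure)
    finally show ?thesis .
  qed
  moreover have "(\<lambda>j. ennreal (measure std_gaussian (half_space e \<alpha> - A j)
      + measure std_gaussian (half_space e \<beta> - B j) + measure std_gaussian (C j - half_space e \<kappa>))) \<longlonglongrightarrow> ennreal (0 + 0 + 0)"
    by (intro tendsto_ennrealI tendsto_add L)
  ultimately have "ennreal m * emeasure lborel U \<le> ennreal (0 + 0 + 0)"
    by (intro tendsto_lowerbound[OF _ always_eventually]) auto
  then have "emeasure lborel U = 0" by (simp add: m_def)
  then have "measure lborel U = 0" by (simp add: measure_def)
  moreover have "0 < measure lborel U"
    unfolding U_def using \<epsilon>(1) by (intro content_ball_pos) auto
  ultimately show False by simp
qed

section \<open>Central sections\<close>

text \<open>Upper semicontinuity: since \<open>K\<close> is closed, a point \<open>x\<close> with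
  \<open>f j x\<close> in \<open>K\<close> for infinitely many \<open>j\<close> has
  \<open>g x\<close> in \<open>K\<close>, and the measure of this limit superior is the limit of the
  measures of the tail unions \<open>D k\<close>.\<close>

lemma measure_closed_limit:
  fixes f :: "nat \<Rightarrow> 'a::euclidean_space \<Rightarrow> 'b::euclidean_space"
  assumes [measurable]: "\<And>j. f j \<in> borel_measurable borel" "g \<in> borel_measurable borel"
    and K: "closed K" and lim: "\<And>x. (\<lambda>j. f j x) \<longlonglongrightarrow> g x"
    and c: "\<forall>\<^sub>F j in sequentially. c \<le> measure std_gaussian {x. f j x \<in> K}"
  shows "c \<le> measure std_gaussian {x. g x \<in> K}"
proof -
  have [measurable]: "K \<in> sets borel" using K by (rule borel_closed)
  define D where "D k = (\<Union>j\<in>{k..}. {x. f j x \<in> K})" for k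
  have [measurable]: "D k \<in> sets borel" for k unfolding D_def by measurable
  have "decseq D" unfolding decseq_def D_def by (intro allI impI UN_mono) auto
  then have D: "(\<lambda>k. measure std_gaussian (D k)) \<longlonglongrightarrow> measure std_gaussian (\<Inter>k. D k)"
    by (intro N.finite_Lim_measure_decseq) auto
  have "\<forall>\<^sub>F k in sequentially. c \<le> measure std_gaussian (D k)"
    using c
  proof eventually_elim
    case (elim k)
    also have "measure std_gaussian {x. f k x \<in> K} \<le> measure std_gaussian (D k)"
      by (rule N.finite_measure_mono) (auto simp: D_def)
    finally show ?case .
  qed
  then have "c \<le> measure std_gaussian (\<Inter>k. D k)"
    by (intro tendsto_lowerbound[OF D]) auto
  also have "\<dots> \<le> measure std_gaussian {x. g x \<in> K}"
  proof (rule N.finite_measure_mono)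
    show "(\<Inter>k. D k) \<subseteq> {x. g x \<in> K}"
    proof (clarify, rule ccontr)
      fix x assume x: "x \<in> (\<Inter>k. D k)" and "g x \<notin> K"
      then have "\<forall>\<^sub>F j in sequentially. f j x \<in> - K"
        using topological_tendstoD[OF lim[of x], of "- K"] K by auto
      then obtain k where "\<And>j. j \<ge> k \<Longrightarrow> f j x \<notin> K" by (auto simp: eventually_sequentially)
      with x show False by (auto simp: D_def)
    qed
  qed auto
  finally show ?thesis .
qed

lemma std_gaussian_prod:
  fixes P :: "real \<times> real \<Rightarrow> ennreal"
  assumes [measurable]: "P \<in> borel_measurable borel"
  shows "(\<integral>\<^sup>+p. P p \<partial>std_gaussian) = (\<integral>\<^sup>+s. \<integral>\<^sup>+a. P (s, a) \<partial>std_gaussian \<partial>std_gaussian)"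
proof -
  have g: "gaussian_density DIM(real \<times> real) (s, a) = \<phi> s * \<phi> a" for s a :: real
  proof -
    have "(1 / sqrt (2 * pi)) * (1 / sqrt (2 * pi)) = (2 * pi) powr (- 1)"
      by (simp add: powr_minus_divide field_simps)
    moreover have "exp (- (s\<^sup>2 + a\<^sup>2) / 2) = exp (- s\<^sup>2 / 2) * exp (- a\<^sup>2 / 2)"
      by (simp add: exp_add[symmetric] field_simps)
    ultimately show ?thesis
      by (simp add: gaussian_density_def std_normal_density_def norm_Pair)
  qed
  have [measurable]: "P \<in> borel_measurable (borel \<Otimes>\<^sub>M borel)"
    by (simp add: borel_prod)
  have "(\<integral>\<^sup>+p. P p \<partial>std_gaussian) = (\<integral>\<^sup>+p. gaussian_density DIM(real \<times> real) p * P p \<partial>(lborel \<Otimes>\<^sub>M lborel))"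
    by (simp add: nn_integral_std_gaussian lborel_prod)
  also have "\<dots> = (\<integral>\<^sup>+s. \<integral>\<^sup>+a. gaussian_density DIM(real \<times> real) (s, a) * P (s, a) \<partial>lborel \<partial>lborel)"
    by (rule lborel.nn_integral_fst[symmetric]) (simp add: lborel_prod)
  also have "\<dots> = (\<integral>\<^sup>+s. \<phi> s * (\<integral>\<^sup>+a. \<phi> a * P (s, a) \<partial>lborel) \<partial>lborel)"
    unfolding g by (intro nn_integral_cong) (simp add: ennreal_mult mult.assoc nn_integral_cmult)
  also have "\<dots> = (\<integral>\<^sup>+s. \<integral>\<^sup>+a. P (s, a) \<partial>std_gaussian \<partial>std_gaussian)"
    unfolding std_gaussian_real by (simp add: nn_integral_density)
  finally show ?thesis .
qed

text \<open>A line separating \<open>(0, a1)\<close> from \<open>Hyp\<close> bounds a half-plane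
  containing \<open>Hyp\<close>, whose measure is \<open>Phi\<close> of the signed distance from the
  origin to the line. Measure at least \<open>1/2\<close> puts the origin in the half-plane, and the
  distance is then at most \<open>a1\<close> because \<open>(0, a1)\<close> lies beyond the
  line.\<close>

lemma half_plane_of_convex:
  fixes Hyp :: "(real \<times> real) set"
  assumes "convex Hyp" "closed Hyp" "(0, a1) \<notin> Hyp"
    and down: "\<And>s a t. (s, a) \<in> Hyp \<Longrightarrow> 0 \<le> t \<Longrightarrow> (s, a - t) \<in> Hyp"
    and m: "1 / 2 \<le> measure std_gaussian Hyp"
  shows "measure std_gaussian Hyp \<le> Phi a1"
proof -
  obtain l b where l: "l \<bullet> (0, a1) < b" "\<And>x. x \<in> Hyp \<Longrightarrow> b < l \<bullet> x"
    using separating_hyperplane_closed_point[OF assms(1,2,3)] by blast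
  obtain P Q where PQ: "l = (P, Q)" by (cases l)
  have "Hyp \<noteq> {}" using m by auto
  then obtain s0 a0 where s0: "(s0, a0) \<in> Hyp" by auto
  \<comment> \<open>Otherwise moving a point of \<open>Hyp\<close> far enough down would take it
    across the separating line.\<close>
  have "Q \<le> 0"
  proof (rule ccontr)
    assume "\<not> Q \<le> 0"
    define t where "t = max 0 ((P * s0 + Q * a0 - b) / Q)"
    have "b < P * s0 + Q * (a0 - t)"
      using l(2)[OF down[OF s0, of t]] by (simp add: PQ t_def)
    then have "Q * t < P * s0 + Q * a0 - b" by (simp add: algebra_simps)
    then have "t < (P * s0 + Q * a0 - b) / Q" using \<open>\<not> Q \<le> 0\<close> by (simp add: field_simps)
    then show False by (simp add: t_def)
  qed
  have "l \<noteq> 0" using l(1) l(2)[OF s0] by (auto simp: zero_prod_def)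
  define n where "n = norm l"
  have n: "0 < n" using \<open>l \<noteq> 0\<close> by (simp add: n_def)
  define d where "d = (- 1 / n) *\<^sub>R l"
  have d: "norm d = 1" using n by (simp add: d_def n_def)
  have "Hyp \<subseteq> {x. x \<bullet> d \<in> {..- b / n}}"
    using l(2) n by (auto simp: d_def inner_commute[of _ l] divide_right_mono less_imp_le)
  then have "measure std_gaussian Hyp \<le> measure std_gaussian {x. x \<bullet> d \<in> {..- b / n}}"
    by (rule N.finite_measure_mono) measurable
  also have "\<dots> = Phi (- b / n)"
    by (subst measure_marginal[OF d]) (auto simp: Phi_def)
  finally have le: "measure std_gaussian Hyp \<le> Phi (- b / n)" .
  then have "Phi 0 \<le> Phi (- b / n)" using m by simp
  then have "b \<le> 0" using n unfolding Phi_le_iff by (simp add: field_simps)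
  have Qb: "Q * a1 < b" using l(1) by (simp add: PQ)
  with \<open>b \<le> 0\<close> \<open>Q \<le> 0\<close> have "0 < a1"
    by (metis less_le_trans mult_nonpos_nonpos not_le order_less_le_trans)
  \<comment> \<open>The vertical component of the normal is at most its length, so the vertical
    distance \<open>a1\<close> bounds the distance to the line.\<close>
  have "- Q \<le> n" unfolding n_def PQ using norm_snd_le[of Q P] by simp
  then have "- Q * a1 \<le> n * a1" using \<open>0 < a1\<close> by (intro mult_right_mono) auto
  then have "- b / n \<le> a1" using n Qb by (simp add: field_simps)
  then have "Phi (- b / n) \<le> Phi a1" by simp
  with le show ?thesis by linarith
qed

text \<open>In the plane, \<open>Hyp\<close> is the hypograph of \<open>inv Phi\<close> of the
  measure \<open>G\<close> of the parallel sections. It is convex by \<open>ehrhard\<close>, closed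
  by \<open>measure_closed_limit\<close>, and by Fubini its Gaussian measure is that of
  \<open>K\<close>. If \<open>G 0\<close> were smaller, \<open>half_plane_of_convex\<close> would
  apply to a point just above the hypograph over 0.\<close>

theorem central_section:
  fixes K :: "'a::euclidean_space set"
  assumes K: "closed K" "convex K" and e: "norm e = 1" and m: "1 / 2 \<le> measure std_gaussian K"
  shows "measure std_gaussian K \<le> measure std_gaussian {x. resample e x 0 \<in> K}"
proof (rule ccontr)
  have [measurable]: "K \<in> sets borel" using K(1) by (rule borel_closed)
  define G where "G s = measure std_gaussian {x. resample e x s \<in> K}" for s
  have [measurable]: "(\<lambda>x. resample e x s) \<in> borel_measurable borel" for s
    unfolding resample_def by measurable
  define Hyp where "Hyp = {p. Phi (snd p) \<le> G (fst p)}"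
  assume "\<not> measure std_gaussian K \<le> measure std_gaussian {x. resample e x 0 \<in> K}"
  then have less: "G 0 < measure std_gaussian K" by (simp add: G_def)
  have G01: "0 \<le> G s" "G s \<le> 1" for s by (simp_all add: G_def)
  \<comment> \<open>The midpoint lies strictly between 0 and 1 even if \<open>G 0 = 0\<close> or
    \<open>K\<close> has full measure, so it is a value of \<open>Phi\<close>.\<close>
  define p where "p = (G 0 + measure std_gaussian K) / 2"
  have p: "G 0 < p" "p < measure std_gaussian K" using less by (simp_all add: p_def)
  have "measure std_gaussian K \<le> 1" by simp
  then have "0 < p" "p < 1" using p G01(1)[of 0] by linarith+
  then obtain a1 where a1: "Phi a1 = p" using Phi_surj by blast
  have "(0, a1) \<notin> Hyp" using p a1 by (simp add: Hyp_def)
  have conv: "convex {x. resample e x s \<in> K}" for s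
  proof -
    have "resample e ((1 - \<theta>) *\<^sub>R x + \<theta> *\<^sub>R y) s \<in> K"
      if "resample e x s \<in> K" "resample e y s \<in> K" "0 \<le> \<theta>" "\<theta> \<le> 1" for x y \<theta>
      using convexD_alt[OF K(2) that] by (simp add: resample_combination distrib_right[symmetric])
    then show ?thesis by (auto simp: convex_alt)
  qed
  have "convex Hyp"
    unfolding convex_alt
  proof (clarify)
    fix s1 b1 s2 b2 \<theta> :: real
    assume in12: "(s1, b1) \<in> Hyp" "(s2, b2) \<in> Hyp" and \<theta>: "0 \<le> \<theta>" "\<theta> \<le> 1"
    have "Phi ((1 - \<theta>) * b1 + \<theta> * b2) \<le> measure std_gaussian {x. resample e x ((1 - \<theta>) * s1 + \<theta> * s2) \<in> K}"
    proof (rule ehrhard[OF conv[of s1] conv[of s2] _ _ _ \<theta>])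
      fix x y assume "x \<in> {x. resample e x s1 \<in> K}" "y \<in> {x. resample e x s2 \<in> K}"
      then show "(1 - \<theta>) *\<^sub>R x + \<theta> *\<^sub>R y \<in> {x. resample e x ((1 - \<theta>) * s1 + \<theta> * s2) \<in> K}"
        using convexD_alt[OF K(2) _ _ \<theta>] by (simp add: resample_combination[symmetric])
    qed (use in12 in \<open>auto simp: Hyp_def G_def\<close>)
    then show "(1 - \<theta>) *\<^sub>R (s1, b1) + \<theta> *\<^sub>R (s2, b2) \<in> Hyp" by (simp add: Hyp_def G_def)
  qed
  moreover have "closed Hyp"
    unfolding closed_sequential_limits
  proof (intro allI impI, elim conjE)
    fix h :: "nat \<Rightarrow> real \<times> real" and l
    assume h: "\<forall>j. h j \<in> Hyp" "h \<longlonglongrightarrow> l"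
    have "Phi (snd l) \<le> measure std_gaussian {x. resample e x (fst l) \<in> K}"
    proof (rule Phi_le_of_all_less)
      fix \<epsilon> :: real assume "0 < \<epsilon>"
      then have "\<forall>\<^sub>F j in sequentially. snd l - \<epsilon> < snd (h j)"
        by (intro order_tendstoD(1)[OF tendsto_snd[OF h(2)]]) simp
      then have ev: "\<forall>\<^sub>F j in sequentially. Phi (snd l - \<epsilon>) \<le> measure std_gaussian {x. resample e x (fst (h j)) \<in> K}"
      proof eventually_elim
        case (elim j)
        then have "Phi (snd l - \<epsilon>) \<le> Phi (snd (h j))" by simp
        also have "\<dots> \<le> G (fst (h j))" using h(1) by (simp add: Hyp_def)
        finally show ?case by (simp add: G_def)
      qed
      show "Phi (snd l - \<epsilon>) \<le> measure std_gaussian {x. resample e x (fst l) \<in> K}"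
        by (rule measure_closed_limit[OF _ _ K(1) _ ev])
           (auto simp: resample_def intro!: tendsto_intros h(2))
    qed
    then show "l \<in> Hyp" by (simp add: Hyp_def G_def)
  qed
  moreover have "(s, a - t) \<in> Hyp" if "(s, a) \<in> Hyp" "0 \<le> t" for s a t
  proof -
    have "Phi (a - t) \<le> Phi a" using that(2) by simp
    then show ?thesis using that(1) unfolding Hyp_def mem_Collect_eq fst_conv snd_conv by linarith
  qed
  moreover have mH: "measure std_gaussian Hyp = measure std_gaussian K"
  proof -
    have [measurable]: "Hyp \<in> sets borel" using \<open>closed Hyp\<close> by (rule borel_closed)
    have eG: "ennreal (G s) = (\<integral>\<^sup>+x. indicator K (resample e x s) \<partial>std_gaussian)" for s
    proof -
      have "(\<integral>\<^sup>+x. indicator K (resample e x s) \<partial>std_gaussian) = (\<integral>\<^sup>+x. indicator {x. resample e x s \<in> K} x \<partial>std_gaussian)"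
        by (intro nn_integral_cong) (auto simp: indicator_def)
      also have "\<dots> = emeasure std_gaussian {x. resample e x s \<in> K}" by simp
      finally show ?thesis by (simp add: G_def N.emeasure_eq_measure)
    qed
    have "emeasure std_gaussian Hyp = (\<integral>\<^sup>+p. indicator Hyp p \<partial>std_gaussian)" by simp
    also have "\<dots> = (\<integral>\<^sup>+s. \<integral>\<^sup>+a. indicator Hyp (s, a) \<partial>std_gaussian \<partial>std_gaussian)"
      by (rule std_gaussian_prod) measurable
    also have "\<dots> = (\<integral>\<^sup>+s. ennreal (G s) \<partial>std_gaussian)"
    proof (rule nn_integral_cong)
      fix s :: real
      have "(\<integral>\<^sup>+a. indicator Hyp (s, a) \<partial>std_gaussian) = (\<integral>\<^sup>+a. indicator {a. Phi a \<le> G s} a \<partial>std_gaussian)"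
        by (intro nn_integral_cong) (auto simp: indicator_def Hyp_def)
      also have "\<dots> = emeasure std_gaussian {a. Phi a \<le> G s}" by (rule nn_integral_indicator) measurable
      finally show "(\<integral>\<^sup>+a. indicator Hyp (s, a) \<partial>std_gaussian) = ennreal (G s)"
        by (simp add: N.emeasure_eq_measure measure_Phi_le G01)
    qed
    also have "\<dots> = (\<integral>\<^sup>+x. \<integral>\<^sup>+s. indicator K (resample e x s) \<partial>std_gaussian \<partial>std_gaussian)"
      unfolding eG by (rule G1G.Fubini') measurable
    also have "\<dots> = (\<integral>\<^sup>+x. indicator K x \<partial>std_gaussian)"
      by (rule nn_integral_resample'[OF e]) measurable
    also have "\<dots> = emeasure std_gaussian K" by simp
    finally show ?thesis by (simp add: measure_def)
  qed
  ultimately have "measure std_gaussian K \<le> Phi a1"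
    using half_plane_of_convex[of Hyp a1] \<open>(0, a1) \<notin> Hyp\<close> m unfolding mH by blast
  then show False using a1 p by simp
qed

lemma continuous_on_proj [continuous_intros]: "continuous_on S (orth_proj B)"
  unfolding orth_proj_def[abs_def] by (intro continuous_intros)

text \<open>Apply \<open>central_section\<close> to the cylinder \<open>K'\<close> over the section.
  Setting the component along \<open>e\<close> to 0 before projecting onto \<open>span B\<close> is
  the same as projecting onto the span of \<open>B - {e}\<close>.\<close>

lemma central_section_proj:
  fixes K :: "'a::euclidean_space set"
  assumes K: "closed K" "convex K" and B: "orthonormal B" "e \<in> B"
    and m: "1 / 2 \<le> measure std_gaussian {x. p + orth_proj B x \<in> K}"
  shows "measure std_gaussian {x. p + orth_proj B x \<in> K} \<le> measure std_gaussian {x. p + orth_proj (B - {e}) x \<in> K}"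
proof -
  define K' where "K' = {x. p + orth_proj B x \<in> K}"
  have "closed K'"
  proof -
    have "closed ((\<lambda>x. p + orth_proj B x) -` K)"
      using K(1) by (intro closed_vimage continuous_intros continuous_on_proj)
    then show ?thesis by (simp add: K'_def vimage_def)
  qed
  moreover have "convex K'"
    unfolding convex_alt
  proof (intro ballI allI impI)
    fix x y :: 'a and u :: real
    assume "x \<in> K'" "y \<in> K'" "0 \<le> u \<and> u \<le> 1"
    then have "(1 - u) *\<^sub>R (p + orth_proj B x) + u *\<^sub>R (p + orth_proj B y) \<in> K"
      using K(2) by (auto simp: K'_def intro!: convexD_alt)
    also have "(1 - u) *\<^sub>R (p + orth_proj B x) + u *\<^sub>R (p + orth_proj B y) = p + orth_proj B ((1 - u) *\<^sub>R x + u *\<^sub>R y)"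
      by (simp add: proj_add proj_diff proj_scale algebra_simps)
    finally show "(1 - u) *\<^sub>R x + u *\<^sub>R y \<in> K'" by (simp add: K'_def)
  qed
  moreover have e: "norm e = 1" using B by (auto simp: orthonormal_def)
  ultimately have "measure std_gaussian K' \<le> measure std_gaussian {x. resample e x 0 \<in> K'}"
    using m by (intro central_section) (auto simp: K'_def)
  moreover have "orth_proj B (resample e x 0) = orth_proj (B - {e}) x" for x
  proof -
    have "orth_proj B e = e" by (rule proj_fixed[OF B(1) span_base[OF B(2)]])
    moreover have "orth_proj B x = (x \<bullet> e) *\<^sub>R e + orth_proj (B - {e}) x"
      unfolding orth_proj_def using sum.remove[OF orthonormal_finite[OF B(1)] B(2)] .
    ultimately show ?thesis by (simp add: resample_def proj_diff proj_scale)
  qed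
  ultimately show ?thesis by (simp add: K'_def)
qed

section \<open>Maximal sections and the theorem\<close>

text \<open>For orthonormal \<open>B\<close> this is, by \<open>gaussian_subspace_eq\<close>, the
  Gaussian measure on \<open>span B\<close> of the part of \<open>K - p\<close> in
  \<open>span B\<close>.\<close>

definition section_measure :: "'a::euclidean_space set \<Rightarrow> 'a set \<Rightarrow> 'a \<Rightarrow> real" where
  "section_measure K B p = measure std_gaussian {x. p + orth_proj B x \<in> K}"

lemma section_measure_mono_limit:
  fixes K :: "'a::euclidean_space set"
  assumes "closed K" "q \<longlonglongrightarrow> p" "\<forall>\<^sub>F j in sequentially. c \<le> section_measure K B (q j)"
  shows "c \<le> section_measure K B p"
  unfolding section_measure_def
  by (rule measure_closed_limit[of "\<lambda>j x. q j + orth_proj B x"])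
     (use assms in \<open>auto simp: section_measure_def intro!: tendsto_intros\<close>)

text \<open>The section measure may jump when \<open>p\<close> moves, but it is upper semicontinuous
  for closed \<open>K\<close>. So the limit of a convergent subsequence of near-maximisers attains
  the supremum.\<close>

lemma section_measure_attains_max:
  fixes K :: "'a::euclidean_space set" and h :: "'b::metric_space \<Rightarrow> 'a"
  assumes K: "closed K" and C: "compact C" "C \<noteq> {}" and h: "continuous_on C h"
  shows "\<exists>y\<in>C. \<forall>z\<in>C. section_measure K B (h z) \<le> section_measure K B (h y)"
proof -
  let ?F = "\<lambda>y. section_measure K B (h y)"
  define M where "M = Sup (?F ` C)"
  have bdd: "bdd_above (?F ` C)"
    by (rule bdd_aboveI2[where M = 1]) (simp add: section_measure_def)
  have "\<exists>y\<in>C. M - 1 / real (Suc j) < ?F y" for j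
    using less_cSupD[of "?F ` C" "M - 1 / real (Suc j)"] C(2) by (auto simp: M_def)
  then obtain y where y: "\<And>j. y j \<in> C" "\<And>j. M - 1 / real (Suc j) < ?F (y j)"
    by metis
  then obtain l r where l: "l \<in> C" "strict_mono r" "(y \<circ> r) \<longlonglongrightarrow> l"
    using C(1) unfolding compact_def by metis
  have lim: "(\<lambda>j. h (y (r j))) \<longlonglongrightarrow> h l"
    using continuous_on_tendsto_compose[OF h l(3) l(1)] y(1) by (simp add: comp_def)
  have "c \<le> ?F l" if "c < M" for c
  proof (rule section_measure_mono_limit[OF K lim])
    have "(\<lambda>j. M - 1 / real (Suc (r j))) \<longlonglongrightarrow> M - 0"
      using LIMSEQ_subseq_LIMSEQ[OF LIMSEQ_Suc[OF lim_1_over_n] l(2)]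
      by (intro tendsto_diff tendsto_const) (simp add: comp_def)
    then have "\<forall>\<^sub>F j in sequentially. c < M - 1 / real (Suc (r j))"
      using that by (intro order_tendstoD) auto
    then show "\<forall>\<^sub>F j in sequentially. c \<le> ?F (y (r j))"
      by eventually_elim (use y(2) in \<open>meson less_imp_le less_trans\<close>)
  qed
  then have "M \<le> ?F l" by (rule dense_le)
  then have "?F z \<le> ?F l" if "z \<in> C" for z
    using cSup_upper[OF imageI[OF that] bdd] by (simp add: M_def)
  then show ?thesis using l(1) by blast
qed

text \<open>At a maximum along \<open>w\<close>, the Cameron--Martin formula and \<open>1 + t \<le> exp t\<close> give
  \<open>\<epsilon> m \<le> exp (\<epsilon>\<^sup>2 |w|\<^sup>2 / 2) - 1\<close> for the first moment \<open>m\<close> and all small \<open>\<epsilon>\<close> of either sign.\<close>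

lemma section_measure_critical:
  fixes K :: "'a::euclidean_space set"
  assumes [measurable]: "K \<in> sets borel" and B: "orthonormal B" and w: "w \<in> span B"
    and \<delta>: "0 < \<delta>" and max: "\<And>\<epsilon>. \<bar>\<epsilon>\<bar> < \<delta> \<Longrightarrow> section_measure K B (p + \<epsilon> *\<^sub>R w) \<le> section_measure K B p"
  shows "(\<integral>x. (x \<bullet> w) * indicator {x. p + orth_proj B x \<in> K} x \<partial>std_gaussian) = 0"
proof -
  define S where "S = {x. p + orth_proj B x \<in> K}"
  have [measurable]: "S \<in> sets borel" unfolding S_def by measurable
  define m where "m = (\<integral>x. (x \<bullet> w) * indicator S x \<partial>std_gaussian)"
  define k where "k = (norm w)\<^sup>2 / 2"
  have bound: "\<epsilon> * m \<le> exp (\<epsilon>\<^sup>2 * k) - 1" if "\<bar>\<epsilon>\<bar> < \<delta>" for \<epsilon>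
  proof -
    define E where "E x = exp (x \<bullet> (\<epsilon> *\<^sub>R w) - (norm (\<epsilon> *\<^sub>R w))\<^sup>2 / 2) * indicator S x" for x
    have E: "E x = exp (- (\<epsilon>\<^sup>2 * k)) * (exp (\<epsilon> * (x \<bullet> w)) * indicator S x)" for x
      by (simp add: E_def k_def power_mult_distrib exp_add[symmetric] exp_diff exp_minus field_simps)
    have "(\<integral>\<^sup>+x. ennreal (E x) \<partial>std_gaussian) = (\<integral>\<^sup>+x. ennreal (exp (x \<bullet> (\<epsilon> *\<^sub>R w) - (norm (\<epsilon> *\<^sub>R w))\<^sup>2 / 2)) * indicator S x \<partial>std_gaussian)"
      by (simp add: E_def ennreal_mult' ennreal_indicator)
    also have "\<dots> = (\<integral>\<^sup>+x. indicator S (x + \<epsilon> *\<^sub>R w) \<partial>std_gaussian)"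
      by (rule nn_integral_shift[symmetric]) measurable
    \<comment> \<open>As \<open>w\<close> lies in \<open>span B\<close>, the projection fixes it,
      and shifting the Gaussian variable amounts to moving \<open>p\<close>.\<close>
    also have "\<dots> = (\<integral>\<^sup>+x. indicator {x. p + \<epsilon> *\<^sub>R w + orth_proj B x \<in> K} x \<partial>std_gaussian)"
      using proj_fixed[OF B w]
      by (intro nn_integral_cong) (auto simp: indicator_def S_def proj_add proj_scale algebra_simps)
    also have "\<dots> = emeasure std_gaussian {x. p + \<epsilon> *\<^sub>R w + orth_proj B x \<in> K}"
      by (rule nn_integral_indicator) measurable
    also have "\<dots> = ennreal (section_measure K B (p + \<epsilon> *\<^sub>R w))"
      by (simp add: section_measure_def N.emeasure_eq_measure)
    finally have nn: "(\<integral>\<^sup>+x. ennreal (E x) \<partial>std_gaussian) = ennreal (section_measure K B (p + \<epsilon> *\<^sub>R w))" .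
    have E0: "0 \<le> E x" for x by (simp add: E_def)
    have "has_bochner_integral std_gaussian E (section_measure K B (p + \<epsilon> *\<^sub>R w))"
      by (rule has_bochner_integral_nn_integral[OF _ _ _ nn]) (auto simp: E0 section_measure_def E_def[abs_def])
    then have intE: "integrable std_gaussian E" and eqE: "(\<integral>x. E x \<partial>std_gaussian) = section_measure K B (p + \<epsilon> *\<^sub>R w)"
      by (auto simp: has_bochner_integral_iff)
    have intm: "integrable std_gaussian (\<lambda>x. (x \<bullet> w) * indicator S x)"
      by (rule integrable_moment) measurable
    have "exp (- (\<epsilon>\<^sup>2 * k)) * (measure std_gaussian S + \<epsilon> * m)
      = (\<integral>x. exp (- (\<epsilon>\<^sup>2 * k)) * (indicator S x + \<epsilon> * ((x \<bullet> w) * indicator S x)) \<partial>std_gaussian)"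
      by (simp add: intm m_def N.emeasure_eq_measure)
    also have "\<dots> \<le> (\<integral>x. E x \<partial>std_gaussian)"
    proof (rule integral_mono[OF _ intE])
      show "integrable std_gaussian (\<lambda>x. exp (- (\<epsilon>\<^sup>2 * k)) * (indicator S x + \<epsilon> * ((x \<bullet> w) * indicator S x)))"
        by (intro integrable_mult_right Bochner_Integration.integrable_add intm) (simp_all add: N.emeasure_eq_measure)
      show "exp (- (\<epsilon>\<^sup>2 * k)) * (indicator S x + \<epsilon> * ((x \<bullet> w) * indicator S x)) \<le> E x" for x
        unfolding E using exp_ge_add_one_self[of "\<epsilon> * (x \<bullet> w)"] by (auto simp: indicator_def)
    qed
    also have "\<dots> \<le> measure std_gaussian S"
      using max[OF that] by (simp add: eqE section_measure_def S_def)
    finally have "measure std_gaussian S + \<epsilon> * m \<le> exp (\<epsilon>\<^sup>2 * k) * measure std_gaussian S"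
      by (simp add: exp_minus field_simps)
    then have "\<epsilon> * m \<le> (exp (\<epsilon>\<^sup>2 * k) - 1) * measure std_gaussian S" by (simp add: algebra_simps)
    also have "\<dots> \<le> (exp (\<epsilon>\<^sup>2 * k) - 1) * 1"
      by (intro mult_left_mono) (auto simp: k_def)
    finally show ?thesis by simp
  qed
  have k0: "0 \<le> k" by (simp add: k_def)
  have "\<bar>m\<bar> \<le> 0 + e" if "0 < e" for e
  proof -
    \<comment> \<open>The entries keep \<open>\<epsilon>\<close> within the range of
      \<open>bound\<close>, make \<open>\<epsilon>\<^sup>2 * k \<le> 1\<close> so that
      \<open>exp_bound\<close> applies, and make \<open>2 * \<epsilon> * k \<le> e\<close>.\<close>
    define \<epsilon> where "\<epsilon> = min (\<delta> / 2) (min (1 / (k + 1)) (min 1 (e / (2 * k + 1))))"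
    have \<epsilon>: "0 < \<epsilon>" "\<epsilon> < \<delta>" "\<epsilon> \<le> 1 / (k + 1)" "\<epsilon> \<le> 1" "\<epsilon> \<le> e / (2 * k + 1)"
      using \<delta> that k0 by (auto simp: \<epsilon>_def min_less_iff_disj)
    have "\<epsilon> * k \<le> 1" using \<epsilon>(3) k0 by (simp add: field_simps) (use \<epsilon>(1) in linarith)
    then have "\<epsilon> * (\<epsilon> * k) \<le> 1 * 1" using \<epsilon> k0 by (intro mult_mono) auto
    then have c: "0 \<le> \<epsilon>\<^sup>2 * k" "\<epsilon>\<^sup>2 * k \<le> 1" using k0 by (auto simp: power2_eq_square)
    have "exp (\<epsilon>\<^sup>2 * k) \<le> 1 + \<epsilon>\<^sup>2 * k + (\<epsilon>\<^sup>2 * k)\<^sup>2" by (rule exp_bound[OF c])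
    also have "(\<epsilon>\<^sup>2 * k)\<^sup>2 \<le> \<epsilon>\<^sup>2 * k"
      using mult_left_mono[OF c(2) c(1)] by (simp add: power2_eq_square)
    finally have "exp (\<epsilon>\<^sup>2 * k) - 1 \<le> \<epsilon> * (2 * (\<epsilon> * k))" by (simp add: power2_eq_square)
    moreover have "\<epsilon> * \<bar>m\<bar> \<le> exp (\<epsilon>\<^sup>2 * k) - 1"
      using bound[of \<epsilon>] bound[of "-\<epsilon>"] \<epsilon>(1,2) by (simp add: abs_if)
    ultimately have "\<epsilon> * \<bar>m\<bar> \<le> \<epsilon> * (2 * (\<epsilon> * k))" by linarith
    then have "\<bar>m\<bar> \<le> 2 * (\<epsilon> * k)" using \<epsilon>(1) by simp
    also have "\<dots> \<le> \<epsilon> * (2 * k + 1)" using \<epsilon>(1) by (simp add: algebra_simps)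
    also have "\<dots> \<le> e" using \<epsilon>(5) k0 by (simp add: field_simps)
    finally show ?thesis by simp
  qed
  then have "\<bar>m\<bar> \<le> 0" by (rule field_le_epsilon)
  then show ?thesis by (simp add: m_def S_def)
qed

section \<open>Consequences of a centred section\<close>

lemma proj_adjoint: "orth_proj B x \<bullet> y = x \<bullet> orth_proj B y"
  by (simp add: orth_proj_def inner_sum_left inner_sum_right inner_commute mult.commute)

text \<open>If \<open>p\<close> were outside \<open>K\<close>, a strictly separating functional
  \<open>a\<close> would satisfy \<open>a \<bullet> orth_proj B x \<ge> c > 0\<close> on the whole
  section, so the first moment along \<open>orth_proj B a\<close> would be positive.\<close>

lemma mem_of_centred_section:
  fixes K :: "'a::euclidean_space set"
  assumes K: "closed K" "convex K" and B: "orthonormal B" and pos: "0 < section_measure K B p"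
    and centred: "\<And>w. w \<in> span B \<Longrightarrow> (\<integral>x. (x \<bullet> w) * indicator {x. p + orth_proj B x \<in> K} x \<partial>std_gaussian) = 0"
  shows "p \<in> K"
proof (rule ccontr)
  assume "p \<notin> K"
  obtain a b where ab: "a \<bullet> p < b" "\<And>x. x \<in> K \<Longrightarrow> b < a \<bullet> x"
    using separating_hyperplane_closed_point[OF K(2,1) \<open>p \<notin> K\<close>] by blast
  define c where "c = b - a \<bullet> p"
  have c: "0 < c" using ab(1) by (simp add: c_def)
  define S where "S = {x. p + orth_proj B x \<in> K}"
  have [measurable]: "K \<in> sets borel" using K(1) by (rule borel_closed)
  have [measurable]: "S \<in> sets borel" unfolding S_def by measurable
  have "x \<bullet> orth_proj B a = a \<bullet> orth_proj B x" for x
    by (metis proj_adjoint inner_commute)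
  then have "c \<le> x \<bullet> orth_proj B a" if "x \<in> S" for x
    using ab(2)[of "p + orth_proj B x"] that by (simp add: S_def c_def inner_add_right)
  then have "(\<integral>x. c * indicator S x \<partial>std_gaussian) \<le> (\<integral>x. (x \<bullet> orth_proj B a) * indicator S x \<partial>std_gaussian)"
    by (intro integral_mono integrable_moment integrable_mult_right integrable_real_indicator)
       (auto simp: N.emeasure_eq_measure split: split_indicator)
  also have "\<dots> = 0" unfolding S_def by (rule centred[OF proj_in_span])
  finally have "c * measure std_gaussian S \<le> 0" by simp
  with c pos show False by (simp add: section_measure_def S_def mult_le_0_iff)
qed

lemma sets_lborel_subspace [simp, measurable_cong]: "sets (lborel_subspace W) = sets borel"
  by (simp add: lborel_subspace_def Let_def)

text \<open>Up to the normalising constant \<open>c\<close>, the integral is the vector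
  \<open>v\<close> written in the ambient space. Testing \<open>v\<close> against itself gives a
  scalar moment along \<open>orth_proj B v\<close>, which vanishes by assumption.\<close>

lemma barycenter_subspace:
  fixes S :: "'a::euclidean_space set"
  assumes B: "orthonormal B" and [measurable]: "S \<in> sets borel"
    and centred: "\<And>w. w \<in> span B \<Longrightarrow> (\<integral>x. (x \<bullet> w) * indicator {x. orth_proj B x \<in> S} x \<partial>std_gaussian) = 0"
  shows "(LINT y:S|lborel_subspace (span B). exp (- (norm y)\<^sup>2 / 2) *\<^sub>R y) = 0"
proof -
  define c where "c = (2 * pi) powr (- (real (dim (span B)) / 2))"
  have c: "0 < c" by (simp add: c_def)
  define v where "v = (\<integral>x. indicator S (orth_proj B x) *\<^sub>R orth_proj B x \<partial>std_gaussian)"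
  have "v \<bullet> v = 0"
  proof (cases "integrable std_gaussian (\<lambda>x. indicator S (orth_proj B x) *\<^sub>R orth_proj B x)")
    case True
    have "v \<bullet> v = (\<integral>x. (indicator S (orth_proj B x) *\<^sub>R orth_proj B x) \<bullet> v \<partial>std_gaussian)"
      by (subst (1) v_def) (rule integral_inner_left[symmetric, OF True])
    also have "\<dots> = (\<integral>x. (x \<bullet> orth_proj B v) * indicator {x. orth_proj B x \<in> S} x \<partial>std_gaussian)"
    proof (rule Bochner_Integration.integral_cong[OF refl])
      fix x
      have "orth_proj B x \<bullet> v = x \<bullet> orth_proj B v"
        by (rule proj_adjoint)
      then show "(indicator S (orth_proj B x) *\<^sub>R orth_proj B x) \<bullet> v = (x \<bullet> orth_proj B v) * indicator {x. orth_proj B x \<in> S} x"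
        by (simp add: indicator_def)
    qed
    also have "\<dots> = 0" by (rule centred[OF proj_in_span])
    finally show ?thesis .
  next
    case False
    \<comment> \<open>The Bochner integral of a non-integrable function is 0 by convention.\<close>
    then show ?thesis by (simp add: v_def not_integrable_integral_eq)
  qed
  then have "v = 0" by simp
  have "c *\<^sub>R (LINT y:S|lborel_subspace (span B). exp (- (norm y)\<^sup>2 / 2) *\<^sub>R y)
      = (\<integral>y. gaussian_density (dim (span B)) y *\<^sub>R (indicator S y *\<^sub>R y) \<partial>lborel_subspace (span B))"
    unfolding set_lebesgue_integral_def integral_scaleR_right[symmetric] gaussian_density_def c_def
    by (simp add: mult.commute mult.left_commute)
  also have "\<dots> = (\<integral>y. indicator S y *\<^sub>R y \<partial>gaussian_subspace (span B))"
    unfolding gaussian_subspace_def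
    by (rule integral_density[symmetric]) (auto simp: less_imp_le gaussian_density_pos)
  also have "\<dots> = v"
    unfolding gaussian_subspace_eq[OF B] v_def by (rule integral_distr) measurable
  finally show ?thesis using c \<open>v = 0\<close> by simp
qed

text \<open>One Gram--Schmidt step: the added vector is the normalised residual of \<open>u\<close>,
  the normal direction needed for a central section.\<close>

lemma orthonormal_extend:
  assumes B: "orthonormal B" and u: "u \<notin> span B"
  obtains e where "e \<notin> B" "orthonormal (insert e B)" "span (insert e B) = span (insert u B)"
proof -
  define r where "r = u - orth_proj B u"
  have r: "r \<noteq> 0" using u proj_in_span[of B u] by (auto simp: r_def)
  define e where "e = r /\<^sub>R norm r"
  have "norm e = 1" using r by (simp add: e_def)
  have orth: "e \<bullet> b = 0" if "b \<in> B" for b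
    using proj_residual[OF B span_base[OF that], of u] by (simp add: e_def r_def)
  have "orthonormal (insert e B)"
    using B orth \<open>norm e = 1\<close> by (auto simp: orthonormal_def pairwise_insert orthogonal_def inner_commute)
  moreover have "e \<notin> B" using orth[of e] \<open>norm e = 1\<close> by auto
  moreover have "span (insert e B) = span (insert u B)"
  proof -
    have pB: "orth_proj B u \<in> span (insert x B)" for x
      using proj_in_span[of B u] span_mono[of B "insert x B"] by auto
    have "e \<in> span (insert u B)"
      unfolding e_def r_def by (intro span_scale span_diff pB span_base) simp
    moreover have "u = norm r *\<^sub>R e + orth_proj B u" using r by (simp add: e_def r_def)
    then have "u \<in> span (insert e B)"
      by (metis insertI1 pB span_add span_base span_scale)
    ultimately show ?thesis
      by (intro span_eq[THEN iffD2] conjI subsetI) (auto intro: span_base)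
  qed
  ultimately show thesis using that by blast
qed

theorem theorem1p6:
  fixes v :: "'n::finite \<Rightarrow> real ^ 'n" and t :: "real ^ 'n" and K :: "(real ^ 'n) set"
  assumes "inj v" and "independent (range v)"
    and "t \<in> zonotope v"
    and "convex_body K"
    and "measure std_gaussian K \<ge> 1 / 2"
  shows "\<exists>x :: real ^ 'n. (\<forall>i. x $ i \<in> {-1..1}) \<and>
    (let p = (\<Sum>i\<in>UNIV. (x $ i) *\<^sub>R v i) - t;
         A = {i. x $ i \<in> {-1<..<1}};
         W = span (v ` A);
         S = (\<lambda>y. y - p) ` K \<inter> W
     in p \<in> K \<and>
        ((\<forall>i. x $ i \<in> {-1, 1}) \<or>
         (measure (gaussian_subspace W) S \<ge> measure std_gaussian K \<and>
          (LINT y:S|lborel_subspace W. exp (- (norm y)\<^sup>2 / 2) *\<^sub>R y) = 0)))"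
proof -
  define m where "m = measure std_gaussian K"
  have m: "1 / 2 \<le> m" using assms(5) by (simp add: m_def)
  have K: "closed K" "convex K" using assms(4) by (auto simp: convex_body_def)
  have [measurable]: "K \<in> sets borel" using K(1) by (rule borel_closed)
  define pt where "pt x = (\<Sum>i\<in>UNIV. (x $ i) *\<^sub>R v i) - t" for x :: "real ^ 'n"
  have pt_cont: "continuous_on S pt" for S
    unfolding pt_def[abs_def] by (intro continuous_intros)
  have "\<forall>A. \<exists>B. orthonormal B \<and> span B = span (v ` A)"
    using orthonormal_basis_of_ex[OF subspace_span] unfolding orthonormal_basis_of_def orthonormal_def by metis
  then obtain bas where bas: "\<And>A. orthonormal (bas A)" "\<And>A. span (bas A) = span (v ` A)"
    by metis
  define F where "F A x = section_measure K (bas A) (pt x)" for A x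
  \<comment> \<open>Here \<open>A\<close> only contains the fractional coordinates of
    \<open>x\<close>; equality will follow from minimality of \<open>A\<close>.\<close>
  define Good where "Good A \<longleftrightarrow> (\<exists>x :: real ^ 'n. (\<forall>i. x $ i \<in> {-1..1}) \<and> (\<forall>i. i \<notin> A \<longrightarrow> x $ i \<in> {-1, 1}) \<and> m \<le> F A x)" for A
  have "Good UNIV"
  proof -
    obtain l :: "real ^ 'n" where l: "t = (\<Sum>i\<in>UNIV. (l $ i) *\<^sub>R v i)" "\<forall>i. l $ i \<in> {-1..1}"
      using assms(3) by (auto simp: zonotope_def)
    have "card (range v) = DIM(real ^ 'n)" using assms(1) by (simp add: card_image)
    then have "span (range v) = UNIV"
      using card_ge_dim_independent[OF subset_UNIV assms(2)] by auto
    \<comment> \<open>The coefficients \<open>l\<close> of \<open>t\<close> give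
      \<open>p = 0\<close>, and the projection is the identity, so this section is \<open>K\<close>
      itself.\<close>
    then have "orth_proj (bas UNIV) x = x" for x by (intro proj_fixed bas) (simp add: bas)
    then have "F UNIV l = m" by (simp add: F_def section_measure_def pt_def l(1)[symmetric] m_def)
    then show ?thesis using l(2) by (auto simp: Good_def)
  qed
  then obtain A where A: "Good A" and min: "\<And>A'. Good A' \<Longrightarrow> card A \<le> card A'"
    using ex_has_least_nat[of Good UNIV card] by blast
  obtain x0 where x0: "\<forall>i. x0 $ i \<in> {-1..1}" "\<forall>i. i \<notin> A \<longrightarrow> x0 $ i \<in> {-1, 1}" "m \<le> F A x0"
    using A unfolding Good_def by blast
  \<comment> \<open>A face of the cube, written as a box with degenerate sides: coordinates outside
    \<open>A\<close> are frozen at those of \<open>x0\<close>.\<close>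
  define C where "C = cbox (\<chi> i. if i \<in> A then -1 else x0 $ i) (\<chi> i. if i \<in> A then 1 else x0 $ i)"
  have C: "y \<in> C \<longleftrightarrow> (\<forall>i. (i \<in> A \<longrightarrow> y $ i \<in> {-1..1}) \<and> (i \<notin> A \<longrightarrow> y $ i = x0 $ i))" for y
    unfolding C_def mem_box_cart by (intro all_cong1) auto
  have x0C: "x0 \<in> C" using x0(1) by (auto simp: C)
  have "compact C" by (simp add: C_def compact_cbox)
  moreover have "C \<noteq> {}" using x0C by blast
  ultimately obtain x where x: "x \<in> C" and max: "\<And>z. z \<in> C \<Longrightarrow> F A z \<le> F A x"
    using section_measure_attains_max[OF K(1) _ _ pt_cont, of C "bas A"] unfolding F_def by blast
  have Fx: "m \<le> F A x" using x0(3) max[OF x0C] by linarith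
  have cube: "x $ i \<in> {-1..1}" for i using x x0(1) by (cases "i \<in> A") (auto simp: C)
  have off: "x $ i \<in> {-1, 1}" if "i \<notin> A" for i using x x0(2) that by (auto simp: C)
  have interior: "x $ i \<in> {-1<..<1}" if i: "i \<in> A" for i
  proof (rule ccontr)
    assume "x $ i \<notin> {-1<..<1}"
    then have xi: "x $ i \<in> {-1, 1}" using cube[of i] by auto
    define A' where "A' = A - {i}"
    have "v i \<notin> span (v ` A')"
    proof
      assume "v i \<in> span (v ` A')"
      moreover have "v ` A' \<subseteq> range v - {v i}" using assms(1) by (auto simp: A'_def inj_eq)
      ultimately have "v i \<in> span (range v - {v i})" using span_mono by blast
      then show False using assms(2) unfolding dependent_def by blast
    qed
    then have "v i \<notin> span (bas A')" by (simp add: bas)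
    \<comment> \<open>The section for \<open>A'\<close> is the central section, normal to
      \<open>e\<close>, of the section for \<open>A\<close>. As the latter has measure at least
      \<open>1/2\<close>, passing to \<open>A'\<close> does not decrease the measure, contradicting
      minimality.\<close>
    then obtain e where e: "e \<notin> bas A'" "orthonormal (insert e (bas A'))"
        "span (insert e (bas A')) = span (insert (v i) (bas A'))"
      using orthonormal_extend[OF bas(1)] by metis
    have "span (insert (v i) (bas A')) = span (insert (v i) (v ` A'))"
      by (simp add: span_insert bas(2))
    also have "insert (v i) (v ` A') = v ` A" using i by (auto simp: A'_def)
    finally have "orth_proj (insert e (bas A')) = orth_proj (bas A)"
      by (intro proj_eq_of_span_eq) (simp_all add: e bas)
    then have "F A x = measure std_gaussian {y. pt x + orth_proj (insert e (bas A')) y \<in> K}"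
      by (simp add: F_def section_measure_def)
    also have "\<dots> \<le> measure std_gaussian {y. pt x + orth_proj (insert e (bas A') - {e}) y \<in> K}"
      by (rule central_section_proj[OF K e(2)]) (use calculation Fx m in auto)
    also have "insert e (bas A') - {e} = bas A'" using e(1) by auto
    finally have "m \<le> F A' x" using Fx by (simp add: F_def section_measure_def)
    then have "Good A'" unfolding Good_def using cube off xi by (auto simp: A'_def)
    then have "card A \<le> card A'" by (rule min)
    then show False using i card_Diff1_less[of A i] by (simp add: A'_def)
  qed
  then have Ax: "{i. x $ i \<in> {-1<..<1}} = A" using off by fastforce
  define p where "p = pt x"
  have centred: "(\<integral>y. (y \<bullet> w) * indicator {y. p + orth_proj (bas A) y \<in> K} y \<partial>std_gaussian) = 0"
    if w: "w \<in> span (bas A)" for w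
  proof -
    have "w \<in> span (v ` A)" using w by (simp add: bas)
    then obtain c where "w = (\<Sum>z\<in>v ` A. c z *\<^sub>R z)"
      by (auto simp: span_finite)
    then have wc: "w = (\<Sum>i\<in>A. c (v i) *\<^sub>R v i)"
      using assms(1) by (simp add: sum.reindex inj_on_subset[OF assms(1)])
    \<comment> \<open>Moving the colouring by \<open>\<epsilon> *\<^sub>R u\<close> changes only
      coordinates in \<open>A\<close> and moves \<open>p\<close> by
      \<open>\<epsilon> *\<^sub>R w\<close>. Since those coordinates of \<open>x\<close> are
      interior, small steps of either sign stay in \<open>C\<close>, so \<open>x\<close> maximises
      along \<open>w\<close>.\<close>
    define u :: "real ^ 'n" where "u = (\<chi> i. if i \<in> A then c (v i) else 0)"
    have "(\<Sum>i\<in>UNIV. (u $ i) *\<^sub>R v i) = (\<Sum>i\<in>UNIV. if i \<in> A then c (v i) *\<^sub>R v i else 0)"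
      by (intro sum.cong) (auto simp: u_def)
    also have "\<dots> = w" unfolding wc by (simp add: sum.If_cases)
    finally have wu: "(\<Sum>i\<in>UNIV. (u $ i) *\<^sub>R v i) = w" .
    have pu: "pt (x + \<epsilon> *\<^sub>R u) = p + \<epsilon> *\<^sub>R w" for \<epsilon>
      by (simp add: pt_def p_def wu[symmetric] scaleR_left_distrib sum.distrib scaleR_sum_right)
    have "\<forall>\<^sub>F \<epsilon> in nhds 0. x + \<epsilon> *\<^sub>R u \<in> C"
    proof -
      have "\<forall>\<^sub>F \<epsilon> in nhds 0. x $ i + \<epsilon> * u $ i \<in> {-1<..<1}" if "i \<in> A" for i
      proof (rule topological_tendstoD)
        have "((\<lambda>\<epsilon>. x $ i + \<epsilon> * u $ i) \<longlongrightarrow> x $ i + 0 * u $ i) (nhds 0)"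
          by (intro tendsto_intros filterlim_ident)
        then show "((\<lambda>\<epsilon>. x $ i + \<epsilon> * u $ i) \<longlongrightarrow> x $ i) (nhds 0)" by simp
      qed (use interior[OF that] in auto)
      then have "\<forall>\<^sub>F \<epsilon> in nhds 0. \<forall>i\<in>A. x $ i + \<epsilon> * u $ i \<in> {-1<..<1}"
        by (intro eventually_ball_finite) auto
      then show ?thesis
      proof eventually_elim
        case (elim \<epsilon>)
        then show ?case using x by (force simp: C u_def)
      qed
    qed
    then obtain \<delta> where \<delta>: "0 < \<delta>" "\<And>\<epsilon>. \<bar>\<epsilon>\<bar> < \<delta> \<Longrightarrow> x + \<epsilon> *\<^sub>R u \<in> C"
      by (auto simp: eventually_nhds_metric dist_real_def)
    show ?thesis
    proof (rule section_measure_critical[OF _ bas(1) w \<delta>(1)])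
      show "section_measure K (bas A) (p + \<epsilon> *\<^sub>R w) \<le> section_measure K (bas A) p" if "\<bar>\<epsilon>\<bar> < \<delta>" for \<epsilon>
        using max[OF \<delta>(2)[OF that]] by (simp add: F_def pu p_def)
    qed measurable
  qed
  have "p \<in> K"
    by (rule mem_of_centred_section[OF K bas(1) _ centred]) (use Fx m in \<open>auto simp: F_def p_def\<close>)
  define W where "W = span (v ` A)"
  define S where "S = (\<lambda>y. y - p) ` K \<inter> W"
  have WB: "W = span (bas A)" by (simp add: W_def bas)
  have inS: "y \<in> S \<longleftrightarrow> p + y \<in> K \<and> y \<in> W" for y
    by (auto simp: S_def image_iff algebra_simps intro!: bexI[of _ "p + y"])
  have "closed S"
    unfolding S_def W_def
    by (intro closed_Int closed_span) (use closed_translation[OF K(1), of "- p"] in simp)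
  then have [measurable]: "S \<in> sets borel" by (rule borel_closed)
  have projS: "orth_proj (bas A) y \<in> S \<longleftrightarrow> p + orth_proj (bas A) y \<in> K" for y
    using proj_in_span[of "bas A" y] by (simp add: inS WB)
  have "measure (gaussian_subspace W) S = measure std_gaussian {y. orth_proj (bas A) y \<in> S}"
    unfolding WB gaussian_subspace_eq[OF bas(1)] by (subst measure_distr) (auto simp: vimage_def)
  also have "\<dots> = F A x" by (simp add: projS F_def section_measure_def p_def)
  finally have "m \<le> measure (gaussian_subspace W) S" using Fx by simp
  moreover have "(LINT y:S|lborel_subspace W. exp (- (norm y)\<^sup>2 / 2) *\<^sub>R y) = 0"
    unfolding WB by (rule barycenter_subspace[OF bas(1)]) (simp_all add: projS centred)
  ultimately show ?thesis
    using cube \<open>p \<in> K\<close>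
    by (intro exI[of _ x]) (simp add: Let_def Ax pt_def[symmetric] p_def[symmetric] W_def[symmetric] S_def[symmetric] m_def del: greaterThanLessThan_iff)
qed

end
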